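(* Consider the equi-energy (EE) sampler described in the context, with $0<p_{ee}<1$. Suppose (i) the highest-order chain $X^{(K)}$ (a Metropolis–Hastings chain with target $\pi_K$) is irreducible and aperiodic; (ii) for each $i=0,1,\dots,K-1$, the Metropolis–Hastings transition kernel $T^{(i)}_{MH}$ used for the local moves of $X^{(i)}$ (which has $\pi_i$ as a stationary distribution) connects adjacent energy sets, in the sense that for every $j$ there exist sets $A_1,A_2\subset D_j$, $B_1\subset D_{j-1}$, $B_2\subset D_{j+1}$ of positive measure with $T^{(i)}_{MH}(A_1,B_1)>0$ and $T^{(i)}_{MH}(A_2,B_2)>0$ (whenever $D_{j-1}$, resp. $D_{j+1}$, exists); and (iii) $p^{(i)}_j:=P_{\pi_i}(X\in D_j)>0$ for all $i$ and $j$. Then for every $i=0,1,\dots,K$ the chain $X^{(i)}$ is ergodic with steady-state distribution $\pi_i$; in particular $X^{(0)}$ has steady-state distribution $\pi_0=\pi$.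
   Context: Target: $\pi(x)\propto\exp(-h(x))$ on a state space $\mathcal X$. Fix energy levels $H_0<H_1<\dots<H_K<H_{K+1}=\infty$ with $H_0\le\inf_x h(x)$ and temperatures $1=T_0<T_1<\dots<T_K$. For $0\le i\le K$ let $h_i(x)=\frac1{T_i}\max(h(x),H_i)$ and $\pi_i(x)\propto\exp(-h_i(x))$, so $\pi_0=\pi$. Energy sets: $D_j=\{x: h(x)\in[H_j,H_{j+1})\}$, $0\le j\le K$, partitioning $\mathcal X$; $I(x)=j$ iff $x\in D_j$. EE sampler: chain $X^{(K)}$ is a plain Metropolis–Hastings chain targeting $\pi_K$. Chains are started successively from $i=K$ down to $0$ (chain $i$ starts after chain $i+1$ has run for a burn-in $B$ plus $N$ steps). After its burn-in, every sample of chain $X^{(i)}$ is added to the energy ring $\hat D^{(i)}_{I(X^{(i)}_n)}$, where the energy ring $\hat D^{(i)}_j$ is the (growing) collection of post-burn-in samples of chain $i$ lying in $D_j$. For $i<K$, given $X^{(i)}_n=x$: if $\hat D^{(i+1)}_{I(x)}$ is empty, perform an MH step with kernel $T^{(i)}_{MH}$; otherwise, with probability $1-p_{ee}$ perform an MH step with kernel $T^{(i)}_{MH}$ (targeting $\pi_i$), and with probability $p_{ee}$ perform an equi-energy jump: draw $y$ uniformly from $\hat D^{(i+1)}_{I(x)}$ and set $X^{(i)}_{n+1}=y$ with probability $\min\!\big(1,\frac{\pi_i(y)\pi_{i+1}(x)}{\pi_i(x)\pi_{i+1}(y)}\big)$, else $X^{(i)}_{n+1}=x$. Lower-order chains do not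 affect higher-order chains. "Ergodic with steady-state distribution $\pi_i$" means the distribution of $X^{(i)}_n$ converges to $\pi_i$ as $n\to\infty$. *)

theory Defs
  imports "HOL-Probability.Probability"
begin

definition ee_f :: "('a \<Rightarrow> real) \<Rightarrow> (nat \<Rightarrow> real) \<Rightarrow> (nat \<Rightarrow> real) \<Rightarrow> nat \<Rightarrow> 'a \<Rightarrow> real" where
  "ee_f h H Tm i x = exp (- (max (h x) (H i) / Tm i))"

definition ee_pi :: "'a measure \<Rightarrow> ('a \<Rightarrow> real) \<Rightarrow> (nat \<Rightarrow> real) \<Rightarrow> (nat \<Rightarrow> real) \<Rightarrow> nat \<Rightarrow> 'a measure" where
  "ee_pi M h H Tm i =
     density M (\<lambda>x. ennreal (ee_f h H Tm i x / (\<integral>y. ee_f h H Tm i y \<partial>M)))"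

text \<open>Energy set D_j = {x. H_j \<le> h x < H_(j+1)}, with H_(K+1) = \<infinity>.\<close>
definition ee_D :: "'a measure \<Rightarrow> ('a \<Rightarrow> real) \<Rightarrow> nat \<Rightarrow> (nat \<Rightarrow> real) \<Rightarrow> nat \<Rightarrow> 'a set" where
  "ee_D M h K H j = {x \<in> space M. H j \<le> h x \<and> (j < K \<longrightarrow> h x < H (Suc j))}"

text \<open>Energy index I(x) = j iff x \<in> D_j.\<close>
definition ee_I :: "('a \<Rightarrow> real) \<Rightarrow> nat \<Rightarrow> (nat \<Rightarrow> real) \<Rightarrow> 'a \<Rightarrow> nat" where
  "ee_I h K H x = Max {j. j \<le> K \<and> H j \<le> h x}"

definition mh_acc :: "('a \<Rightarrow> real) \<Rightarrow> ('a \<Rightarrow> 'a \<Rightarrow> real) \<Rightarrow> 'a \<Rightarrow> 'a \<Rightarrow> real" where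
  "mh_acc f q x y = min 1 ((f y * q y x) / (f x * q x y))"

definition MH_kernel :: "'a measure \<Rightarrow> ('a \<Rightarrow> real) \<Rightarrow> ('a \<Rightarrow> 'a \<Rightarrow> real) \<Rightarrow> 'a \<Rightarrow> 'a measure" where
  "MH_kernel M f q x = measure_of (space M) (sets M)
     (\<lambda>A. (\<integral>\<^sup>+ y\<in>A. ennreal (q x y * mh_acc f q x y) \<partial>M)
          + (1 - (\<integral>\<^sup>+ y. ennreal (q x y * mh_acc f q x y) \<partial>M)) * indicator A x)"

primrec kpow :: "'a measure \<Rightarrow> ('a \<Rightarrow> 'a measure) \<Rightarrow> nat \<Rightarrow> 'a \<Rightarrow> 'a measure" where
  "kpow M P 0 x = return M x"
| "kpow M P (Suc n) x = bind (kpow M P n x) P"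

definition irreducible_kernel :: "'a measure \<Rightarrow> ('a \<Rightarrow> 'a measure) \<Rightarrow> bool" where
  "irreducible_kernel M P \<longleftrightarrow>
     (\<exists>\<phi>. sets \<phi> = sets M \<and> sigma_finite_measure \<phi> \<and> emeasure \<phi> (space M) > 0 \<and>
        (\<forall>x\<in>space M. \<forall>A\<in>sets M. emeasure \<phi> A > 0 \<longrightarrow>
            (\<exists>n>0. emeasure (kpow M P n x) A > 0)))"

text \<open>Aperiodicity (Tierney 1994): there is no d \<ge> 2 and no family of nonempty disjoint
  measurable sets E_0..E_(d-1) cycled with probability one.\<close>
definition aperiodic_kernel :: "'a measure \<Rightarrow> ('a \<Rightarrow> 'a measure) \<Rightarrow> bool" where
  "aperiodic_kernel M P \<longleftrightarrow>
     \<not> (\<exists>d::nat. d \<ge> 2 \<and> (\<exists>E. (\<forall>k<d. E k \<in> sets M \<and> E k \<noteq> {}) \<and>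
          disjoint_family_on E {..<d} \<and>
          (\<forall>k<d. \<forall>x\<in>E k. emeasure (P x) (E (Suc k mod d)) = 1)))"

definition kernel_set_trans :: "'a measure \<Rightarrow> ('a \<Rightarrow> 'a measure) \<Rightarrow> 'a set \<Rightarrow> 'a set \<Rightarrow> ennreal" where
  "kernel_set_trans M P A B = (\<integral>\<^sup>+ x\<in>A. emeasure (P x) B \<partial>M)"

text \<open>Parameters: reference measure M, energy h, K, levels H, temperatures Tm,
  proposal densities q i, p_ee, burn-in B, N, initial points x0.
  The joint history is omega :: nat => nat => 'a, omega i n = X^(i)_n.\<close>

definition ee_start :: "nat \<Rightarrow> nat \<Rightarrow> nat \<Rightarrow> nat \<Rightarrow> nat" where
  "ee_start K B N i = (K - i) * (B + N)"

definition ee_Tmh :: "'a measure \<Rightarrow> ('a \<Rightarrow> real) \<Rightarrow> (nat \<Rightarrow> real) \<Rightarrow> (nat \<Rightarrow> real)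
    \<Rightarrow> (nat \<Rightarrow> 'a \<Rightarrow> 'a \<Rightarrow> real) \<Rightarrow> nat \<Rightarrow> 'a \<Rightarrow> 'a measure" where
  "ee_Tmh M h H Tm q i = MH_kernel M (ee_f h H Tm i) (q i)"

definition mix_measure :: "real \<Rightarrow> 'a measure \<Rightarrow> 'a measure \<Rightarrow> 'a measure" where
  "mix_measure p P Q = bind (measure_pmf (bernoulli_pmf p)) (\<lambda>b. if b then P else Q)"

definition ee_jump :: "'a measure \<Rightarrow> ('a \<Rightarrow> real) \<Rightarrow> (nat \<Rightarrow> real) \<Rightarrow> (nat \<Rightarrow> real)
    \<Rightarrow> nat \<Rightarrow> 'a \<Rightarrow> 'a \<Rightarrow> 'a measure" where
  "ee_jump M h H Tm i x y =
     bind (measure_pmf (bernoulli_pmf (min 1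
        ((ee_f h H Tm i y * ee_f h H Tm (Suc i) x) / (ee_f h H Tm i x * ee_f h H Tm (Suc i) y)))))
      (\<lambda>b. return M (if b then y else x))"

text \<open>Ring of chain i+1 available to chain i at its local step n: indices m of
  post-burn-in samples X^(i+1)_m (B \<le> m \<le> n+B+N) lying in the energy set of X^(i)_n.
  (When chain i is at local time n, chain i+1 is at local time n+B+N.)\<close>
definition ee_ring :: "('a \<Rightarrow> real) \<Rightarrow> nat \<Rightarrow> (nat \<Rightarrow> real) \<Rightarrow> nat \<Rightarrow> nat
    \<Rightarrow> nat \<Rightarrow> nat \<Rightarrow> (nat \<Rightarrow> nat \<Rightarrow> 'a) \<Rightarrow> nat set" where
  "ee_ring h K H B N i n \<omega> =
     {m. B \<le> m \<and> m \<le> n + B + N \<and> ee_I h K H (\<omega> (Suc i) m) = ee_I h K H (\<omega> i n)}"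

definition ee_next :: "'a measure \<Rightarrow> ('a \<Rightarrow> real) \<Rightarrow> nat \<Rightarrow> (nat \<Rightarrow> real) \<Rightarrow> (nat \<Rightarrow> real)
    \<Rightarrow> (nat \<Rightarrow> 'a \<Rightarrow> 'a \<Rightarrow> real) \<Rightarrow> real \<Rightarrow> nat \<Rightarrow> nat
    \<Rightarrow> nat \<Rightarrow> nat \<Rightarrow> (nat \<Rightarrow> nat \<Rightarrow> 'a) \<Rightarrow> 'a measure" where
  "ee_next M h K H Tm q pee B N i n \<omega> =
     (let x = \<omega> i n; R = ee_ring h K H B N i n \<omega> in
      if i = K \<or> R = {} then ee_Tmh M h H Tm q i x
      else mix_measure pee
             (bind (measure_pmf (pmf_of_set R)) (\<lambda>m. ee_jump M h H Tm i x (\<omega> (Suc i) m)))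
             (ee_Tmh M h H Tm q i x))"

definition ee_space :: "'a measure \<Rightarrow> (nat \<Rightarrow> nat \<Rightarrow> 'a) measure" where
  "ee_space M = PiM UNIV (\<lambda>_. PiM UNIV (\<lambda>_. M))"

text \<open>One global time step t \<rightarrow> t+1: every chain i already started (start time
  (K-i)(B+N) \<le> t) makes one move, independently given the history.\<close>
definition ee_step :: "'a measure \<Rightarrow> ('a \<Rightarrow> real) \<Rightarrow> nat \<Rightarrow> (nat \<Rightarrow> real) \<Rightarrow> (nat \<Rightarrow> real)
    \<Rightarrow> (nat \<Rightarrow> 'a \<Rightarrow> 'a \<Rightarrow> real) \<Rightarrow> real \<Rightarrow> nat \<Rightarrow> nat
    \<Rightarrow> nat \<Rightarrow> (nat \<Rightarrow> nat \<Rightarrow> 'a) \<Rightarrow> (nat \<Rightarrow> nat \<Rightarrow> 'a) measure" where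
  "ee_step M h K H Tm q pee B N t \<omega> =
     distr (PiM {..K} (\<lambda>i. if ee_start K B N i \<le> t
                             then ee_next M h K H Tm q pee B N i (t - ee_start K B N i) \<omega>
                             else return M (\<omega> i 0)))
           (ee_space M)
           (\<lambda>v i n. if i \<le> K \<and> ee_start K B N i \<le> t \<and> n = Suc (t - ee_start K B N i)
                    then v i else \<omega> i n)"

definition ee_init :: "'a measure \<Rightarrow> nat \<Rightarrow> (nat \<Rightarrow> 'a) \<Rightarrow> nat \<Rightarrow> nat \<Rightarrow> 'a" where
  "ee_init M K x0 i n = (if i \<le> K then x0 i else (SOME x. x \<in> space M))"

primrec ee_law :: "'a measure \<Rightarrow> ('a \<Rightarrow> real) \<Rightarrow> nat \<Rightarrow> (nat \<Rightarrow> real) \<Rightarrow> (nat \<Rightarrow> real)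
    \<Rightarrow> (nat \<Rightarrow> 'a \<Rightarrow> 'a \<Rightarrow> real) \<Rightarrow> real \<Rightarrow> nat \<Rightarrow> nat \<Rightarrow> (nat \<Rightarrow> 'a)
    \<Rightarrow> nat \<Rightarrow> (nat \<Rightarrow> nat \<Rightarrow> 'a) measure" where
  "ee_law M h K H Tm q pee B N x0 0 = return (ee_space M) (ee_init M K x0)"
| "ee_law M h K H Tm q pee B N x0 (Suc t) =
     bind (ee_law M h K H Tm q pee B N x0 t) (ee_step M h K H Tm q pee B N t)"

text \<open>Distribution of X^(i)_n (fixed from global time start_i + n on).\<close>
definition ee_dist :: "'a measure \<Rightarrow> ('a \<Rightarrow> real) \<Rightarrow> nat \<Rightarrow> (nat \<Rightarrow> real) \<Rightarrow> (nat \<Rightarrow> real)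
    \<Rightarrow> (nat \<Rightarrow> 'a \<Rightarrow> 'a \<Rightarrow> real) \<Rightarrow> real \<Rightarrow> nat \<Rightarrow> nat \<Rightarrow> (nat \<Rightarrow> 'a)
    \<Rightarrow> nat \<Rightarrow> nat \<Rightarrow> 'a measure" where
  "ee_dist M h K H Tm q pee B N x0 i n =
     distr (ee_law M h K H Tm q pee B N x0 (ee_start K B N i + n)) M (\<lambda>\<omega>. \<omega> i n)"

end

theory Submission
  imports Defs
begin

text \<open>
  The chains are treated from \<open>i = K\<close> down to \<open>i = 0\<close>, and for each of them one proves an asymptotic
  decorrelation property: \<open>E [\<phi> (X\<^sub>n) (g (X\<^sub>m\<^sub>+\<^sub>k) - \<pi> g)]\<close> is small for a suitable \<open>k\<close>, all large \<open>m\<close>,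
  all \<open>n \<le> m\<close> and all \<open>\<bar>\<phi>\<bar> \<le> 1\<close>. It contains the convergence of the marginals and, by bounding
  covariances, gives an \<open>L\<^sup>2\<close> law of large numbers for the chain.

  For \<open>i = K\<close> the Metropolis kernel \<open>P\<close> is reversible, so \<open>\<langle>P\<^sup>n f, P\<^sup>m f\<rangle>\<close> depends on \<open>n + m\<close> only and
  \<open>P\<^sup>2\<^sup>n f\<close> is Cauchy in \<open>L\<^sup>2(\<pi>)\<close>. Its limit is invariant under \<open>P\<^sup>2\<close>, hence constant by irreducibility
  and aperiodicity. As \<open>P(x, _)\<close> has a density apart from an atom at \<open>x\<close>, this convergence in mean
  carries over to every starting point. No countability of the \<open>\<sigma>\<close>-algebra is needed.

  For \<open>i < K\<close> compare a step of chain \<open>i\<close> with the operator \<open>S\<close> in which the energy ring is replaced by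
  \<open>\<pi>\<^sub>i\<^sub>+\<^sub>1\<close> conditioned on the energy set. The weight \<open>w = \<pi>\<^sub>i / \<pi>\<^sub>i\<^sub>+\<^sub>1\<close> is bounded, so a jump from \<open>D\<^sub>j\<close> dominates
  a multiple of \<open>\<pi>\<^sub>i\<close> on \<open>D\<^sub>j\<close>; since the local moves connect adjacent energy sets, a power of \<open>S\<close> satisfies a
  Doeblin condition and \<open>S\<^sup>k g\<close> tends to \<open>\<pi>\<^sub>i g\<close> uniformly. The acceptance probability \<open>min 1 (w y / w x)\<close>
  depends on \<open>x\<close> through a real number only, so finitely many brackets and the law of large
  numbers for chain \<open>i + 1\<close> make the error of one step small in mean, uniformly in the state.
\<close>

section \<open>Bounded functions and Markov kernels\<close>

definition bfun :: "'a measure \<Rightarrow> ('a \<Rightarrow> real) set" where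
  "bfun M = {g \<in> borel_measurable M. \<exists>C. \<forall>x\<in>space M. \<bar>g x\<bar> \<le> C}"

lemma bfunI: "g \<in> borel_measurable M \<Longrightarrow> (\<And>x. x \<in> space M \<Longrightarrow> \<bar>g x\<bar> \<le> C) \<Longrightarrow> g \<in> bfun M"
  unfolding bfun_def by auto

lemma bfun_measurable[measurable_dest]: "g \<in> bfun M \<Longrightarrow> g \<in> borel_measurable M"
  unfolding bfun_def by auto

lemma bfun_bounded:
  assumes "g \<in> bfun M" shows "\<exists>C>0. \<forall>x\<in>space M. \<bar>g x\<bar> \<le> C"
proof -
  obtain C where C: "\<forall>x\<in>space M. \<bar>g x\<bar> \<le> C" using assms unfolding bfun_def by auto
  show ?thesis by (rule exI[of _ "max C 1"]) (use C in \<open>auto simp: le_max_iff_disj\<close>)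
qed

lemma bfun_const[simp, intro]: "(\<lambda>_. c) \<in> bfun M"
  by (rule bfunI[where C="\<bar>c\<bar>"]) auto

lemma bfun_add[intro]:
  assumes f: "f \<in> bfun M" and g: "g \<in> bfun M" shows "(\<lambda>x. f x + g x) \<in> bfun M"
proof -
  obtain C where C: "\<forall>x\<in>space M. \<bar>f x\<bar> \<le> C" using bfun_bounded[OF f] by blast
  obtain D where D: "\<forall>x\<in>space M. \<bar>g x\<bar> \<le> D" using bfun_bounded[OF g] by blast
  have [measurable]: "f \<in> borel_measurable M" "g \<in> borel_measurable M" by (rule bfun_measurable, fact)+
  show ?thesis
  proof (rule bfunI[where C="C + D"])
    fix x assume x: "x \<in> space M"
    show "\<bar>f x + g x\<bar> \<le> C + D" using C[rule_format, OF x] D[rule_format, OF x] by linarith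
  qed measurable
qed

lemma bfun_uminus[intro]: "f \<in> bfun M \<Longrightarrow> (\<lambda>x. - f x) \<in> bfun M"
  by (frule bfun_measurable, drule bfun_bounded, erule exE, rule bfunI) auto

lemma bfun_diff[intro]: "f \<in> bfun M \<Longrightarrow> g \<in> bfun M \<Longrightarrow> (\<lambda>x. f x - g x) \<in> bfun M"
  using bfun_add[OF _ bfun_uminus, of f M g] by simp

lemma bfun_mult[intro]:
  assumes f: "f \<in> bfun M" and g: "g \<in> bfun M" shows "(\<lambda>x. f x * g x) \<in> bfun M"
proof -
  obtain C where C: "C > 0" "\<forall>x\<in>space M. \<bar>f x\<bar> \<le> C" using bfun_bounded[OF f] by blast
  obtain D where D: "D > 0" "\<forall>x\<in>space M. \<bar>g x\<bar> \<le> D" using bfun_bounded[OF g] by blast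
  have [measurable]: "f \<in> borel_measurable M" "g \<in> borel_measurable M" by (rule bfun_measurable, fact)+
  show ?thesis
  proof (rule bfunI[where C="C * D"])
    fix x assume "x \<in> space M"
    then have "\<bar>f x\<bar> \<le> C" "\<bar>g x\<bar> \<le> D" using C D by auto
    then show "\<bar>f x * g x\<bar> \<le> C * D" unfolding abs_mult by (intro mult_mono') auto
  qed measurable
qed

lemma bfun_abs[intro]: "f \<in> bfun M \<Longrightarrow> (\<lambda>x. \<bar>f x\<bar>) \<in> bfun M"
  by (frule bfun_measurable, drule bfun_bounded, erule exE, rule bfunI) auto

lemma bfun_max[intro]:
  assumes f: "f \<in> bfun M" and g: "g \<in> bfun M" shows "(\<lambda>x. max (f x) (g x)) \<in> bfun M"
proof -
  have "(\<lambda>x. 1/2 * ((f x + g x) + \<bar>f x - g x\<bar>)) \<in> bfun M" by (intro bfun_mult bfun_add bfun_abs bfun_diff bfun_const f g)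
  moreover have "1/2 * ((a + b) + \<bar>a - b\<bar>) = max a b" for a b :: real by (auto simp: max_def)
  ultimately show ?thesis by simp
qed

lemma bfun_power2[intro]: "f \<in> bfun M \<Longrightarrow> (\<lambda>x. (f x)\<^sup>2) \<in> bfun M"
  unfolding power2_eq_square by auto

lemma bfun_indicator[intro]: "A \<in> sets M \<Longrightarrow> (indicator A :: _ \<Rightarrow> real) \<in> bfun M"
  by (rule bfunI[where C=1]) (auto simp: indicator_def)

lemma bfun_sum[intro]: "(\<And>i. i \<in> I \<Longrightarrow> f i \<in> bfun M) \<Longrightarrow> (\<lambda>x. \<Sum>i\<in>I. f i x) \<in> bfun M"
proof (induction I rule: infinite_finite_induct)
  case (insert i I)
  then show ?case using bfun_add[of "f i" M "\<lambda>x. \<Sum>i\<in>I. f i x"] by simp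
qed simp_all

lemma bfun_compose: "g \<in> bfun N \<Longrightarrow> X \<in> M \<rightarrow>\<^sub>M N \<Longrightarrow> (\<lambda>w. g (X w)) \<in> bfun M"
  by (frule bfun_measurable, drule bfun_bounded, erule exE, rule bfunI) (auto dest: measurable_space)

lemma bfun_integrable:
  assumes "g \<in> bfun M" "finite_measure N" "sets N = sets M"
  shows "integrable N g"
proof -
  interpret finite_measure N by fact
  obtain C where C: "C > 0" "\<forall>x\<in>space M. \<bar>g x\<bar> \<le> C" using bfun_bounded[OF assms(1)] by blast
  have "space N = space M" by (rule sets_eq_imp_space_eq) fact
  moreover have "g \<in> borel_measurable N" using assms(1,3) bfun_measurable by (metis measurable_cong_sets)
  ultimately show ?thesis using C by (intro integrable_const_bound[of _ C]) auto
qed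

lemma (in prob_space) abs_integral_le_bound:
  fixes g :: "'a \<Rightarrow> real"
  assumes "\<And>x. x \<in> space M \<Longrightarrow> \<bar>g x\<bar> \<le> C"
  shows "\<bar>\<integral>x. g x \<partial>M\<bar> \<le> C"
proof (cases "integrable M g")
  case True
  have "\<bar>\<integral>x. g x \<partial>M\<bar> \<le> (\<integral>x. \<bar>g x\<bar> \<partial>M)" by simp
  also have "\<dots> \<le> (\<integral>x. C \<partial>M)" using True assms by (intro integral_mono) auto
  finally show ?thesis by (simp add: prob_space)
next
  case False
  obtain x where "x \<in> space M" using not_empty by auto
  then have "0 \<le> C" using assms[of x] by linarith
  then show ?thesis using False by (simp add: not_integrable_integral_eq)
qed

definition kop :: "('a \<Rightarrow> 'a measure) \<Rightarrow> ('a \<Rightarrow> real) \<Rightarrow> 'a \<Rightarrow> real" where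
  "kop P g x = (\<integral>y. g y \<partial>P x)"

locale markov_kernel =
  fixes M :: "'a measure" and P :: "'a \<Rightarrow> 'a measure"
  assumes kernel: "P \<in> M \<rightarrow>\<^sub>M prob_algebra M"
begin

lemma kernel_subprob[measurable]: "P \<in> M \<rightarrow>\<^sub>M subprob_algebra M"
  using kernel by (rule measurable_prob_algebraD)

lemma prob_P: "x \<in> space M \<Longrightarrow> prob_space (P x)"
  using measurable_space[OF kernel] by (auto simp: space_prob_algebra)

lemma sets_P: "x \<in> space M \<Longrightarrow> sets (P x) = sets M"
  using measurable_space[OF kernel] by (auto simp: space_prob_algebra)

lemma space_P: "x \<in> space M \<Longrightarrow> space (P x) = space M"
  using sets_P sets_eq_imp_space_eq by blast

lemma integrable_P: "x \<in> space M \<Longrightarrow> g \<in> bfun M \<Longrightarrow> integrable (P x) g"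
  using prob_P sets_P by (auto intro!: bfun_integrable prob_space.finite_measure)

lemma kop_abs_le_const: "x \<in> space M \<Longrightarrow> (\<And>y. y \<in> space M \<Longrightarrow> \<bar>g y\<bar> \<le> C) \<Longrightarrow> \<bar>kop P g x\<bar> \<le> C"
  unfolding kop_def using prob_P space_P by (intro prob_space.abs_integral_le_bound) auto

lemma kop_bfun[intro]: assumes "g \<in> bfun M" shows "kop P g \<in> bfun M"
proof -
  obtain C where C: "C > 0" "\<forall>x\<in>space M. \<bar>g x\<bar> \<le> C" using bfun_bounded[OF assms] by blast
  note [measurable] = bfun_measurable[OF assms]
  show ?thesis
  proof (rule bfunI[where C=C])
    show "kop P g \<in> borel_measurable M" unfolding kop_def by measurable
  qed (use kop_abs_le_const C in auto)
qed

lemma kop_funpow_bfun[intro]: "g \<in> bfun M \<Longrightarrow> (kop P ^^ n) g \<in> bfun M"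
  by (induction n) auto

lemma kop_const[simp]: "x \<in> space M \<Longrightarrow> kop P (\<lambda>_. c) x = c"
  unfolding kop_def using prob_P[of x] by (simp add: prob_space.prob_space)

lemma kop_add: "x \<in> space M \<Longrightarrow> f \<in> bfun M \<Longrightarrow> g \<in> bfun M \<Longrightarrow> kop P (\<lambda>y. f y + g y) x = kop P f x + kop P g x"
  unfolding kop_def by (intro Bochner_Integration.integral_add integrable_P)

lemma kop_diff: "x \<in> space M \<Longrightarrow> f \<in> bfun M \<Longrightarrow> g \<in> bfun M \<Longrightarrow> kop P (\<lambda>y. f y - g y) x = kop P f x - kop P g x"
  unfolding kop_def by (intro Bochner_Integration.integral_diff integrable_P)

lemma kop_cmult: "kop P (\<lambda>y. c * g y) x = c * kop P g x"
  unfolding kop_def by simp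

lemma kop_mono:
  "x \<in> space M \<Longrightarrow> f \<in> bfun M \<Longrightarrow> g \<in> bfun M \<Longrightarrow> (\<And>y. y \<in> space M \<Longrightarrow> f y \<le> g y) \<Longrightarrow> kop P f x \<le> kop P g x"
  unfolding kop_def using space_P by (intro integral_mono integrable_P) auto

lemma kop_cong: "x \<in> space M \<Longrightarrow> (\<And>y. y \<in> space M \<Longrightarrow> f y = g y) \<Longrightarrow> kop P f x = kop P g x"
  unfolding kop_def using space_P by (intro Bochner_Integration.integral_cong) auto

lemma kop_abs_le: "\<bar>kop P g x\<bar> \<le> kop P (\<lambda>y. \<bar>g y\<bar>) x"
  unfolding kop_def by simp

lemma kop_nonneg: "x \<in> space M \<Longrightarrow> (\<And>y. y \<in> space M \<Longrightarrow> 0 \<le> g y) \<Longrightarrow> 0 \<le> kop P g x"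
  unfolding kop_def using space_P by (intro integral_nonneg_AE) auto

lemma kop_indicator: "x \<in> space M \<Longrightarrow> A \<in> sets M \<Longrightarrow> kop P (indicator A) x = measure (P x) A"
  unfolding kop_def using prob_P[of x] sets_P[of x] sets.sets_into_space[of A M]
  by (simp add: prob_space.finite_measure space_P Int_absorb2)

lemma kop_square_le:
  assumes x: "x \<in> space M" and g: "g \<in> bfun M"
  shows "(kop P g x)\<^sup>2 \<le> kop P (\<lambda>y. (g y)\<^sup>2) x"
proof -
  let ?c = "kop P g x"
  have "0 \<le> kop P (\<lambda>y. (g y - ?c)\<^sup>2) x" using x by (intro kop_nonneg) auto
  also have "\<dots> = kop P (\<lambda>y. ((g y)\<^sup>2 + ?c\<^sup>2) - (2 * ?c) * g y) x"
    by (simp add: power2_diff algebra_simps)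
  also have "\<dots> = kop P (\<lambda>y. (g y)\<^sup>2) x + ?c\<^sup>2 - (2 * ?c) * ?c"
  proof -
    have "(\<lambda>y. (g y)\<^sup>2) \<in> bfun M" "(\<lambda>y. (2 * ?c) * g y) \<in> bfun M" "(\<lambda>y. (g y)\<^sup>2 + ?c\<^sup>2) \<in> bfun M"
      using g by (intro bfun_power2 bfun_mult bfun_add bfun_const; simp)+
    then show ?thesis using x by (simp only: kop_diff kop_add bfun_const kop_const kop_cmult)
  qed
  finally show ?thesis by (simp add: power2_eq_square)
qed

lemma emeasure_P_eq_1_iff: "x \<in> space M \<Longrightarrow> A \<in> sets M \<Longrightarrow> emeasure (P x) A = 1 \<longleftrightarrow> measure (P x) A = 1"
  using prob_P[of x] by (simp add: prob_space.finite_measure finite_measure.emeasure_eq_measure)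

lemma measure_P_Int:
  assumes x: "x \<in> space M" and A: "A \<in> sets M" "B \<in> sets M" and "measure (P x) A = 1" "measure (P x) B = 1"
  shows "measure (P x) (A \<inter> B) = 1"
proof -
  interpret prob_space "P x" by (rule prob_P[OF x])
  have "AE y in P x. y \<in> A" "AE y in P x. y \<in> B"
    using assms sets_P[OF x] by (auto simp: AE_in_set_eq_1)
  then have "AE y in P x. y \<in> A \<inter> B" by auto
  then show ?thesis using A sets_P[OF x] by (subst (asm) AE_in_set_eq_1) auto
qed

lemma measure_P_mono_1:
  assumes x: "x \<in> space M" and A: "A \<in> sets M" "B \<in> sets M" and "measure (P x) A = 1" "A \<subseteq> B"
  shows "measure (P x) B = 1"
proof -
  interpret prob_space "P x" by (rule prob_P[OF x])
  have "measure (P x) A \<le> measure (P x) B" using assms sets_P[OF x] by (intro finite_measure_mono) auto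
  then show ?thesis using assms prob_le_1[of B] by simp
qed

lemma measure_P_compl:
  assumes x: "x \<in> space M" and A: "A \<in> sets M"
  shows "measure (P x) (space M - A) = 1 - measure (P x) A"
  using prob_space.prob_compl[OF prob_P[OF x], of A] A sets_P[OF x] space_P[OF x] by simp

lemma measure_P_measurable[measurable]: "A \<in> sets M \<Longrightarrow> (\<lambda>x. measure (P x) A) \<in> borel_measurable M"
  using measurable_compose[OF kernel_subprob measurable_measure_subprob_algebra] .

definition absorbing :: "'a set \<Rightarrow> bool" where
  "absorbing S \<longleftrightarrow> S \<in> sets M \<and> (\<forall>x\<in>S. measure (P x) S = 1)"

lemma absorbing_sets: "absorbing S \<Longrightarrow> S \<in> sets M"
  unfolding absorbing_def by blast

lemma absorbing_space: "absorbing S \<Longrightarrow> x \<in> S \<Longrightarrow> x \<in> space M"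
  using absorbing_sets sets.sets_into_space by blast

lemma prob_kpow: "x \<in> space M \<Longrightarrow> kpow M P n x \<in> space (prob_algebra M)"
proof (induction n)
  case 0
  then show ?case by (simp add: space_prob_algebra prob_space_return)
next
  case (Suc n)
  then have s: "sets (kpow M P n x) = sets M" "prob_space (kpow M P n x)" by (auto simp: space_prob_algebra)
  have "P \<in> kpow M P n x \<rightarrow>\<^sub>M prob_algebra M" using kernel s by (simp cong: measurable_cong_sets)
  then show ?case using s
    using prob_space_bind'[of "kpow M P n x" M P M] sets_bind'[of "kpow M P n x" M P M] kernel
    by (auto simp: space_prob_algebra)
qed

lemma kpow_absorbing:
  assumes S: "absorbing S" and x: "x \<in> S"
  shows "emeasure (kpow M P n x) S = 1"
proof (induction n)
  case 0
  then show ?case using S x by (auto simp: absorbing_def)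
next
  case (Suc n)
  have SM: "S \<in> sets M" and xM: "x \<in> space M" using absorbing_sets[OF S] absorbing_space[OF S x] .
  have s: "sets (kpow M P n x) = sets M" "prob_space (kpow M P n x)"
    using prob_kpow[OF xM] by (auto simp: space_prob_algebra)
  interpret p: prob_space "kpow M P n x" by fact
  have sp: "space (kpow M P n x) = space M" using s(1) by (rule sets_eq_imp_space_eq)
  have AE: "AE y in kpow M P n x. y \<in> S"
    using Suc SM s by (subst p.AE_in_set_eq_1) (auto simp: p.emeasure_eq_measure)
  have "emeasure (kpow M P (Suc n) x) S = (\<integral>\<^sup>+y. emeasure (P y) S \<partial>kpow M P n x)"
    using SM xM sp s kernel_subprob by (subst kpow.simps, subst emeasure_bind[where N=M]) (auto cong: measurable_cong_sets)
  also have "\<dots> = (\<integral>\<^sup>+y. 1 \<partial>kpow M P n x)"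
  proof (rule nn_integral_cong_AE)
    have "emeasure (P y) S = 1" if "y \<in> S" for y
      using that S SM emeasure_P_eq_1_iff[of y S] sets.sets_into_space[OF SM] by (auto simp: absorbing_def)
    then show "AE y in kpow M P n x. emeasure (P y) S = 1" using AE by auto
  qed
  also have "\<dots> = 1" by (simp add: p.emeasure_space_1)
  finally show ?case .
qed

lemma irreducible_no_disjoint_absorbing:
  assumes irr: "irreducible_kernel M P" and A: "absorbing A" and B: "absorbing B"
    and ne: "A \<noteq> {}" "B \<noteq> {}" and dj: "A \<inter> B = {}"
  shows False
proof -
  obtain \<phi> where \<phi>: "sets \<phi> = sets M" "emeasure \<phi> (space M) > 0"
    "\<And>x A. x \<in> space M \<Longrightarrow> A \<in> sets M \<Longrightarrow> emeasure \<phi> A > 0 \<Longrightarrow> \<exists>n>0. emeasure (kpow M P n x) A > 0"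
    using irr unfolding irreducible_kernel_def by blast
  have null: "emeasure \<phi> (space M - S) = 0" if S: "absorbing S" and ne: "S \<noteq> {}" for S
  proof (rule ccontr)
    assume *: "emeasure \<phi> (space M - S) \<noteq> 0"
    obtain x where x: "x \<in> S" using ne by auto
    have SM: "S \<in> sets M" and xM: "x \<in> space M" using absorbing_sets[OF S] absorbing_space[OF S x] .
    obtain n where n: "emeasure (kpow M P n x) (space M - S) > 0"
      using \<phi>(3)[OF xM sets.compl_sets[OF SM]] * by (metis zero_less_iff_neq_zero)
    have s: "sets (kpow M P n x) = sets M" "prob_space (kpow M P n x)"
      using prob_kpow[OF xM] by (auto simp: space_prob_algebra)
    interpret p: prob_space "kpow M P n x" by fact
    have sp: "space (kpow M P n x) = space M" using s(1) by (rule sets_eq_imp_space_eq)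
    show False using n p.prob_compl[of S] SM s sp kpow_absorbing[OF S x, of n] by (simp add: p.emeasure_eq_measure)
  qed
  have S: "A \<in> sets \<phi>" "B \<in> sets \<phi>" "space M \<in> sets \<phi>" using A B \<phi>(1) by (auto simp: absorbing_def)
  have "emeasure \<phi> (space M) \<le> emeasure \<phi> ((space M - A) \<union> (space M - B))"
    using dj S by (intro emeasure_mono) auto
  also have "\<dots> \<le> emeasure \<phi> (space M - A) + emeasure \<phi> (space M - B)"
    using S by (intro emeasure_subadditive) auto
  also have "\<dots> = 0" using null A B ne by simp
  finally show False using \<phi>(2) by simp
qed

end

locale stationary_kernel = markov_kernel M P + pi: prob_space \<pi>
  for M :: "'a measure" and P and \<pi> :: "'a measure" +
  assumes sets_pi: "sets \<pi> = sets M"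
    and stationary: "g \<in> bfun M \<Longrightarrow> (\<integral>x. kop P g x \<partial>\<pi>) = (\<integral>x. g x \<partial>\<pi>)"
begin

lemma space_pi: "space \<pi> = space M" using sets_pi by (rule sets_eq_imp_space_eq)

lemma integrable_pi: "g \<in> bfun M \<Longrightarrow> integrable \<pi> g"
  using sets_pi pi.finite_measure_axioms by (auto intro!: bfun_integrable)

lemma measurable_pi: "measurable \<pi> N = measurable M N"
  using sets_pi by (rule measurable_cong_sets) simp

lemma kop_contract_L1:
  assumes "g \<in> bfun M" shows "(\<integral>x. \<bar>kop P g x\<bar> \<partial>\<pi>) \<le> (\<integral>x. \<bar>g x\<bar> \<partial>\<pi>)"
proof -
  have "(\<integral>x. \<bar>kop P g x\<bar> \<partial>\<pi>) \<le> (\<integral>x. kop P (\<lambda>y. \<bar>g y\<bar>) x \<partial>\<pi>)"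
    using assms by (intro integral_mono integrable_pi) (auto intro: kop_abs_le)
  then show ?thesis using stationary[OF bfun_abs[OF assms]] by linarith
qed

lemma integral_measure_P:
  assumes A: "A \<in> sets M" shows "(\<integral>x. measure (P x) A \<partial>\<pi>) = measure \<pi> A"
proof -
  have "(\<integral>x. measure (P x) A \<partial>\<pi>) = (\<integral>x. kop P (indicator A) x \<partial>\<pi>)"
    using A space_pi kop_indicator by (intro Bochner_Integration.integral_cong) auto
  also have "\<dots> = measure \<pi> A"
    using A stationary[of "indicator A"] sets.sets_into_space[OF A] by (simp add: bfun_indicator space_pi Int_absorb2)
  finally show ?thesis .
qed

lemma AE_measure_P:
  assumes A: "A \<in> sets M" and 1: "measure \<pi> A = 1"
  shows "AE x in \<pi>. measure (P x) A = 1"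
proof -
  have b: "(\<lambda>x. measure (P x) A) \<in> bfun M"
    using A by (intro bfunI[where C=1] measure_P_measurable) (auto simp: prob_space.prob_le_1[OF prob_P])
  have "(\<integral>x. 1 - measure (P x) A \<partial>\<pi>) = 0"
    using integrable_pi[OF b] integral_measure_P[OF A] 1 by (simp add: pi.prob_space)
  moreover have "AE x in \<pi>. 0 \<le> 1 - measure (P x) A"
    using space_pi prob_P prob_space.prob_le_1 by (intro AE_I2) force
  ultimately have "AE x in \<pi>. 1 - measure (P x) A = 0"
    using b by (subst (asm) integral_nonneg_eq_0_iff_AE) (auto intro!: integrable_pi)
  then show ?thesis by auto
qed

lemma full_contains_absorbing:
  assumes G: "G \<in> sets M" and 1: "measure \<pi> G = 1"
  obtains G' where "absorbing G'" "G' \<subseteq> G" "measure \<pi> G' = 1"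
proof -
  define F where "F = rec_nat G (\<lambda>_ S. {x\<in>S. measure (P x) S = 1})"
  have F0: "F 0 = G" and FS: "F (Suc n) = {x\<in>F n. measure (P x) (F n) = 1}" for n by (auto simp: F_def)
  have Fs: "F n \<in> sets M \<and> measure \<pi> (F n) = 1" for n
  proof (induction n)
    case 0 then show ?case using G 1 by (simp add: F0)
  next
    case (Suc n)
    have [measurable]: "F n \<in> sets M" using Suc by simp
    have "F (Suc n) = F n \<inter> {x\<in>space M. measure (P x) (F n) = 1}"
      using sets.sets_into_space[of "F n" M] by (auto simp: FS)
    also have "\<dots> \<in> sets M" by measurable
    finally have s: "F (Suc n) \<in> sets M" .
    have "AE x in \<pi>. x \<in> F n" using Suc sets_pi by (subst pi.AE_in_set_eq_1) auto
    moreover have "AE x in \<pi>. measure (P x) (F n) = 1" using Suc by (intro AE_measure_P) auto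
    ultimately have "AE x in \<pi>. x \<in> F (Suc n)" by eventually_elim (auto simp: FS)
    then show ?case using s sets_pi by (subst (asm) pi.AE_in_set_eq_1) auto
  qed
  have dec: "decseq F" by (rule decseq_SucI) (auto simp: FS)
  define G' where "G' = (\<Inter>n. F n)"
  have G's: "G' \<in> sets M" using Fs unfolding G'_def by auto
  have "absorbing G'" unfolding absorbing_def
  proof (intro conjI ballI)
    fix x assume x: "x \<in> G'"
    then have xM: "x \<in> space M" using G's sets.sets_into_space by auto
    interpret p: prob_space "P x" using prob_P xM .
    have "(\<lambda>n. measure (P x) (F n)) \<longlonglongrightarrow> measure (P x) (\<Inter>n. F n)"
      using Fs sets_P[OF xM] dec by (intro p.finite_Lim_measure_decseq) auto
    moreover have "measure (P x) (F n) = 1" for n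
    proof -
      have "x \<in> F (Suc n)" using x unfolding G'_def by blast
      then show ?thesis by (simp add: FS)
    qed
    ultimately show "measure (P x) G' = 1" unfolding G'_def by (simp add: LIMSEQ_const_iff)
  qed fact
  moreover have "G' \<subseteq> G" unfolding G'_def using F0 by auto
  moreover have "(\<lambda>n. measure \<pi> (F n)) \<longlonglongrightarrow> measure \<pi> (\<Inter>n. F n)"
    using Fs sets_pi dec by (intro pi.finite_Lim_measure_decseq) auto
  then have "measure \<pi> G' = 1" using Fs unfolding G'_def by (simp add: LIMSEQ_const_iff)
  ultimately show ?thesis using that by blast
qed

end


section \<open>Reversible kernels\<close>

locale reversible_kernel = stationary_kernel +
  assumes reversible: "f \<in> bfun M \<Longrightarrow> g \<in> bfun M \<Longrightarrow>
    (\<integral>x. f x * kop P g x \<partial>\<pi>) = (\<integral>x. kop P f x * g x \<partial>\<pi>)"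

context stationary_kernel
begin

lemma kop_zero_imp_zero_set:
  assumes x: "x \<in> space M" and \<phi>: "\<phi> \<in> bfun M" "\<And>y. y \<in> space M \<Longrightarrow> 0 \<le> \<phi> y" and 0: "kop P \<phi> x = 0"
  shows "measure (P x) {y\<in>space M. \<phi> y = 0} = 1"
proof -
  interpret p: prob_space "P x" by (rule prob_P[OF x])
  note [measurable] = bfun_measurable[OF \<phi>(1)]
  have "AE y in P x. \<phi> y = 0"
    using 0 \<phi> integrable_P[OF x \<phi>(1)] space_P[OF x] unfolding kop_def
    by (subst (asm) integral_nonneg_eq_0_iff_AE) auto
  then have "AE y in P x. y \<in> {y\<in>space M. \<phi> y = 0}"
    using AE_space by eventually_elim (simp add: space_P[OF x])
  then show ?thesis using sets_P[OF x] by (subst (asm) p.AE_in_set_eq_1) auto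
qed

text \<open>A set that is invariant for two steps is split by the value of \<open>P y A \<in> {0, 1}\<close> into
  a part that is invariant for one step and a part on which the chain has period two.\<close>

lemma two_step_invariant_trivial:
  assumes irr: "irreducible_kernel M P" and aper: "aperiodic_kernel M P"
    and A: "A \<in> sets M"
    and in_A: "AE x in \<pi>. x \<in> A \<longrightarrow> measure (P x) {y\<in>space M. measure (P y) A = 1} = 1"
    and out_A: "AE x in \<pi>. x \<notin> A \<longrightarrow> measure (P x) {y\<in>space M. measure (P y) A = 0} = 1"
  shows "measure \<pi> A = 0 \<or> measure \<pi> A = 1"
proof -
  define A1 where "A1 = {y\<in>space M. measure (P y) A = 1}"
  define A0 where "A0 = {y\<in>space M. measure (P y) A = 0}"
  have [measurable]: "A \<in> sets M" by fact
  have A1[measurable]: "A1 \<in> sets M" unfolding A1_def by measurable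
  have A0[measurable]: "A0 \<in> sets M" unfolding A0_def by measurable
  have AE1: "AE x in \<pi>. measure (P x) (A1 \<union> A0) = 1"
    using in_A out_A AE_space unfolding A1_def[symmetric] A0_def[symmetric]
  proof eventually_elim
    case (elim x)
    then have x: "x \<in> space M" using space_pi by simp
    show ?case
      by (cases "x \<in> A") (use elim x measure_P_mono_1[OF x] A1 A0 sets.Un[OF A1 A0] in blast)+
  qed
  have "measure \<pi> (A1 \<union> A0) = (\<integral>x. measure (P x) (A1 \<union> A0) \<partial>\<pi>)"
    by (rule integral_measure_P[symmetric]) simp
  also have "\<dots> = (\<integral>x. 1 \<partial>\<pi>)" using AE1 by (intro integral_cong_AE) (auto simp: measurable_pi)
  finally have "measure \<pi> (A1 \<union> A0) = 1" by (simp add: pi.prob_space)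
  then have AE2: "AE x in \<pi>. x \<in> A1 \<union> A0" using sets_pi by (subst pi.AE_in_set_eq_1) auto
  define G where "G = {x\<in>space M. (x \<in> A \<longrightarrow> measure (P x) A1 = 1) \<and> (x \<notin> A \<longrightarrow> measure (P x) A0 = 1) \<and> x \<in> A1 \<union> A0}"
  have G[measurable]: "G \<in> sets M" unfolding G_def by measurable
  have "AE x in \<pi>. x \<in> G" using in_A out_A AE_space AE2 unfolding A1_def[symmetric] A0_def[symmetric]
    by eventually_elim (simp add: G_def space_pi)
  then have "measure \<pi> G = 1" using sets_pi by (subst (asm) pi.AE_in_set_eq_1) auto
  then obtain G' where G': "absorbing G'" "G' \<subseteq> G" "measure \<pi> G' = 1"
    using full_contains_absorbing[OF G] by metis
  have G's[measurable]: "G' \<in> sets M" using G'(1) by (rule absorbing_sets)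
  have C[measurable]: "space M - A \<in> sets M" by simp
  have Cm: "measure (P x) (space M - A) = 1" if "x \<in> A0" for x
    using that measure_P_compl[OF _ A, of x] by (auto simp: A0_def)
  have Gm: "measure (P x) G' = 1" "x \<in> space M" if "x \<in> G'" for x
    using that G'(1) absorbing_space[OF G'(1)] by (auto simp: absorbing_def)
  define E0 where "E0 = A \<inter> A0 \<inter> G'"
  define E1 where "E1 = (space M - A) \<inter> A1 \<inter> G'"
  define F1 where "F1 = A \<inter> A1 \<inter> G'"
  define F0 where "F0 = (space M - A) \<inter> A0 \<inter> G'"
  note s[measurable] = A A1 A0 G's C
  have st: "E0 \<in> sets M" "E1 \<in> sets M" "F1 \<in> sets M" "F0 \<in> sets M"
    unfolding E0_def E1_def F1_def F0_def by auto
  have e0: "measure (P x) E1 = 1" if "x \<in> E0" for x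
  proof -
    have "x \<in> A" "x \<in> A0" "x \<in> G'" "x \<in> G" using that G'(2) by (auto simp: E0_def)
    then show ?thesis unfolding E1_def using Cm Gm s by (intro measure_P_Int) (auto simp: G_def)
  qed
  have e1: "measure (P x) E0 = 1" if "x \<in> E1" for x
  proof -
    have "x \<notin> A" "x \<in> A1" "x \<in> G'" "x \<in> G" using that G'(2) by (auto simp: E1_def)
    then show ?thesis unfolding E0_def using Gm s by (intro measure_P_Int) (auto simp: G_def A1_def)
  qed
  have f1: "absorbing F1" unfolding absorbing_def
  proof (intro conjI ballI)
    fix x assume "x \<in> F1"
    then have "x \<in> A" "x \<in> A1" "x \<in> G'" "x \<in> G" using G'(2) by (auto simp: F1_def)
    then show "measure (P x) F1 = 1" unfolding F1_def using Gm s by (intro measure_P_Int) (auto simp: G_def A1_def)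
  qed (rule st)
  have f0: "absorbing F0" unfolding absorbing_def
  proof (intro conjI ballI)
    fix x assume "x \<in> F0"
    then have "x \<notin> A" "x \<in> A0" "x \<in> G'" "x \<in> G" using G'(2) by (auto simp: F0_def)
    then show "measure (P x) F0 = 1" unfolding F0_def using Cm Gm s by (intro measure_P_Int) (auto simp: G_def)
  qed (rule st)
  have "E0 = {} \<or> E1 = {}"
  proof (rule ccontr)
    assume ne: "\<not> ?thesis"
    define E where "E = (\<lambda>k::nat. if k = 0 then E0 else E1)"
    have "\<forall>k<2. E k \<in> sets M \<and> E k \<noteq> {}" using ne st by (auto simp: E_def)
    moreover have "disjoint_family_on E {..<2}"
      by (auto simp: disjoint_family_on_def E_def E0_def E1_def)
    moreover have "\<forall>k<2. \<forall>x\<in>E k. emeasure (P x) (E (Suc k mod 2)) = 1"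
    proof (intro allI impI ballI)
      fix k :: nat and x assume k: "k < 2" and x: "x \<in> E k"
      have xM: "x \<in> space M" using x Gm(2) by (auto simp: E_def E0_def E1_def split: if_splits)
      show "emeasure (P x) (E (Suc k mod 2)) = 1"
      proof (cases "k = 0")
        case True
        then show ?thesis using x e0[of x] st emeasure_P_eq_1_iff[OF xM, of E1] by (simp add: E_def)
      next
        case False
        then have "k = 1" using k by simp
        then show ?thesis using x e1[of x] st emeasure_P_eq_1_iff[OF xM, of E0] by (simp add: E_def)
      qed
    qed
    ultimately show False using aper unfolding aperiodic_kernel_def by blast
  qed
  then have E: "E0 = {}" "E1 = {}"
    using e0 e1 by (metis all_not_in_conv measure_empty zero_neq_one)+
  have "F1 = {} \<or> F0 = {}"
    using irreducible_no_disjoint_absorbing[OF irr f1 f0] by (auto simp: F1_def F0_def)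
  moreover have "G' \<subseteq> E0 \<union> E1 \<union> F0 \<union> F1"
    using G'(2) unfolding E0_def E1_def F0_def F1_def G_def by blast
  ultimately have "G' \<subseteq> A \<or> G' \<inter> A = {}" using E by (auto simp: F1_def F0_def)
  then show ?thesis
  proof
    assume "G' \<subseteq> A"
    then have "measure \<pi> G' \<le> measure \<pi> A" using sets_pi A by (intro pi.finite_measure_mono) auto
    then show ?thesis using G'(3) pi.prob_le_1[of A] by simp
  next
    assume "G' \<inter> A = {}"
    then have "measure \<pi> (G' \<union> A) = measure \<pi> G' + measure \<pi> A"
      using sets_pi A by (intro pi.finite_measure_Union) auto
    then show ?thesis using G'(3) pi.prob_le_1[of "G' \<union> A"] measure_nonneg[of \<pi> A] by linarith
  qed
qed

lemma two_step_harmonic_const: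
  assumes irr: "irreducible_kernel M P" and aper: "aperiodic_kernel M P"
    and g: "g \<in> bfun M" and inv: "AE x in \<pi>. kop P (kop P g) x = g x"
  shows "AE x in \<pi>. g x = (\<integral>y. g y \<partial>\<pi>)"
proof -
  define c where "c = (\<integral>y. g y \<partial>\<pi>)"
  define \<phi> where "\<phi> = (\<lambda>x. max (g x - c) 0)"
  have \<phi>: "\<phi> \<in> bfun M" unfolding \<phi>_def using g by (intro bfun_max bfun_diff) auto
  have gc: "(\<lambda>x. g x - c) \<in> bfun M" using g by (intro bfun_diff) auto
  define A where "A = {x\<in>space M. c < g x}"
  note [measurable] = bfun_measurable[OF g] bfun_measurable[OF \<phi>]
  have A[measurable]: "A \<in> sets M" unfolding A_def by measurable
  let ?T = "kop P" let ?J = "indicator A :: _ \<Rightarrow> real"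
  have ge: "AE x in \<pi>. \<phi> x \<le> ?T (?T \<phi>) x"
    using inv AE_space
  proof eventually_elim
    case (elim x)
    then have x: "x \<in> space M" by (simp add: space_pi)
    have "?T (\<lambda>x. g x - c) y \<le> ?T \<phi> y" if "y \<in> space M" for y
      using that gc \<phi> by (intro kop_mono) (auto simp: \<phi>_def)
    then have "?T (?T (\<lambda>x. g x - c)) x \<le> ?T (?T \<phi>) x" using x gc \<phi> by (intro kop_mono[OF x kop_bfun kop_bfun]) auto
    moreover have "?T (?T (\<lambda>x. g x - c)) x = ?T (\<lambda>y. ?T g y - c) x"
      using x g by (intro kop_cong) (auto simp: kop_diff)
    moreover have "\<dots> = g x - c" using x g elim by (subst kop_diff) auto
    moreover have "0 \<le> ?T (?T \<phi>) x" using x by (intro kop_nonneg) (auto simp: \<phi>_def)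
    ultimately show ?case by (simp add: \<phi>_def)
  qed
  have "(\<integral>x. ?T (?T \<phi>) x - \<phi> x \<partial>\<pi>) = 0"
    using \<phi> stationary[of "?T \<phi>"] stationary[of \<phi>] by (subst Bochner_Integration.integral_diff) (auto intro!: integrable_pi)
  then have eq: "AE x in \<pi>. ?T (?T \<phi>) x = \<phi> x"
    using ge \<phi> by (subst (asm) integral_nonneg_eq_0_iff_AE) (auto intro!: integrable_pi Bochner_Integration.integrable_diff)
  have sub: "AE x in \<pi>. x \<notin> A \<longrightarrow> measure (P x) {y\<in>space M. measure (P y) A = 0} = 1"
    using eq AE_space
  proof (eventually_elim, intro impI)
    fix x assume e: "?T (?T \<phi>) x = \<phi> x" and x: "x \<in> space \<pi>" and nA: "x \<notin> A"
    have x: "x \<in> space M" using x by (simp add: space_pi)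
    have "\<phi> x = 0" using nA x by (auto simp: A_def \<phi>_def)
    then have 1: "measure (P x) {y\<in>space M. ?T \<phi> y = 0} = 1"
      using x \<phi> e by (intro kop_zero_imp_zero_set kop_bfun) (auto intro!: kop_nonneg simp: \<phi>_def)
    have "measure (P y) A = 0" if y: "y \<in> space M" "?T \<phi> y = 0" for y
    proof -
      have "measure (P y) {z\<in>space M. \<phi> z = 0} = 1"
        using y \<phi> by (intro kop_zero_imp_zero_set) (auto simp: \<phi>_def)
      moreover have "{z\<in>space M. \<phi> z = 0} = space M - A" by (auto simp: A_def \<phi>_def)
      ultimately show ?thesis using measure_P_compl[OF y(1) A] by simp
    qed
    then show "measure (P x) {y\<in>space M. measure (P y) A = 0} = 1"
      using bfun_measurable[OF kop_bfun[OF \<phi>]]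
      by (intro measure_P_mono_1[OF x _ _ 1]) auto
  qed
  have bA: "?J \<in> bfun M" "?T ?J \<in> bfun M" "?T (?T ?J) \<in> bfun M" using A by (intro kop_bfun bfun_indicator; simp)+
  have Tind: "?T ?J y = measure (P y) A" if "y \<in> space M" for y using that A by (rule kop_indicator)
  have T1: "0 \<le> ?T (?T ?J) x \<and> ?T (?T ?J) x \<le> 1" if "x \<in> space M" for x
  proof -
    have "\<bar>?T (?T ?J) x\<bar> \<le> 1" using that by (intro kop_abs_le_const) (auto simp: indicator_def)
    moreover have "0 \<le> ?T (?T ?J) x" using that by (intro kop_nonneg) auto
    ultimately show ?thesis by linarith
  qed
  have z: "AE x in \<pi>. x \<notin> A \<longrightarrow> ?T (?T ?J) x = 0"
    using sub AE_space
  proof (eventually_elim, intro impI)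
    fix x assume s: "x \<notin> A \<longrightarrow> measure (P x) {y\<in>space M. measure (P y) A = 0} = 1" and x: "x \<in> space \<pi>" and nA: "x \<notin> A"
    have x: "x \<in> space M" using x by (simp add: space_pi)
    interpret p: prob_space "P x" by (rule prob_P[OF x])
    have "AE y in P x. y \<in> {y\<in>space M. measure (P y) A = 0}"
      using s nA sets_P[OF x] by (subst p.AE_in_set_eq_1) auto
    then have "AE y in P x. ?T ?J y = 0" by eventually_elim (auto simp: Tind)
    then show "?T (?T ?J) x = 0" unfolding kop_def[of P "kop P ?J"] using integral_eq_zero_AE by blast
  qed
  have "(\<integral>x. ?J x - ?T (?T ?J) x \<partial>\<pi>) = 0"
    using bA stationary[of "?T ?J"] stationary[of ?J] by (subst Bochner_Integration.integral_diff) (auto intro!: integrable_pi)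
  moreover have "AE x in \<pi>. 0 \<le> ?J x - ?T (?T ?J) x"
    using z AE_space by eventually_elim (use T1 space_pi in \<open>auto simp: indicator_def\<close>)
  ultimately have eq1: "AE x in \<pi>. ?J x - ?T (?T ?J) x = 0"
    using bA by (subst (asm) integral_nonneg_eq_0_iff_AE) (auto intro!: integrable_pi Bochner_Integration.integrable_diff)
  have sub1: "AE x in \<pi>. x \<in> A \<longrightarrow> measure (P x) {y\<in>space M. measure (P y) A = 1} = 1"
    using eq1 AE_space
  proof (eventually_elim, intro impI)
    fix x assume e: "?J x - ?T (?T ?J) x = 0" and x: "x \<in> space \<pi>" and xA: "x \<in> A"
    have x: "x \<in> space M" using x by (simp add: space_pi)
    have b: "(\<lambda>y. 1 - ?T ?J y) \<in> bfun M" using bA by auto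
    have "?T (\<lambda>y. 1 - ?T ?J y) x = 0" using x bA e xA by (subst kop_diff) auto
    moreover have "0 \<le> 1 - ?T ?J y" if "y \<in> space M" for y
      using Tind[OF that] prob_space.prob_le_1[OF prob_P[OF that], of A] by simp
    ultimately have "measure (P x) {y\<in>space M. 1 - ?T ?J y = 0} = 1"
      using x b by (intro kop_zero_imp_zero_set) auto
    moreover have "{y\<in>space M. 1 - ?T ?J y = 0} = {y\<in>space M. measure (P y) A = 1}" using Tind by auto
    ultimately show "measure (P x) {y\<in>space M. measure (P y) A = 1} = 1" by simp
  qed
  have "measure \<pi> A \<noteq> 1"
  proof
    assume "measure \<pi> A = 1"
    then have *: "AE x in \<pi>. x \<in> A" using sets_pi A by (subst pi.AE_in_set_eq_1) auto
    have "(\<integral>x. g x - c \<partial>\<pi>) = 0" using g by (simp add: c_def integrable_pi pi.prob_space)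
    moreover have "AE x in \<pi>. 0 \<le> g x - c" using * by eventually_elim (auto simp: A_def)
    ultimately have "AE x in \<pi>. g x - c = 0" using gc by (subst (asm) integral_nonneg_eq_0_iff_AE) (auto intro!: integrable_pi)
    then have "AE x in \<pi>. False" using * by eventually_elim (auto simp: A_def)
    then show False by simp
  qed
  then have "measure \<pi> A = 0" using two_step_invariant_trivial[OF irr aper A sub1 sub] by blast
  then have "measure \<pi> (space \<pi> - A) = 1" using A sets_pi by (subst pi.prob_compl) auto
  moreover have "space \<pi> - A \<in> sets \<pi>" using A by (simp add: sets_pi space_pi)
  ultimately have *: "AE x in \<pi>. x \<in> space \<pi> - A" by (simp only: pi.AE_in_set_eq_1)
  have "(\<integral>x. c - g x \<partial>\<pi>) = 0" using g by (simp add: c_def integrable_pi pi.prob_space)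
  moreover have "AE x in \<pi>. 0 \<le> c - g x" using * by eventually_elim (auto simp: A_def space_pi)
  ultimately have "AE x in \<pi>. c - g x = 0"
    using g by (subst (asm) integral_nonneg_eq_0_iff_AE) (auto intro!: integrable_pi bfun_diff)
  then show ?thesis by (auto simp: c_def)
qed

end

lemma (in prob_space) integral_abs_le_sqrt:
  fixes u :: "'a \<Rightarrow> real"
  assumes "integrable M u" "integrable M (\<lambda>x. (u x)\<^sup>2)"
  shows "(\<integral>x. \<bar>u x\<bar> \<partial>M) \<le> sqrt (\<integral>x. (u x)\<^sup>2 \<partial>M)"
proof (rule real_le_rsqrt)
  let ?c = "\<integral>x. \<bar>u x\<bar> \<partial>M"
  have "0 \<le> (\<integral>x. (\<bar>u x\<bar> - ?c)\<^sup>2 \<partial>M)" by simp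
  also have "\<dots> = (\<integral>x. (u x)\<^sup>2 + ?c\<^sup>2 - 2 * ?c * \<bar>u x\<bar> \<partial>M)"
    by (intro Bochner_Integration.integral_cong) (auto simp: power2_diff algebra_simps)
  also have "\<dots> = (\<integral>x. (u x)\<^sup>2 \<partial>M) + ?c\<^sup>2 - 2 * ?c * ?c"
    using assms by (simp add: prob_space)
  finally show "?c\<^sup>2 \<le> (\<integral>x. (u x)\<^sup>2 \<partial>M)" by (simp add: power2_eq_square)
qed

lemma (in finite_measure) L1_Cauchy_bounded_limit:
  fixes u :: "nat \<Rightarrow> 'a \<Rightarrow> real"
  assumes u: "\<And>n. u n \<in> borel_measurable M" and C: "\<And>n x. x \<in> space M \<Longrightarrow> \<bar>u n x\<bar> \<le> C"
    and cauchy: "\<And>e. e > 0 \<Longrightarrow> \<exists>N. \<forall>m\<ge>N. \<forall>n\<ge>N. (\<integral>x. \<bar>u m x - u n x\<bar> \<partial>M) \<le> e"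
  shows "\<exists>g\<in>borel_measurable M. (\<forall>x\<in>space M. \<bar>g x\<bar> \<le> C) \<and> (\<lambda>n. \<integral>x. \<bar>u n x - g x\<bar> \<partial>M) \<longlonglongrightarrow> 0"
proof -
  note [measurable] = u
  have int: "integrable M (u n)" for n using C by (intro integrable_const_bound[of _ C]) auto
  have "\<forall>k. \<exists>N. \<forall>m\<ge>N. \<forall>n\<ge>N. (\<integral>x. \<bar>u m x - u n x\<bar> \<partial>M) \<le> (1/2)^k" using cauchy by simp
  then obtain Nf where Nf: "\<And>k m n. m \<ge> Nf k \<Longrightarrow> n \<ge> Nf k \<Longrightarrow> (\<integral>x. \<bar>u m x - u n x\<bar> \<partial>M) \<le> (1/2)^k"
    by metis
  define r where "r = (\<lambda>k. \<Sum>j\<le>k. Nf j)"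
  have r1: "Nf k \<le> r k" for k unfolding r_def by (simp add: member_le_sum)
  have r2: "r k \<le> r (Suc k)" for k unfolding r_def by simp
  define v where "v = (\<lambda>k x. u (r (Suc k)) x - u (r k) x)"
  have [measurable]: "v k \<in> borel_measurable M" for k unfolding v_def by measurable
  have vint: "integrable M (v k)" for k unfolding v_def using int by auto
  have vb: "(\<integral>\<^sup>+x. ennreal \<bar>v k x\<bar> \<partial>M) \<le> ennreal ((1/2)^k)" for k
  proof -
    have "(\<integral>\<^sup>+x. ennreal \<bar>v k x\<bar> \<partial>M) = ennreal (\<integral>x. \<bar>v k x\<bar> \<partial>M)"
      using vint[of k] by (intro nn_integral_eq_integral) auto
    also have "\<dots> \<le> ennreal ((1/2)^k)" unfolding v_def
      using r1[of k] r2[of k] by (intro ennreal_leI Nf) auto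
    finally show ?thesis .
  qed
  have "(\<integral>\<^sup>+x. (\<Sum>k. ennreal \<bar>v k x\<bar>) \<partial>M) = (\<Sum>k. \<integral>\<^sup>+x. ennreal \<bar>v k x\<bar> \<partial>M)"
    by (intro nn_integral_suminf) measurable
  also have "\<dots> \<le> (\<Sum>k. ennreal ((1/2)^k))" by (intro suminf_le vb) auto
  also have "\<dots> = ennreal (\<Sum>k. (1/2)^k)" by (intro suminf_ennreal2) (auto simp: summable_geometric)
  also have "\<dots> < \<infinity>" by simp
  finally have "AE x in M. (\<Sum>k. ennreal \<bar>v k x\<bar>) \<noteq> \<infinity>"
    by (intro nn_integral_noteq_infinite) auto
  then have conv: "AE x in M. convergent (\<lambda>k. u (r k) x)"
  proof eventually_elim
    fix x assume *: "(\<Sum>k. ennreal \<bar>v k x\<bar>) \<noteq> \<infinity>"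
    have "summable (\<lambda>k. \<bar>v k x\<bar>)" using * by (intro summable_suminf_not_top) (auto simp: infinity_ennreal_def)
    then have "summable (\<lambda>k. v k x)" by (rule summable_rabs_cancel)
    then have "convergent (\<lambda>n. (\<Sum>k<n. v k x))" by (simp add: summable_iff_convergent)
    moreover have "(\<Sum>k<n. v k x) = u (r n) x - u (r 0) x" for n
      unfolding v_def by (rule sum_lessThan_telescope)
    ultimately have "convergent (\<lambda>n. u (r n) x - u (r 0) x)" by simp
    from convergent_add[OF this convergent_const[of "u (r 0) x"]] show "convergent (\<lambda>k. u (r k) x)" by simp
  qed
  define g where "g = (\<lambda>x. if convergent (\<lambda>k. u (r k) x) then lim (\<lambda>k. u (r k) x) else u 0 x)"
  have gm[measurable]: "g \<in> borel_measurable M" unfolding g_def Cauchy_convergent_iff[symmetric] by measurable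
  have gC: "\<bar>g x\<bar> \<le> C" if x: "x \<in> space M" for x
  proof (cases "convergent (\<lambda>k. u (r k) x)")
    case True
    then have "(\<lambda>k. u (r k) x) \<longlonglongrightarrow> g x" by (simp add: g_def convergent_LIMSEQ_iff)
    then have "(\<lambda>k. \<bar>u (r k) x\<bar>) \<longlonglongrightarrow> \<bar>g x\<bar>" by (rule tendsto_rabs)
    then show ?thesis by (rule LIMSEQ_le_const2) (use C[OF x] in auto)
  next
    case False then show ?thesis using C[OF x] by (simp add: g_def)
  qed
  have gint: "integrable M g" using gC by (intro integrable_const_bound[of _ C]) auto
  have "(\<lambda>k. \<integral>x. \<bar>u (r k) x - g x\<bar> \<partial>M) \<longlonglongrightarrow> (\<integral>x. 0 \<partial>M)"
  proof (rule integral_dominated_convergence[where w="\<lambda>x. 2 * C"])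
    show "AE x in M. (\<lambda>k. \<bar>u (r k) x - g x\<bar>) \<longlonglongrightarrow> 0"
      using conv
    proof eventually_elim
      fix x assume "convergent (\<lambda>k. u (r k) x)"
      then have "(\<lambda>k. u (r k) x) \<longlonglongrightarrow> g x" by (simp add: g_def convergent_LIMSEQ_iff)
      then show "(\<lambda>k. \<bar>u (r k) x - g x\<bar>) \<longlonglongrightarrow> 0" by (simp add: LIM_zero tendsto_rabs_zero)
    qed
    show "AE x in M. norm \<bar>u (r k) x - g x\<bar> \<le> 2 * C" for k
    proof (rule AE_I2)
      fix x assume x: "x \<in> space M"
      show "norm \<bar>u (r k) x - g x\<bar> \<le> 2 * C" using C[OF x, of "r k"] gC[OF x] by simp
    qed
  qed auto
  then have lim0: "(\<lambda>k. \<integral>x. \<bar>u (r k) x - g x\<bar> \<partial>M) \<longlonglongrightarrow> 0" by simp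
  have "(\<lambda>n. \<integral>x. \<bar>u n x - g x\<bar> \<partial>M) \<longlonglongrightarrow> 0"
  proof (rule LIMSEQ_I)
    fix e :: real assume e: "e > 0"
    obtain k0 where k0: "\<And>k. k \<ge> k0 \<Longrightarrow> \<bar>\<integral>x. \<bar>u (r k) x - g x\<bar> \<partial>M\<bar> < e/2"
      using LIMSEQ_D[OF lim0, of "e/2"] e by auto
    obtain k1 where k1: "(1/2::real)^k1 < e/2" using e real_arch_pow_inv[of "e/2" "1/2"] by auto
    define k where "k = max k0 k1"
    have kk: "(1/2::real)^k \<le> (1/2)^k1" by (intro power_decreasing) (auto simp: k_def)
    show "\<exists>no. \<forall>n\<ge>no. norm ((\<integral>x. \<bar>u n x - g x\<bar> \<partial>M) - 0) < e"
    proof (intro exI allI impI)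
      fix n assume n: "n \<ge> Nf k"
      have "(\<integral>x. \<bar>u n x - g x\<bar> \<partial>M) \<le> (\<integral>x. \<bar>u n x - u (r k) x\<bar> + \<bar>u (r k) x - g x\<bar> \<partial>M)"
        using int gint by (intro integral_mono) auto
      also have "\<dots> = (\<integral>x. \<bar>u n x - u (r k) x\<bar> \<partial>M) + (\<integral>x. \<bar>u (r k) x - g x\<bar> \<partial>M)"
        using int gint by (intro Bochner_Integration.integral_add) auto
      also have "\<dots> < e"
      proof -
        have "\<bar>\<integral>x. \<bar>u (r k) x - g x\<bar> \<partial>M\<bar> < e/2" by (rule k0) (simp add: k_def)
        then show ?thesis using Nf[of k n "r k", OF n r1] kk k1 by linarith
      qed
      finally show "norm ((\<integral>x. \<bar>u n x - g x\<bar> \<partial>M) - 0) < e" by simp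
    qed
  qed
  then show ?thesis using gm gC by blast
qed

context reversible_kernel
begin

lemma integral_funpow_mult:
  assumes f: "f \<in> bfun M" and g: "g \<in> bfun M"
  shows "(\<integral>x. (kop P ^^ n) f x * g x \<partial>\<pi>) = (\<integral>x. f x * (kop P ^^ n) g x \<partial>\<pi>)"
  using g
proof (induction n arbitrary: g)
  case (Suc n)
  have "(\<integral>x. (kop P ^^ Suc n) f x * g x \<partial>\<pi>) = (\<integral>x. (kop P ^^ n) f x * kop P g x \<partial>\<pi>)"
    using reversible[of "(kop P ^^ n) f" g] f Suc.prems by (simp add: kop_funpow_bfun)
  also have "\<dots> = (\<integral>x. f x * (kop P ^^ n) (kop P g) x \<partial>\<pi>)" using Suc by (intro Suc.IH kop_bfun)
  also have "(kop P ^^ n) (kop P g) = (kop P ^^ Suc n) g" by (simp add: funpow_swap1)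
  finally show ?case .
qed simp

theorem reversible_L1_convergence:
  assumes irr: "irreducible_kernel M P" and aper: "aperiodic_kernel M P" and f: "f \<in> bfun M"
  shows "(\<lambda>n. \<integral>x. \<bar>(kop P ^^ n) f x - (\<integral>y. f y \<partial>\<pi>)\<bar> \<partial>\<pi>) \<longlonglongrightarrow> 0"
proof -
  let ?T = "kop P"
  define u where "u = (\<lambda>n. (?T ^^ n) f)"
  have ub: "u n \<in> bfun M" for n using f by (auto simp: u_def)
  have uS: "u (Suc n) = ?T (u n)" for n by (simp add: u_def)
  obtain C where C: "C > 0" "\<forall>x\<in>space M. \<bar>f x\<bar> \<le> C" using bfun_bounded[OF f] by blast
  have uC: "\<bar>u n x\<bar> \<le> C" if "x \<in> space M" for n x
    using that by (induction n arbitrary: x) (auto simp: u_def C intro!: kop_abs_le_const)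
  define b where "b = (\<lambda>n. \<integral>x. f x * u n x \<partial>\<pi>)"
  have ip: "(\<integral>x. u n x * u m x \<partial>\<pi>) = b (n + m)" for n m
    using integral_funpow_mult[OF f ub[of m], of n] by (simp add: u_def b_def funpow_add)
  have b0: "0 \<le> b (2 * n)" for n
  proof -
    have "b (2 * n) = (\<integral>x. u n x * u n x \<partial>\<pi>)" by (simp add: ip mult_2)
    then show ?thesis by simp
  qed
  have bdec: "b (2 * Suc n) \<le> b (2 * n)" for n
  proof -
    have "b (2 * Suc n) = (\<integral>x. (u (Suc n) x)\<^sup>2 \<partial>\<pi>)"
      using ip[of "Suc n" "Suc n"] by (simp add: power2_eq_square mult_2)
    also have "\<dots> \<le> (\<integral>x. ?T (\<lambda>y. (u n y)\<^sup>2) x \<partial>\<pi>)" unfolding uS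
      using ub[of n] space_pi by (intro integral_mono integrable_pi bfun_power2 kop_bfun kop_square_le) auto
    also have "\<dots> = (\<integral>y. (u n y)\<^sup>2 \<partial>\<pi>)" by (intro stationary bfun_power2 ub)
    also have "\<dots> = b (2 * n)" using ip[of n n] by (simp add: power2_eq_square mult_2)
    finally show ?thesis .
  qed
  have "decseq (\<lambda>n. b (2 * n))" by (rule decseq_SucI) (use bdec in auto)
  then obtain L where L: "(\<lambda>n. b (2 * n)) \<longlonglongrightarrow> L" using b0 decseq_convergent[of "\<lambda>n. b (2 * n)" 0] by blast
  define v where "v = (\<lambda>n. u (2 * n))"
  have vb: "v n \<in> bfun M" for n using ub by (simp add: v_def)
  have sq: "(\<integral>x. (v m x - v n x)\<^sup>2 \<partial>\<pi>) = b (2 * (2 * m)) + b (2 * (2 * n)) - 2 * b (2 * (m + n))" for m n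
  proof -
    have i: "integrable \<pi> (\<lambda>x. v m x * v n x)" for m n using vb by (intro integrable_pi bfun_mult)
    have "(\<integral>x. (v m x - v n x)\<^sup>2 \<partial>\<pi>) = (\<integral>x. v m x * v m x + v n x * v n x - 2 * (v m x * v n x) \<partial>\<pi>)"
      by (intro Bochner_Integration.integral_cong) (auto simp: power2_eq_square algebra_simps)
    also have "\<dots> = (\<integral>x. v m x * v m x \<partial>\<pi>) + (\<integral>x. v n x * v n x \<partial>\<pi>) - 2 * (\<integral>x. v m x * v n x \<partial>\<pi>)"
      using i by simp
    also have "\<dots> = b (2 * m + 2 * m) + b (2 * n + 2 * n) - 2 * b (2 * m + 2 * n)" unfolding v_def ip ..
    finally show ?thesis by (simp only: mult_2[symmetric] distrib_left[symmetric])
  qed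
  have cauchy: "\<exists>N. \<forall>m\<ge>N. \<forall>n\<ge>N. (\<integral>x. \<bar>v m x - v n x\<bar> \<partial>\<pi>) \<le> e" if e: "e > 0" for e :: real
  proof -
    obtain N where N: "\<And>n. n \<ge> N \<Longrightarrow> \<bar>b (2 * n) - L\<bar> < e\<^sup>2 / 4"
      using LIMSEQ_D[OF L, of "e\<^sup>2/4"] e by auto
    show ?thesis
    proof (intro exI allI impI)
      fix m n assume m: "m \<ge> N" and n: "n \<ge> N"
      have "(\<integral>x. \<bar>v m x - v n x\<bar> \<partial>\<pi>) \<le> sqrt (\<integral>x. (v m x - v n x)\<^sup>2 \<partial>\<pi>)"
        using vb by (intro pi.integral_abs_le_sqrt integrable_pi bfun_power2 bfun_diff)
      also have "\<dots> \<le> sqrt (e\<^sup>2)" unfolding sq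
      proof (rule real_sqrt_le_mono)
        have "\<bar>b (2 * (2 * m)) - L\<bar> < e\<^sup>2 / 4" "\<bar>b (2 * (2 * n)) - L\<bar> < e\<^sup>2 / 4" "\<bar>b (2 * (m + n)) - L\<bar> < e\<^sup>2 / 4"
          by (rule N; use m n in simp)+
        then show "b (2 * (2 * m)) + b (2 * (2 * n)) - 2 * b (2 * (m + n)) \<le> e\<^sup>2" by linarith
      qed
      also have "\<dots> = e" using e by simp
      finally show "(\<integral>x. \<bar>v m x - v n x\<bar> \<partial>\<pi>) \<le> e" .
    qed
  qed
  have "\<exists>g\<in>borel_measurable \<pi>. (\<forall>x\<in>space \<pi>. \<bar>g x\<bar> \<le> C) \<and> (\<lambda>n. \<integral>x. \<bar>v n x - g x\<bar> \<partial>\<pi>) \<longlonglongrightarrow> 0"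
    using vb cauchy uC unfolding v_def
    by (intro pi.L1_Cauchy_bounded_limit) (auto simp: measurable_pi space_pi dest: bfun_measurable)
  then obtain g where g': "g \<in> borel_measurable M" "\<forall>x\<in>space M. \<bar>g x\<bar> \<le> C"
    and lim: "(\<lambda>n. \<integral>x. \<bar>v n x - g x\<bar> \<partial>\<pi>) \<longlonglongrightarrow> 0"
    unfolding measurable_pi space_pi by blast
  have g: "g \<in> bfun M" using g' by (auto intro: bfunI)
  have TT: "(\<integral>x. \<bar>?T (?T g) x - g x\<bar> \<partial>\<pi>) \<le> (\<integral>x. \<bar>v n x - g x\<bar> \<partial>\<pi>) + (\<integral>x. \<bar>v (Suc n) x - g x\<bar> \<partial>\<pi>)" for n
  proof -
    have d: "(\<lambda>x. v n x - g x) \<in> bfun M" using vb g by auto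
    have 1: "?T (?T (\<lambda>x. v n x - g x)) x = v (Suc n) x - ?T (?T g) x" if x: "x \<in> space M" for x
    proof -
      have "?T (?T (\<lambda>x. v n x - g x)) x = ?T (\<lambda>y. ?T (v n) y - ?T g y) x"
        using x vb g by (intro kop_cong) (auto intro!: kop_diff)
      also have "\<dots> = ?T (?T (v n)) x - ?T (?T g) x" using x vb g by (intro kop_diff kop_bfun)
      finally show ?thesis by (simp add: v_def uS)
    qed
    have "(\<integral>x. \<bar>v (Suc n) x - ?T (?T g) x\<bar> \<partial>\<pi>) = (\<integral>x. \<bar>?T (?T (\<lambda>x. v n x - g x)) x\<bar> \<partial>\<pi>)"
      using 1 space_pi by (intro Bochner_Integration.integral_cong) auto
    also have "\<dots> \<le> (\<integral>x. \<bar>?T (\<lambda>x. v n x - g x) x\<bar> \<partial>\<pi>)" using d by (intro kop_contract_L1 kop_bfun)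
    also have "\<dots> \<le> (\<integral>x. \<bar>v n x - g x\<bar> \<partial>\<pi>)" using d by (intro kop_contract_L1)
    finally have *: "(\<integral>x. \<bar>v (Suc n) x - ?T (?T g) x\<bar> \<partial>\<pi>) \<le> (\<integral>x. \<bar>v n x - g x\<bar> \<partial>\<pi>)" .
    have i: "integrable \<pi> (\<lambda>x. \<bar>v (Suc n) x - ?T (?T g) x\<bar>)" "integrable \<pi> (\<lambda>x. \<bar>v (Suc n) x - g x\<bar>)"
      "integrable \<pi> (\<lambda>x. \<bar>?T (?T g) x - g x\<bar>)"
      using vb g by (intro integrable_pi bfun_abs bfun_diff kop_bfun; simp)+
    have "(\<integral>x. \<bar>?T (?T g) x - g x\<bar> \<partial>\<pi>) \<le> (\<integral>x. \<bar>v (Suc n) x - ?T (?T g) x\<bar> + \<bar>v (Suc n) x - g x\<bar> \<partial>\<pi>)"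
      using i by (intro integral_mono) auto
    also have "\<dots> = (\<integral>x. \<bar>v (Suc n) x - ?T (?T g) x\<bar> \<partial>\<pi>) + (\<integral>x. \<bar>v (Suc n) x - g x\<bar> \<partial>\<pi>)"
      using i by (intro Bochner_Integration.integral_add) auto
    finally show ?thesis using * by linarith
  qed
  have "(\<lambda>n. (\<integral>x. \<bar>v n x - g x\<bar> \<partial>\<pi>) + (\<integral>x. \<bar>v (Suc n) x - g x\<bar> \<partial>\<pi>)) \<longlonglongrightarrow> 0 + 0"
    using lim LIMSEQ_Suc[OF lim] by (rule tendsto_add)
  then have "(\<integral>x. \<bar>?T (?T g) x - g x\<bar> \<partial>\<pi>) \<le> 0 + 0"
    by (rule LIMSEQ_le_const) (use TT in auto)
  moreover have "0 \<le> (\<integral>x. \<bar>?T (?T g) x - g x\<bar> \<partial>\<pi>)" by simp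
  ultimately have "(\<integral>x. \<bar>?T (?T g) x - g x\<bar> \<partial>\<pi>) = 0" by linarith
  then have "AE x in \<pi>. \<bar>?T (?T g) x - g x\<bar> = 0"
    using g by (subst (asm) integral_nonneg_eq_0_iff_AE) (auto intro!: integrable_pi bfun_abs bfun_diff kop_bfun)
  then have "AE x in \<pi>. ?T (?T g) x = g x" by simp
  then have gconst: "AE x in \<pi>. g x = (\<integral>y. g y \<partial>\<pi>)"
    using two_step_harmonic_const[OF irr aper g] by blast
  have vi: "(\<integral>x. v n x \<partial>\<pi>) = (\<integral>x. f x \<partial>\<pi>)" for n
  proof -
    have "(\<integral>x. u n x \<partial>\<pi>) = (\<integral>x. f x \<partial>\<pi>)" for n
      by (induction n) (auto simp: uS stationary[OF ub], simp add: u_def)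
    then show ?thesis by (simp add: v_def)
  qed
  have "\<bar>(\<integral>x. f x \<partial>\<pi>) - (\<integral>x. g x \<partial>\<pi>)\<bar> \<le> (\<integral>x. \<bar>v n x - g x\<bar> \<partial>\<pi>)" for n
  proof -
    have "(\<integral>x. f x \<partial>\<pi>) - (\<integral>x. g x \<partial>\<pi>) = (\<integral>x. v n x - g x \<partial>\<pi>)"
      using vb g by (simp add: vi integrable_pi)
    then show ?thesis by simp
  qed
  then have "\<bar>(\<integral>x. f x \<partial>\<pi>) - (\<integral>x. g x \<partial>\<pi>)\<bar> \<le> 0" by (intro LIMSEQ_le_const[OF lim]) auto
  then have fg: "(\<integral>x. g x \<partial>\<pi>) = (\<integral>x. f x \<partial>\<pi>)" by simp
  define c where "c = (\<integral>x. f x \<partial>\<pi>)"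
  have gc: "AE x in \<pi>. g x = c" using gconst by (simp add: fg c_def)
  define a where "a = (\<lambda>n. \<integral>x. \<bar>u n x - c\<bar> \<partial>\<pi>)"
  have "(\<integral>x. \<bar>v n x - g x\<bar> \<partial>\<pi>) = a (2 * n)" for n
    unfolding a_def v_def using gc ub g
    by (intro integral_cong_AE) (auto simp: measurable_pi dest: bfun_measurable)
  then have lim2: "(\<lambda>n. a (2 * n)) \<longlonglongrightarrow> 0" using lim by simp
  have adec: "a (Suc n) \<le> a n" for n
  proof -
    have "a (Suc n) = (\<integral>x. \<bar>?T (\<lambda>y. u n y - c) x\<bar> \<partial>\<pi>)" unfolding a_def uS
      using space_pi ub by (intro Bochner_Integration.integral_cong) (auto simp: kop_diff)
    also have "\<dots> \<le> a n" unfolding a_def using ub by (intro kop_contract_L1 bfun_diff) auto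
    finally show ?thesis .
  qed
  have "a \<longlonglongrightarrow> 0"
  proof (rule LIMSEQ_I)
    fix e :: real assume "e > 0"
    then obtain N where N: "\<And>n. n \<ge> N \<Longrightarrow> \<bar>a (2 * n)\<bar> < e" using LIMSEQ_D[OF lim2] by auto
    have "decseq a" by (rule decseq_SucI) (rule adec)
    then have "norm (a n - 0) < e" if "n \<ge> 2 * N" for n
      using N[of N] decseqD[OF \<open>decseq a\<close> that] by (simp add: a_def)
    then show "\<exists>no. \<forall>n\<ge>no. norm (a n - 0) < e" by blast
  qed
  then show ?thesis by (simp add: a_def u_def c_def)
qed

end


section \<open>Metropolis--Hastings kernels\<close>

lemma (in sigma_finite_measure) integral_antisymmetric:
  fixes \<Phi> :: "'a \<Rightarrow> 'a \<Rightarrow> real"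
  assumes int: "integrable (M \<Otimes>\<^sub>M M) (\<lambda>(x, y). \<Phi> x y)"
    and anti: "\<And>x y. x \<in> space M \<Longrightarrow> y \<in> space M \<Longrightarrow> \<Phi> y x = - \<Phi> x y"
  shows "(\<integral>x. \<integral>y. \<Phi> x y \<partial>M \<partial>M) = 0"
proof -
  interpret pair_sigma_finite M M ..
  have "(\<integral>x. \<integral>y. \<Phi> x y \<partial>M \<partial>M) = (\<integral>x. \<integral>y. \<Phi> y x \<partial>M \<partial>M)"
    using Fubini_integral[OF int] by simp
  also have "\<dots> = (\<integral>x. \<integral>y. - \<Phi> x y \<partial>M \<partial>M)"
    by (intro Bochner_Integration.integral_cong refl anti)
  finally show ?thesis by simp
qed

lemma tendsto_affine_recursion:
  fixes b c :: "nat \<Rightarrow> real"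
  assumes r: "0 \<le> r" "r < 1" and rec: "\<And>n. b (Suc n) = c n + r * b n" and c: "c \<longlonglongrightarrow> 0"
  shows "b \<longlonglongrightarrow> 0"
proof (rule LIMSEQ_I)
  fix e :: real assume e: "e > 0"
  have e1: "e * (1 - r) / 2 > 0" using e r by simp
  obtain N where N: "\<And>n. n \<ge> N \<Longrightarrow> \<bar>c n\<bar> < e * (1 - r) / 2" using LIMSEQ_D[OF c e1] by auto
  have bd: "\<bar>b (N + n)\<bar> \<le> r ^ n * \<bar>b N\<bar> + e / 2" for n
  proof (induction n)
    case 0 show ?case using e by simp
  next
    case (Suc n)
    have "\<bar>b (N + Suc n)\<bar> \<le> \<bar>c (N + n)\<bar> + \<bar>r * b (N + n)\<bar>" using rec[of "N + n"] by simp
    also have "\<dots> \<le> e * (1 - r) / 2 + r * (r ^ n * \<bar>b N\<bar> + e / 2)"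
      unfolding abs_mult using r N[of "N + n"] Suc by (intro add_mono mult_mono) auto
    also have "\<dots> = r ^ Suc n * \<bar>b N\<bar> + e / 2" by (simp add: field_simps)
    finally show ?case .
  qed
  have "(\<lambda>n. r ^ n * \<bar>b N\<bar>) \<longlonglongrightarrow> 0 * \<bar>b N\<bar>" using r by (intro tendsto_mult LIMSEQ_power_zero) auto
  from LIMSEQ_D[OF this, of "e/2"]
  obtain N' where N': "\<And>n. n \<ge> N' \<Longrightarrow> \<bar>r ^ n * \<bar>b N\<bar>\<bar> < e / 2" using e by auto
  show "\<exists>no. \<forall>n\<ge>no. norm (b n - 0) < e"
  proof (intro exI allI impI)
    fix n assume n: "n \<ge> N + N'"
    then have "\<bar>r ^ (n - N) * \<bar>b N\<bar>\<bar> < e / 2" by (intro N') auto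
    then show "norm (b n - 0) < e" using bd[of "n - N"] n by simp
  qed
qed

locale metropolis = sigma_finite_measure M for M :: "'a measure" +
  fixes f :: "'a \<Rightarrow> real" and q :: "'a \<Rightarrow> 'a \<Rightarrow> real"
  assumes f_pos: "f x > 0"
    and f_int: "integrable M f"
    and f_norm: "(\<integral>x. f x \<partial>M) > 0"
    and q_meas[measurable]: "(\<lambda>(x, y). q x y) \<in> borel_measurable (M \<Otimes>\<^sub>M M)"
    and q_nonneg: "x \<in> space M \<Longrightarrow> y \<in> space M \<Longrightarrow> 0 \<le> q x y"
    and q_prob: "x \<in> space M \<Longrightarrow> (\<integral>\<^sup>+ y. ennreal (q x y) \<partial>M) = 1"
begin

definition target :: "'a measure" where
  "target = density M (\<lambda>x. ennreal (f x / (\<integral>y. f y \<partial>M)))"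

definition prop_acc :: "'a \<Rightarrow> 'a \<Rightarrow> real" where
  "prop_acc x y = q x y * mh_acc f q x y"

abbreviation T :: "'a \<Rightarrow> 'a measure" where "T \<equiv> MH_kernel M f q"

lemma f_meas[measurable]: "f \<in> borel_measurable M" using f_int by auto

lemma prop_acc_meas[measurable]: "(\<lambda>(x, y). prop_acc x y) \<in> borel_measurable (M \<Otimes>\<^sub>M M)"
  unfolding prop_acc_def mh_acc_def by measurable

lemma prop_acc_meas1: "x \<in> space M \<Longrightarrow> prop_acc x \<in> borel_measurable M"
  using measurable_compose_Pair1[OF _ prop_acc_meas] by simp

lemma prop_acc_bounds: "x \<in> space M \<Longrightarrow> y \<in> space M \<Longrightarrow> 0 \<le> prop_acc x y \<and> prop_acc x y \<le> q x y"
proof -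
  assume xy: "x \<in> space M" "y \<in> space M"
  have "0 \<le> mh_acc f q x y" "mh_acc f q x y \<le> 1"
    unfolding mh_acc_def using q_nonneg[OF xy] q_nonneg[OF xy(2,1)] f_pos[of x] f_pos[of y] by auto
  then show ?thesis unfolding prop_acc_def using q_nonneg[OF xy] by (simp add: mult_left_le)
qed

lemma prop_acc_symmetric:
  assumes "x \<in> space M" "y \<in> space M" shows "f x * prop_acc x y = f y * prop_acc y x"
proof -
  have *: "f x * prop_acc x y = min (f x * q x y) (f y * q y x)" if "x \<in> space M" "y \<in> space M" for x y
  proof (cases "q x y = 0")
    case True
    then show ?thesis using q_nonneg[of y x] that f_pos[of y] by (simp add: prop_acc_def min_def)
  next
    case False
    then have "0 < f x * q x y" using q_nonneg[OF that] f_pos[of x] by simp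
    then show ?thesis using False by (auto simp: prop_acc_def mh_acc_def min_def field_simps)
  qed
  show ?thesis using *[OF assms] *[OF assms(2,1)] by (simp add: min.commute)
qed

lemma nn_integral_prop_acc_le:
  assumes x: "x \<in> space M" shows "(\<integral>\<^sup>+ y. ennreal (prop_acc x y) \<partial>M) \<le> 1"
  unfolding q_prob[OF x, symmetric] using prop_acc_bounds[OF x]
  by (intro nn_integral_mono ennreal_leI) auto

lemma emeasure_T:
  assumes x: "x \<in> space M" and A: "A \<in> sets M"
  shows "emeasure (T x) A = (\<integral>\<^sup>+ y\<in>A. ennreal (prop_acc x y) \<partial>M)
      + (1 - (\<integral>\<^sup>+ y. ennreal (prop_acc x y) \<partial>M)) * indicator A x" (is "_ = ?mu A")
proof (rule emeasure_measure_of)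
  show "T x = measure_of (space M) (sets M) ?mu" unfolding MH_kernel_def prop_acc_def ..
  show "countably_additive (sets (T x)) ?mu"
    unfolding countably_additive_def
  proof (intro allI impI)
    fix F :: "nat \<Rightarrow> 'a set" assume F: "range F \<subseteq> sets (T x)" "disjoint_family F" "\<Union> (range F) \<in> sets (T x)"
    have s: "sets (T x) = sets M" unfolding MH_kernel_def by simp
    let ?D = "density M (\<lambda>y. ennreal (prop_acc x y))"
    note [measurable] = prop_acc_meas1[OF x]
    let ?c = "1 - (\<integral>\<^sup>+ y. ennreal (prop_acc x y) \<partial>M)"
    have mu: "?mu B = emeasure ?D B + ?c * emeasure (return M x) B" if "B \<in> sets M" for B
      using that by (simp add: emeasure_density)
    have F': "range F \<subseteq> sets M" "\<Union> (range F) \<in> sets M" using F s by auto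
    have "(\<Sum>i. ?mu (F i)) = (\<Sum>i. emeasure ?D (F i) + ?c * emeasure (return M x) (F i))"
      using F' by (intro suminf_cong mu) auto
    also have "\<dots> = (\<Sum>i. emeasure ?D (F i)) + ?c * (\<Sum>i. emeasure (return M x) (F i))"
      by (simp add: suminf_add[symmetric])
    also have "(\<Sum>i. emeasure ?D (F i)) = emeasure ?D (\<Union>i. F i)" using F' F by (intro suminf_emeasure) auto
    also have "(\<Sum>i. emeasure (return M x) (F i)) = emeasure (return M x) (\<Union>i. F i)"
      using F' F by (intro suminf_emeasure) auto
    also have "emeasure ?D (\<Union>i. F i) + ?c * emeasure (return M x) (\<Union>i. F i) = ?mu (\<Union> (range F))"
      using F' by (subst mu) auto
    finally show "(\<Sum>i. ?mu (F i)) = ?mu (\<Union> (range F))" .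
  qed
qed (auto simp: positive_def MH_kernel_def A sets.space_closed)

lemma sets_T[simp, measurable_cong]: "sets (T x) = sets M" unfolding MH_kernel_def by simp

lemma space_T[simp]: "space (T x) = space M" by (rule sets_eq_imp_space_eq) simp

lemma prob_T: assumes x: "x \<in> space M" shows "prob_space (T x)"
proof (rule prob_spaceI)
  show "emeasure (T x) (space (T x)) = 1"
    using emeasure_T[OF x sets.top] nn_integral_prop_acc_le[OF x] x
    by (simp add: ennreal_0 add_diff_inverse_ennreal cong: nn_integral_cong)
qed

lemma kernel_T: "T \<in> M \<rightarrow>\<^sub>M prob_algebra M"
proof (rule measurable_prob_algebraI)
  show "T \<in> M \<rightarrow>\<^sub>M subprob_algebra M"
  proof (rule measurable_subprob_algebra)
    fix A assume A[measurable]: "A \<in> sets M"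
    show "(\<lambda>x. emeasure (T x) A) \<in> borel_measurable M"
      by (subst measurable_cong[OF emeasure_T[OF _ A]], assumption) measurable
  qed (auto intro: prob_space_imp_subprob_space prob_T)
qed (rule prob_T)

sublocale markov_kernel M T by unfold_locales (rule kernel_T)

definition rej :: "'a \<Rightarrow> real" where "rej x = 1 - (\<integral>y. prop_acc x y \<partial>M)"

lemma prop_acc_integrable: assumes x: "x \<in> space M" shows "integrable M (prop_acc x)"
proof (rule integrableI_bounded)
  have "(\<integral>\<^sup>+ y. ennreal (norm (prop_acc x y)) \<partial>M) = (\<integral>\<^sup>+ y. ennreal (prop_acc x y) \<partial>M)"
    using prop_acc_bounds[OF x] by (intro nn_integral_cong) auto
  also have "\<dots> < \<infinity>" using nn_integral_prop_acc_le[OF x] by (auto simp: order.strict_trans1)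
  finally show "(\<integral>\<^sup>+ y. ennreal (norm (prop_acc x y)) \<partial>M) < \<infinity>" .
qed (rule prop_acc_meas1[OF x])

lemma rej: assumes x: "x \<in> space M"
  shows "ennreal (rej x) = 1 - (\<integral>\<^sup>+ y. ennreal (prop_acc x y) \<partial>M)" "0 \<le> rej x" "rej x \<le> 1"
proof -
  have e: "(\<integral>\<^sup>+ y. ennreal (prop_acc x y) \<partial>M) = ennreal (\<integral>y. prop_acc x y \<partial>M)"
    using prop_acc_integrable[OF x] prop_acc_bounds[OF x] by (intro nn_integral_eq_integral) auto
  have n: "0 \<le> (\<integral>y. prop_acc x y \<partial>M)" using prop_acc_bounds[OF x] by (intro integral_nonneg_AE) auto
  show "rej x \<le> 1" using n by (simp add: rej_def)
  show "0 \<le> rej x" using nn_integral_prop_acc_le[OF x] unfolding e rej_def by (simp add: ennreal_le_1)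
  show "ennreal (rej x) = 1 - (\<integral>\<^sup>+ y. ennreal (prop_acc x y) \<partial>M)"
    unfolding e rej_def ennreal_1[symmetric] by (rule ennreal_minus[symmetric, OF n])
qed

lemma nn_integral_T:
  assumes x: "x \<in> space M" and g: "g \<in> borel_measurable M"
  shows "(\<integral>\<^sup>+ y. g y \<partial>T x) = (\<integral>\<^sup>+ y. ennreal (prop_acc x y) * g y \<partial>M) + ennreal (rej x) * g x"
  using g
proof (induction rule: borel_measurable_induct)
  case (cong f g)
  have "(\<integral>\<^sup>+ y. f y \<partial>T x) = (\<integral>\<^sup>+ y. g y \<partial>T x)" using cong by (intro nn_integral_cong) auto
  moreover have "(\<integral>\<^sup>+ y. ennreal (prop_acc x y) * f y \<partial>M) = (\<integral>\<^sup>+ y. ennreal (prop_acc x y) * g y \<partial>M)"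
    using cong by (intro nn_integral_cong) auto
  ultimately show ?case using cong x by simp
next
  case (set A)
  then show ?case using emeasure_T[OF x set] rej(1)[OF x] by simp
next
  case (mult u c)
  note [measurable] = mult(2) prop_acc_meas1[OF x]
  have "(\<integral>\<^sup>+ y. c * u y \<partial>T x) = c * (\<integral>\<^sup>+ y. u y \<partial>T x)" by (rule nn_integral_cmult) measurable
  also have "\<dots> = c * (\<integral>\<^sup>+ y. ennreal (prop_acc x y) * u y \<partial>M) + ennreal (rej x) * (c * u x)"
    unfolding mult(4) by (simp add: distrib_left mult_ac)
  also have "c * (\<integral>\<^sup>+ y. ennreal (prop_acc x y) * u y \<partial>M) = (\<integral>\<^sup>+ y. ennreal (prop_acc x y) * (c * u y) \<partial>M)"
    by (subst nn_integral_cmult[symmetric]) (auto simp: mult_ac)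
  finally show ?case .
next
  case (add u v)
  note [measurable] = prop_acc_meas1[OF x]
  have [measurable]: "u \<in> borel_measurable M" "v \<in> borel_measurable M" using add by auto
  have "(\<integral>\<^sup>+ y. v y + u y \<partial>T x) = (\<integral>\<^sup>+ y. v y \<partial>T x) + (\<integral>\<^sup>+ y. u y \<partial>T x)" by (rule nn_integral_add) measurable
  also have "\<dots> = ((\<integral>\<^sup>+ y. ennreal (prop_acc x y) * v y \<partial>M) + (\<integral>\<^sup>+ y. ennreal (prop_acc x y) * u y \<partial>M))
      + ennreal (rej x) * (v x + u x)"
    unfolding add.IH by (simp add: distrib_left add_ac)
  also have "(\<integral>\<^sup>+ y. ennreal (prop_acc x y) * v y \<partial>M) + (\<integral>\<^sup>+ y. ennreal (prop_acc x y) * u y \<partial>M)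
      = (\<integral>\<^sup>+ y. ennreal (prop_acc x y) * (v y + u y) \<partial>M)"
    by (subst nn_integral_add[symmetric]) (auto simp: distrib_left)
  finally show ?case .
next
  case (seq U)
  note [measurable] = seq(1) prop_acc_meas1[OF x]
  have inc: "incseq U" by fact
  have sup: "(SUP i. U i) y = (SUP i. U i y)" for y by (simp add: SUP_apply image_comp)
  have "(\<integral>\<^sup>+ y. (SUP i. U i y) \<partial>T x) = (SUP i. \<integral>\<^sup>+ y. U i y \<partial>T x)"
    using inc by (intro nn_integral_monotone_convergence_SUP) auto
  also have "\<dots> = (SUP i. (\<integral>\<^sup>+ y. ennreal (prop_acc x y) * U i y \<partial>M) + ennreal (rej x) * U i x)"
    using seq by simp
  also have "\<dots> = (SUP i. \<integral>\<^sup>+ y. ennreal (prop_acc x y) * U i y \<partial>M) + (SUP i. ennreal (rej x) * U i x)"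
    using inc by (intro ennreal_SUP_add) (auto simp: incseq_def le_fun_def intro!: nn_integral_mono mult_left_mono)
  also have "(SUP i. \<integral>\<^sup>+ y. ennreal (prop_acc x y) * U i y \<partial>M) = (\<integral>\<^sup>+ y. (SUP i. ennreal (prop_acc x y) * U i y) \<partial>M)"
    using inc by (intro nn_integral_monotone_convergence_SUP[symmetric])
      (auto simp: incseq_def le_fun_def intro!: mult_left_mono)
  finally show ?case unfolding sup by (simp add: SUP_mult_left_ennreal[symmetric])
qed

lemma kop_T:
  assumes x: "x \<in> space M" and g: "g \<in> bfun M"
  shows "kop T g x = (\<integral>y. prop_acc x y * g y \<partial>M) + rej x * g x"
    and "integrable M (\<lambda>y. prop_acc x y * g y)"
proof -
  have i: "integrable M (\<lambda>y. prop_acc x y * g y)" if g: "g \<in> bfun M" for g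
  proof -
    obtain C where C: "\<forall>y\<in>space M. \<bar>g y\<bar> \<le> C" using bfun_bounded[OF g] by blast
    note [measurable] = prop_acc_meas1[OF x] bfun_measurable[OF g]
    show ?thesis
    proof (rule Bochner_Integration.integrable_bound)
      show "integrable M (\<lambda>y. C * prop_acc x y)" using prop_acc_integrable[OF x] by simp
      show "AE y in M. norm (prop_acc x y * g y) \<le> norm (C * prop_acc x y)"
      proof (rule AE_I2)
        fix y assume y: "y \<in> space M"
        have "\<bar>g y\<bar> \<le> \<bar>C\<bar>" using C y by force
        then show "norm (prop_acc x y * g y) \<le> norm (C * prop_acc x y)"
          by (simp add: abs_mult mult.commute mult_right_mono)
      qed
    qed measurable
  qed
  have nn: "kop T g x = (\<integral>y. prop_acc x y * g y \<partial>M) + rej x * g x" if g: "g \<in> bfun M" and pos: "\<And>y. y \<in> space M \<Longrightarrow> 0 \<le> g y" for g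
  proof -
    note [measurable] = bfun_measurable[OF g]
    have n1: "0 \<le> kop T g x" using x pos by (rule kop_nonneg)
    have n2: "0 \<le> (\<integral>y. prop_acc x y * g y \<partial>M)"
      using prop_acc_bounds[OF x] pos by (intro integral_nonneg_AE) auto
    have n3: "0 \<le> rej x * g x" using rej[OF x] pos[OF x] by simp
    have "ennreal (kop T g x) = (\<integral>\<^sup>+ y. ennreal (g y) \<partial>T x)"
      unfolding kop_def using integrable_P[OF x g] pos by (intro nn_integral_eq_integral[symmetric]) auto
    also have "\<dots> = (\<integral>\<^sup>+ y. ennreal (prop_acc x y) * ennreal (g y) \<partial>M) + ennreal (rej x) * ennreal (g x)"
      by (rule nn_integral_T[OF x]) measurable
    also have "(\<integral>\<^sup>+ y. ennreal (prop_acc x y) * ennreal (g y) \<partial>M) = (\<integral>\<^sup>+ y. ennreal (prop_acc x y * g y) \<partial>M)"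
      using prop_acc_bounds[OF x] by (intro nn_integral_cong) (simp add: ennreal_mult')
    also have "\<dots> = ennreal (\<integral>y. prop_acc x y * g y \<partial>M)"
      using prop_acc_bounds[OF x] pos i[OF g] by (intro nn_integral_eq_integral) auto
    also have "ennreal (rej x) * ennreal (g x) = ennreal (rej x * g x)" using rej(2)[OF x] by (simp add: ennreal_mult')
    also have "ennreal (\<integral>y. prop_acc x y * g y \<partial>M) + ennreal (rej x * g x)
        = ennreal ((\<integral>y. prop_acc x y * g y \<partial>M) + rej x * g x)" using n2 n3 by simp
    finally show ?thesis using n1 n2 n3 by (subst (asm) ennreal_inj) auto
  qed
  obtain C where C: "C > 0" "\<forall>y\<in>space M. \<bar>g y\<bar> \<le> C" using bfun_bounded[OF g] by blast
  have gC: "(\<lambda>y. g y + C) \<in> bfun M" using g by auto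
  have pos: "0 \<le> g y + C" if "y \<in> space M" for y using C that by (force simp: abs_le_iff)
  have "kop T g x + C = kop T (\<lambda>y. g y + C) x" using x g by (simp add: kop_add)
  also have "\<dots> = (\<integral>y. prop_acc x y * (g y + C) \<partial>M) + rej x * (g x + C)" using gC pos by (rule nn)
  also have "(\<integral>y. prop_acc x y * (g y + C) \<partial>M) = (\<integral>y. prop_acc x y * g y + C * prop_acc x y \<partial>M)"
    by (simp add: algebra_simps)
  also have "\<dots> = (\<integral>y. prop_acc x y * g y \<partial>M) + C * (\<integral>y. prop_acc x y \<partial>M)"
    using i[OF g] prop_acc_integrable[OF x] by simp
  also have "(\<integral>y. prop_acc x y \<partial>M) = 1 - rej x" by (simp add: rej_def)
  finally show "kop T g x = (\<integral>y. prop_acc x y * g y \<partial>M) + rej x * g x" by (simp add: algebra_simps)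
  show "integrable M (\<lambda>y. prop_acc x y * g y)" by (rule i[OF g])
qed

lemma sets_target[simp, measurable_cong]: "sets target = sets M" by (simp add: target_def)

lemma space_target[simp]: "space target = space M" by (simp add: target_def)

lemma integral_target:
  assumes "g \<in> borel_measurable M"
  shows "(\<integral>x. g x \<partial>target) = (\<integral>x. f x * g x \<partial>M) / (\<integral>y. f y \<partial>M)"
proof -
  have "(\<integral>x. g x \<partial>target) = (\<integral>x. (f x / (\<integral>y. f y \<partial>M)) * g x \<partial>M)"
    unfolding target_def using assms f_pos f_norm
    by (intro integral_real_density) (auto intro!: AE_I2 divide_nonneg_nonneg less_imp_le)
  also have "\<dots> = (\<integral>x. f x * g x / (\<integral>y. f y \<partial>M) \<partial>M)" by simp
  finally show ?thesis by (simp only: integral_divide_zero)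
qed

lemma prob_target: "prob_space target"
proof (rule prob_spaceI)
  have "emeasure target (space target) = (\<integral>\<^sup>+x. ennreal (f x / (\<integral>y. f y \<partial>M)) \<partial>M)"
    unfolding target_def by (subst emeasure_density) (auto intro!: nn_integral_cong)
  also have "\<dots> = ennreal (\<integral>x. f x / (\<integral>y. f y \<partial>M) \<partial>M)"
    using f_int f_norm f_pos by (intro nn_integral_eq_integral) (auto intro!: AE_I2 divide_nonneg_nonneg less_imp_le)
  also have "\<dots> = 1" using f_norm by simp
  finally show "emeasure target (space target) = 1" .
qed

lemma integrable_f_bfun:
  assumes g: "g \<in> bfun M" shows "integrable M (\<lambda>x. f x * g x)"
proof -
  obtain C where C: "C > 0" "\<forall>y\<in>space M. \<bar>g y\<bar> \<le> C" using bfun_bounded[OF g] by blast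
  note [measurable] = bfun_measurable[OF g]
  show ?thesis
  proof (rule Bochner_Integration.integrable_bound)
    show "integrable M (\<lambda>x. C * f x)" using f_int by simp
    show "AE x in M. norm (f x * g x) \<le> norm (C * f x)"
    proof (rule AE_I2)
      fix y assume y: "y \<in> space M"
      have "\<bar>g y\<bar> \<le> C" using C y by blast
      then show "norm (f y * g y) \<le> norm (C * f y)"
        using C(1) f_pos[of y] by (simp add: abs_mult mult.commute mult_right_mono)
    qed
  qed measurable
qed

lemma integrable_pair_f_prop_acc: "integrable (M \<Otimes>\<^sub>M M) (\<lambda>(x, y). f x * prop_acc x y)"
proof (rule integrableI_bounded)
  have "(\<integral>\<^sup>+ z. ennreal (norm (case z of (x, y) \<Rightarrow> f x * prop_acc x y)) \<partial>(M \<Otimes>\<^sub>M M))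
      = (\<integral>\<^sup>+ x. \<integral>\<^sup>+ y. ennreal (norm (f x * prop_acc x y)) \<partial>M \<partial>M)"
    by (subst nn_integral_fst[symmetric]) auto
  also have "\<dots> \<le> (\<integral>\<^sup>+ x. ennreal (f x) \<partial>M)"
  proof (rule nn_integral_mono)
    fix x assume x: "x \<in> space M"
    note [measurable] = prop_acc_meas1[OF x]
    have "(\<integral>\<^sup>+ y. ennreal (norm (f x * prop_acc x y)) \<partial>M) = (\<integral>\<^sup>+ y. ennreal (f x) * ennreal (prop_acc x y) \<partial>M)"
      using prop_acc_bounds[OF x] f_pos[of x] by (intro nn_integral_cong) (simp add: abs_mult ennreal_mult')
    also have "\<dots> = ennreal (f x) * (\<integral>\<^sup>+ y. ennreal (prop_acc x y) \<partial>M)" by (rule nn_integral_cmult) measurable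
    also have "\<dots> \<le> ennreal (f x) * 1" using nn_integral_prop_acc_le[OF x] by (rule mult_left_mono) simp
    finally show "(\<integral>\<^sup>+ y. ennreal (norm (f x * prop_acc x y)) \<partial>M) \<le> ennreal (f x)" by simp
  qed
  also have "\<dots> = ennreal (\<integral>x. f x \<partial>M)" using f_int f_pos by (intro nn_integral_eq_integral) (auto intro!: AE_I2 less_imp_le)
  also have "\<dots> < \<infinity>" by simp
  finally show "(\<integral>\<^sup>+ z. ennreal (norm (case z of (x, y) \<Rightarrow> f x * prop_acc x y)) \<partial>(M \<Otimes>\<^sub>M M)) < \<infinity>" .
qed measurable

lemma reversible_T:
  assumes \<phi>: "\<phi> \<in> bfun M" and \<psi>: "\<psi> \<in> bfun M"
  shows "(\<integral>x. \<phi> x * kop T \<psi> x \<partial>target) = (\<integral>x. kop T \<phi> x * \<psi> x \<partial>target)"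
proof -
  obtain C where C: "C > 0" "\<forall>y\<in>space M. \<bar>\<phi> y\<bar> \<le> C" using bfun_bounded[OF \<phi>] by blast
  obtain D where D: "D > 0" "\<forall>y\<in>space M. \<bar>\<psi> y\<bar> \<le> D" using bfun_bounded[OF \<psi>] by blast
  note [measurable] = bfun_measurable[OF \<phi>] bfun_measurable[OF \<psi>]
  define \<Phi> where "\<Phi> = (\<lambda>x y. f x * prop_acc x y * (\<phi> x * \<psi> y - \<phi> y * \<psi> x))"
  have int: "integrable (M \<Otimes>\<^sub>M M) (\<lambda>(x, y). \<Phi> x y)"
  proof (rule Bochner_Integration.integrable_bound)
    show "integrable (M \<Otimes>\<^sub>M M) (\<lambda>z. 2 * (C * D) * (case z of (x, y) \<Rightarrow> f x * prop_acc x y))"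
      by (intro integrable_mult_right integrable_pair_f_prop_acc)
    show "AE z in M \<Otimes>\<^sub>M M. norm (case z of (x, y) \<Rightarrow> \<Phi> x y) \<le> norm (2 * (C * D) * (case z of (x, y) \<Rightarrow> f x * prop_acc x y))"
    proof (rule AE_I2, clarsimp simp: space_pair_measure)
      fix x y assume xy: "x \<in> space M" "y \<in> space M"
      have 1: "\<bar>\<phi> x * \<psi> y\<bar> \<le> C * D" "\<bar>\<phi> y * \<psi> x\<bar> \<le> C * D"
        unfolding abs_mult using C D xy by (intro mult_mono'; simp)+
      have "\<bar>\<phi> x * \<psi> y - \<phi> y * \<psi> x\<bar> \<le> 2 * (C * D)" using 1 by linarith
      then have "\<bar>f x * prop_acc x y\<bar> * \<bar>\<phi> x * \<psi> y - \<phi> y * \<psi> x\<bar> \<le> \<bar>f x * prop_acc x y\<bar> * (2 * (C * D))"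
        by (intro mult_left_mono) auto
      then show "\<bar>\<Phi> x y\<bar> \<le> \<bar>2 * (C * D) * (f x * prop_acc x y)\<bar>"
        unfolding \<Phi>_def abs_mult using C(1) D(1) by (simp add: mult_ac)
    qed
  qed (unfold \<Phi>_def, measurable)
  have anti: "\<Phi> y x = - \<Phi> x y" if "x \<in> space M" "y \<in> space M" for x y
    unfolding \<Phi>_def prop_acc_symmetric[OF that] by (simp add: algebra_simps)
  have "(\<integral>y. \<Phi> x y \<partial>M) = f x * (\<phi> x * kop T \<psi> x) - f x * (kop T \<phi> x * \<psi> x)" if x: "x \<in> space M" for x
  proof -
    have "(\<integral>y. \<Phi> x y \<partial>M) = (\<integral>y. (f x * \<phi> x) * (prop_acc x y * \<psi> y) - (f x * \<psi> x) * (prop_acc x y * \<phi> y) \<partial>M)"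
      unfolding \<Phi>_def by (simp add: algebra_simps)
    also have "\<dots> = (f x * \<phi> x) * (\<integral>y. prop_acc x y * \<psi> y \<partial>M) - (f x * \<psi> x) * (\<integral>y. prop_acc x y * \<phi> y \<partial>M)"
      using kop_T(2)[OF x \<phi>] kop_T(2)[OF x \<psi>] by simp
    finally show ?thesis unfolding kop_T(1)[OF x \<phi>] kop_T(1)[OF x \<psi>] by (simp add: algebra_simps)
  qed
  then have "(\<integral>x. \<integral>y. \<Phi> x y \<partial>M \<partial>M) = (\<integral>x. f x * (\<phi> x * kop T \<psi> x) - f x * (kop T \<phi> x * \<psi> x) \<partial>M)"
    by (intro Bochner_Integration.integral_cong) auto
  also have "\<dots> = (\<integral>x. f x * (\<phi> x * kop T \<psi> x) \<partial>M) - (\<integral>x. f x * (kop T \<phi> x * \<psi> x) \<partial>M)"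
    using \<phi> \<psi> by (intro Bochner_Integration.integral_diff integrable_f_bfun bfun_mult kop_bfun)
  finally have *: "(\<integral>x. f x * (\<phi> x * kop T \<psi> x) \<partial>M) = (\<integral>x. f x * (kop T \<phi> x * \<psi> x) \<partial>M)"
    using integral_antisymmetric[OF int anti] by simp
  have m: "(\<lambda>x. \<phi> x * kop T \<psi> x) \<in> borel_measurable M" "(\<lambda>x. kop T \<phi> x * \<psi> x) \<in> borel_measurable M"
    by (intro bfun_measurable bfun_mult kop_bfun \<phi> \<psi>)+
  show ?thesis unfolding integral_target[OF m(1)] integral_target[OF m(2)] * ..
qed

sublocale reversible_kernel M T target
proof -
  interpret prob_space target by (rule prob_target)
  show "reversible_kernel M T target"
  proof unfold_locales
    fix g assume g: "g \<in> bfun M"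
    have "(\<integral>x. kop T g x \<partial>target) = (\<integral>x. kop T (\<lambda>_. 1) x * g x \<partial>target)"
      using reversible_T[OF bfun_const g, of 1] by simp
    also have "\<dots> = (\<integral>x. g x \<partial>target)" by (intro Bochner_Integration.integral_cong) auto
    finally show "(\<integral>x. kop T g x \<partial>target) = (\<integral>x. g x \<partial>target)" .
  qed (auto intro: reversible_T)
qed

lemma rej_meas[measurable]: "rej \<in> borel_measurable M"
  unfolding rej_def by measurable

text \<open>Singletons need not be measurable: the states that measurable sets cannot distinguish from
  an absorbing one play the role of a single atom.\<close>

lemma absorbing_state_target:
  assumes irr: "irreducible_kernel M T" and x: "x \<in> space M" and r: "rej x = 1" and g: "g \<in> bfun M"
  shows "(\<integral>y. g y \<partial>target) = g x"
proof -
  define B where "B = {y\<in>space M. rej y = 1}"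
  have B[measurable]: "B \<in> sets M" unfolding B_def by measurable
  have xB: "x \<in> B" using x r by (simp add: B_def)
  have TB: "measure (T y) A = indicator A y" if y: "y \<in> B" and A: "A \<in> sets M" for y A
  proof -
    have yM: "y \<in> space M" and ry: "rej y = 1" using y by (auto simp: B_def)
    have "(\<integral>z. prop_acc y z \<partial>M) = 0" using ry by (simp add: rej_def)
    then have "AE z in M. prop_acc y z = 0"
      using prop_acc_bounds[OF yM] prop_acc_integrable[OF yM]
      by (subst (asm) integral_nonneg_eq_0_iff_AE) auto
    then have z: "(\<integral>z. prop_acc y z * indicator A z \<partial>M) = 0"
      by (intro integral_eq_zero_AE) auto
    show ?thesis using kop_T(1)[OF yM bfun_indicator[OF A]] kop_indicator[OF yM A] z ry by simp
  qed
  have abs: "absorbing (A \<inter> B)" if A: "A \<in> sets M" for A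
    unfolding absorbing_def using TB A B by auto
  define A where "A = {y\<in>space M. g y = g x}"
  note [measurable] = bfun_measurable[OF g]
  have A[measurable]: "A \<in> sets M" unfolding A_def by measurable
  have "(space M - A) \<inter> B = {}"
  proof (rule ccontr)
    assume "(space M - A) \<inter> B \<noteq> {}"
    then show False
      using irreducible_no_disjoint_absorbing[OF irr abs[OF A] abs[of "space M - A"]] xB x A by (auto simp: A_def)
  qed
  then have BA: "B \<subseteq> A" by (auto simp: B_def)
  define H where "H = {y\<in>space M. y \<in> B \<or> measure (T y) B = 0}"
  have H[measurable]: "H \<in> sets M" unfolding H_def by measurable
  have bm: "(\<lambda>y. measure (T y) B) \<in> bfun M"
    using B by (intro bfunI[where C=1] measure_P_measurable) (auto simp: prob_space.prob_le_1[OF prob_P])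
  have "(\<integral>y. measure (T y) B - indicator B y \<partial>target) = 0"
    using integral_measure_P[OF B] B bm bfun_indicator[OF B] sets.sets_into_space[OF B]
    by (simp add: integrable_pi Int_absorb2)
  moreover have "AE y in target. 0 \<le> measure (T y) B - indicator B y"
    using TB[OF _ B] by (intro AE_I2) (auto simp: indicator_def)
  ultimately have "AE y in target. measure (T y) B - indicator B y = 0"
    using bm bfun_indicator[OF B]
    by (subst (asm) integral_nonneg_eq_0_iff_AE) (auto intro!: integrable_pi Bochner_Integration.integrable_diff)
  then have "AE y in target. y \<in> H" using AE_space
    by eventually_elim (auto simp: H_def indicator_def)
  then have "measure target H = 1" by (subst (asm) pi.AE_in_set_eq_1) auto
  then obtain G where G: "absorbing G" "G \<subseteq> H" "measure target G = 1"
    using full_contains_absorbing[OF H] by metis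
  have Gs[measurable]: "G \<in> sets M" by (rule absorbing_sets[OF G(1)])
  have "absorbing (G \<inter> (space M - B))" unfolding absorbing_def
  proof (intro conjI ballI)
    fix y assume y: "y \<in> G \<inter> (space M - B)"
    then have yM: "y \<in> space M" and "measure (T y) B = 0" using G(2) by (auto simp: H_def)
    then show "measure (T y) (G \<inter> (space M - B)) = 1"
      using y G(1) B Gs measure_P_compl[OF yM B] by (intro measure_P_Int) (auto simp: absorbing_def)
  qed simp
  then have "G \<inter> (space M - B) = {}"
    using irreducible_no_disjoint_absorbing[OF irr abs[OF B]] xB by auto
  then have "G \<subseteq> A" using BA sets.sets_into_space[OF Gs] by blast
  moreover have "AE y in target. y \<in> G" using G(3) by (subst pi.AE_in_set_eq_1) auto
  ultimately have "AE y in target. g y = g x" by (auto simp: A_def elim!: eventually_mono)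
  then have "(\<integral>y. g y \<partial>target) = (\<integral>y. g x \<partial>target)" by (intro integral_cong_AE) auto
  then show ?thesis using pi.prob_space by simp
qed

theorem pointwise_convergence:
  assumes irr: "irreducible_kernel M T" and aper: "aperiodic_kernel M T"
    and g: "g \<in> bfun M" and x: "x \<in> space M"
  shows "(\<lambda>n. (kop T ^^ n) g x) \<longlonglongrightarrow> (\<integral>y. g y \<partial>target)"
proof (cases "rej x = 1")
  case True
  have "(kop T ^^ n) g x = g x" for n
  proof (induction n)
    case (Suc n)
    have "(\<integral>z. prop_acc x z \<partial>M) = 0" using True by (simp add: rej_def)
    then have "AE z in M. prop_acc x z = 0"
      using prop_acc_bounds[OF x] prop_acc_integrable[OF x]
      by (subst (asm) integral_nonneg_eq_0_iff_AE) auto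
    then have z: "(\<integral>z. prop_acc x z * (kop T ^^ n) g z \<partial>M) = 0"
      by (intro integral_eq_zero_AE) auto
    show ?case using kop_T(1)[OF x kop_funpow_bfun[OF g, of n]] z True Suc by simp
  qed simp
  then show ?thesis using absorbing_state_target[OF irr x True g] by simp
next
  case False
  then have r: "0 \<le> rej x" "rej x < 1" using rej[OF x] by auto
  define c where "c = (\<integral>y. g y \<partial>target)"
  define v where "v = (\<lambda>n y. (kop T ^^ n) g y - c)"
  have vb: "v n \<in> bfun M" for n unfolding v_def using g by (intro bfun_diff kop_funpow_bfun) auto
  note [measurable] = bfun_measurable[OF vb] prop_acc_meas1[OF x]
  obtain C where C: "C > 0" "\<forall>y\<in>space M. \<bar>g y\<bar> \<le> C" using bfun_bounded[OF g] by blast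
  have cC: "\<bar>c\<bar> \<le> C" unfolding c_def using C by (intro pi.abs_integral_le_bound) auto
  have vC: "\<bar>v n y\<bar> \<le> 2 * C" if "y \<in> space M" for n y
  proof -
    have "\<bar>(kop T ^^ n) g y\<bar> \<le> C" using that
      by (induction n arbitrary: y) (auto simp: C intro!: kop_abs_le_const)
    then show ?thesis unfolding v_def using cC by linarith
  qed
  have "(\<lambda>n. \<integral>y. \<bar>v n y\<bar> \<partial>target) \<longlonglongrightarrow> 0"
    unfolding v_def c_def by (rule reversible_L1_convergence[OF irr aper g])
  then have "(\<lambda>n. (\<integral>y. f y \<partial>M) * (\<integral>y. \<bar>v n y\<bar> \<partial>target)) \<longlonglongrightarrow> (\<integral>y. f y \<partial>M) * 0"
    by (intro tendsto_mult tendsto_const)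
  moreover have "(\<integral>y. f y \<partial>M) * (\<integral>y. \<bar>v n y\<bar> \<partial>target) = (\<integral>y. f y * \<bar>v n y\<bar> \<partial>M)" for n
    using f_norm by (subst integral_target) auto
  ultimately have lim: "(\<lambda>n. \<integral>y. f y * \<bar>v n y\<bar> \<partial>M) \<longlonglongrightarrow> 0" by simp
  have tail: "(\<lambda>L::nat. \<integral>y. prop_acc x y * indicator {y\<in>space M. real L * f y < prop_acc x y} y \<partial>M) \<longlonglongrightarrow> (\<integral>y. 0 \<partial>M)"
  proof (rule integral_dominated_convergence[where w="prop_acc x"])
    show "integrable M (prop_acc x)" by (rule prop_acc_integrable[OF x])
    show "AE y in M. norm (prop_acc x y * indicator {y\<in>space M. real L * f y < prop_acc x y} y) \<le> prop_acc x y" for L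
      using prop_acc_bounds[OF x] by (intro AE_I2) (auto simp: indicator_def)
    show "AE y in M. (\<lambda>L. prop_acc x y * indicator {y\<in>space M. real L * f y < prop_acc x y} y) \<longlonglongrightarrow> 0"
    proof (rule AE_I2, rule tendsto_eventually)
      fix y assume y: "y \<in> space M"
      obtain L0 where L0: "prop_acc x y < real L0 * f y" using ex_less_of_nat_mult[OF f_pos[of y]] by blast
      show "\<forall>\<^sub>F L in sequentially. prop_acc x y * indicator {y\<in>space M. real L * f y < prop_acc x y} y = 0"
      proof (rule eventually_sequentiallyI[of L0])
        fix L assume "L0 \<le> L"
        then have "real L0 * f y \<le> real L * f y" using f_pos[of y] by (intro mult_right_mono) auto
        then show "prop_acc x y * indicator {y\<in>space M. real L * f y < prop_acc x y} y = 0" using L0 by simp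
      qed
    qed
  qed measurable
  have "(\<lambda>n. \<integral>y. prop_acc x y * v n y \<partial>M) \<longlonglongrightarrow> 0"
  proof (rule LIMSEQ_I)
    fix e :: real assume e: "e > 0"
    then have e2: "e / (4 * C) > 0" using C by simp
    obtain L where L: "\<bar>\<integral>y. prop_acc x y * indicator {y\<in>space M. real L * f y < prop_acc x y} y \<partial>M\<bar> < e / (4 * C)"
      using LIMSEQ_D[OF tail e2] by auto
    let ?t = "\<lambda>y. prop_acc x y * indicator {y\<in>space M. real L * f y < prop_acc x y} y"
    have e3: "e / (2 * (real L + 1)) > 0" using e by simp
    obtain N where N: "\<And>n. n \<ge> N \<Longrightarrow> \<bar>\<integral>y. f y * \<bar>v n y\<bar> \<partial>M\<bar> < e / (2 * (real L + 1))"
      using LIMSEQ_D[OF lim e3] by auto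
    have ti: "integrable M ?t" using prop_acc_bounds[OF x] by (intro Bochner_Integration.integrable_bound[OF prop_acc_integrable[OF x]]) (auto simp: indicator_def)
    have fi: "integrable M (\<lambda>y. f y * \<bar>v n y\<bar>)" for n using vb by (intro integrable_f_bfun) auto
    show "\<exists>no. \<forall>n\<ge>no. norm ((\<integral>y. prop_acc x y * v n y \<partial>M) - 0) < e"
    proof (intro exI allI impI)
      fix n assume n: "n \<ge> N"
      have "\<bar>\<integral>y. prop_acc x y * v n y \<partial>M\<bar> \<le> (\<integral>y. \<bar>prop_acc x y * v n y\<bar> \<partial>M)" by simp
      also have "\<dots> \<le> (\<integral>y. real L * (f y * \<bar>v n y\<bar>) + (2 * C) * ?t y \<partial>M)"
      proof (rule integral_mono)
        show "integrable M (\<lambda>y. \<bar>prop_acc x y * v n y\<bar>)" using kop_T(2)[OF x vb] by simp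
        show "integrable M (\<lambda>y. real L * (f y * \<bar>v n y\<bar>) + 2 * C * ?t y)" using fi ti by simp
        fix y assume y: "y \<in> space M"
        have p: "0 \<le> prop_acc x y" using prop_acc_bounds[OF x y] by simp
        show "\<bar>prop_acc x y * v n y\<bar> \<le> real L * (f y * \<bar>v n y\<bar>) + 2 * C * ?t y"
        proof (cases "real L * f y < prop_acc x y")
          case True
          have "prop_acc x y * \<bar>v n y\<bar> \<le> prop_acc x y * (2 * C)" using vC[OF y] p by (rule mult_left_mono)
          moreover have "0 \<le> real L * (f y * \<bar>v n y\<bar>)" using f_pos[of y] by simp
          ultimately have "prop_acc x y * \<bar>v n y\<bar> \<le> real L * (f y * \<bar>v n y\<bar>) + prop_acc x y * (2 * C)" by linarith
          then show ?thesis using p True y by (simp add: abs_mult mult_ac)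
        next
          case False
          then have "prop_acc x y * \<bar>v n y\<bar> \<le> (real L * f y) * \<bar>v n y\<bar>" by (intro mult_right_mono) auto
          then show ?thesis using p False by (simp add: abs_mult mult_ac)
        qed
      qed
      also have "\<dots> = real L * (\<integral>y. f y * \<bar>v n y\<bar> \<partial>M) + (2 * C) * (\<integral>y. ?t y \<partial>M)" using fi ti by simp
      also have "\<dots> < e"
      proof -
        have "(\<integral>y. f y * \<bar>v n y\<bar> \<partial>M) \<le> e / (2 * (real L + 1))" using N[OF n] by linarith
        then have "real L * (\<integral>y. f y * \<bar>v n y\<bar> \<partial>M) \<le> real L * (e / (2 * (real L + 1)))" by (rule mult_left_mono) simp
        also have "\<dots> \<le> e / 2" using e by (simp add: field_simps)
        finally have 1: "real L * (\<integral>y. f y * \<bar>v n y\<bar> \<partial>M) \<le> e / 2" .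
        have "(2 * C) * (\<integral>y. ?t y \<partial>M) < (2 * C) * (e / (4 * C))"
          using L C by (intro mult_strict_left_mono) (auto simp: abs_less_iff)
        also have "\<dots> = e / 2" using C by simp
        finally show ?thesis using 1 by linarith
      qed
      finally show "norm ((\<integral>y. prop_acc x y * v n y \<partial>M) - 0) < e" by simp
    qed
  qed
  moreover have "v (Suc n) x = (\<integral>y. prop_acc x y * v n y \<partial>M) + rej x * v n x" for n
  proof -
    have "v (Suc n) x = kop T (v n) x" unfolding v_def using x g kop_funpow_bfun[OF g, of n] by (simp add: kop_diff)
    then show ?thesis using kop_T(1)[OF x vb] by simp
  qed
  ultimately have "(\<lambda>n. v n x) \<longlonglongrightarrow> 0" using tendsto_affine_recursion[OF r, of "\<lambda>n. v n x" "\<lambda>n. \<integral>y. prop_acc x y * v n y \<partial>M"] by blast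
  then have "(\<lambda>n. (kop T ^^ n) g x - c) \<longlonglongrightarrow> 0" by (simp add: v_def)
  then show ?thesis unfolding c_def by (rule LIM_zero_cancel)
qed

end


section \<open>The joint law of the sampler\<close>

lemma measurable_PiM_prob_algebra:
  assumes I: "finite I" and \<kappa>: "\<And>i. i \<in> I \<Longrightarrow> \<kappa> i \<in> L \<rightarrow>\<^sub>M prob_algebra (M i)"
  shows "(\<lambda>\<omega>. PiM I (\<lambda>i. \<kappa> i \<omega>)) \<in> L \<rightarrow>\<^sub>M prob_algebra (PiM I M)"
proof (rule measurable_prob_algebra_generated[OF sets_PiM Int_stable_prod_algebra prod_algebra_sets_into_space])
  have p: "prob_space (\<kappa> i \<omega>)" "sets (\<kappa> i \<omega>) = sets (M i)" if "i \<in> I" "\<omega> \<in> space L" for i \<omega>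
    using measurable_space[OF \<kappa>[OF that(1)] that(2)] by (auto simp: space_prob_algebra)
  fix \<omega> assume \<omega>: "\<omega> \<in> space L"
  show "prob_space (PiM I (\<lambda>i. \<kappa> i \<omega>))" using p \<omega> by (intro prob_space_PiM) auto
  show "sets (PiM I (\<lambda>i. \<kappa> i \<omega>)) = sets (PiM I M)" using p \<omega> by (intro sets_PiM_cong) auto
next
  fix A assume "A \<in> prod_algebra I M"
  then obtain X where A: "A = Pi\<^sub>E I X" and X: "\<And>i. i \<in> I \<Longrightarrow> X i \<in> sets (M i)"
    unfolding prod_algebra_eq_finite[OF I] by auto
  have "emeasure (PiM I (\<lambda>i. \<kappa> i \<omega>)) A = (\<Prod>i\<in>I. emeasure (\<kappa> i \<omega>) (X i))" if \<omega>: "\<omega> \<in> space L" for \<omega>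
  proof -
    define \<kappa>' where "\<kappa>' = (\<lambda>i. if i \<in> I then \<kappa> i \<omega> else return (count_space UNIV) undefined)"
    have p: "prob_space (\<kappa> i \<omega>)" "sets (\<kappa> i \<omega>) = sets (M i)" if "i \<in> I" for i
      using measurable_space[OF \<kappa>[OF that] \<omega>] by (auto simp: space_prob_algebra)
    have p': "prob_space (\<kappa>' i)" for i using p by (auto simp: \<kappa>'_def prob_space_return)
    interpret product_prob_space \<kappa>' I by (rule product_prob_spaceI) (rule p')
    have "PiM I (\<lambda>i. \<kappa> i \<omega>) = PiM I \<kappa>'" by (intro PiM_cong) (auto simp: \<kappa>'_def)
    then have "emeasure (PiM I (\<lambda>i. \<kappa> i \<omega>)) A = emeasure (PiM I \<kappa>') (Pi\<^sub>E I X)" by (simp add: A)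
    also have "\<dots> = (\<Prod>i\<in>I. emeasure (\<kappa>' i) (X i))" using I X p by (intro emeasure_PiM) (auto simp: \<kappa>'_def)
    also have "\<dots> = (\<Prod>i\<in>I. emeasure (\<kappa> i \<omega>) (X i))" by (intro prod.cong) (auto simp: \<kappa>'_def)
    finally show ?thesis .
  qed
  moreover have "(\<lambda>\<omega>. \<Prod>i\<in>I. emeasure (\<kappa> i \<omega>) (X i)) \<in> borel_measurable L"
    using X measurable_prob_algebraD[OF \<kappa>]
    by (intro borel_measurable_prod_ennreal measurable_compose[OF _ measurable_emeasure_subprob_algebra]) auto
  ultimately show "(\<lambda>\<omega>. emeasure (PiM I (\<lambda>i. \<kappa> i \<omega>)) A) \<in> borel_measurable L"
    by (subst measurable_cong) auto
qed

lemma bind_pmf_kernel: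
  fixes p :: "'b pmf"
  assumes \<kappa>: "\<And>b. \<kappa> b \<in> space (prob_algebra M)"
  shows "bind (measure_pmf p) \<kappa> \<in> space (prob_algebra M)"
    and "g \<in> bfun M \<Longrightarrow> (\<integral>x. g x \<partial>bind (measure_pmf p) \<kappa>) = (\<integral>b. (\<integral>x. g x \<partial>\<kappa> b) \<partial>measure_pmf p)"
proof -
  have p: "measure_pmf p \<in> space (prob_algebra (count_space UNIV))"
    by (simp add: space_prob_algebra measure_pmf.prob_space_axioms)
  have k: "\<kappa> \<in> count_space UNIV \<rightarrow>\<^sub>M prob_algebra M" using \<kappa> by simp
  show "bind (measure_pmf p) \<kappa> \<in> space (prob_algebra M)"
    using prob_space_bind'[OF p k] sets_bind'[OF p k] by (simp add: space_prob_algebra)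
  assume g: "g \<in> bfun M"
  obtain C where C: "\<forall>x\<in>space M. \<bar>g x\<bar> \<le> C" using bfun_bounded[OF g] by blast
  have "\<kappa> \<in> measure_pmf p \<rightarrow>\<^sub>M subprob_algebra M" using measurable_prob_algebraD[OF k] by (simp cong: measurable_cong_sets)
  then show "(\<integral>x. g x \<partial>bind (measure_pmf p) \<kappa>) = (\<integral>b. (\<integral>x. g x \<partial>\<kappa> b) \<partial>measure_pmf p)"
    using g C \<kappa> by (intro integral_bind[where K=M and B=C and B'=1])
      (auto dest: bfun_measurable simp: space_prob_algebra prob_space.emeasure_space_1 measure_pmf.finite_measure_axioms)
qed

lemma integral_bind_bfun:
  assumes A: "A \<in> space (prob_algebra N)" and \<kappa>: "\<kappa> \<in> N \<rightarrow>\<^sub>M prob_algebra M" and g: "g \<in> bfun M"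
  shows "(\<integral>x. g x \<partial>bind A \<kappa>) = (\<integral>b. (\<integral>x. g x \<partial>\<kappa> b) \<partial>A)"
proof -
  obtain C where C: "\<forall>x\<in>space M. \<bar>g x\<bar> \<le> C" using bfun_bounded[OF g] by blast
  have s: "sets A = sets N" "prob_space A" using A by (auto simp: space_prob_algebra)
  have sp: "space A = space N" using s(1) by (rule sets_eq_imp_space_eq)
  have k: "\<kappa> \<in> A \<rightarrow>\<^sub>M subprob_algebra M"
    unfolding measurable_cong_sets[OF s(1) refl] by (rule measurable_prob_algebraD[OF \<kappa>])
  have "emeasure (\<kappa> x) (space (\<kappa> x)) = 1" if "x \<in> space N" for x
    using measurable_space[OF \<kappa> that] by (auto simp: space_prob_algebra prob_space.emeasure_space_1)
  then have "AE x in A. emeasure (\<kappa> x) (space (\<kappa> x)) \<le> ennreal 1" by (intro AE_I2) (simp add: sp)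
  then show ?thesis
    using C bfun_measurable[OF g] k prob_space.finite_measure[OF s(2)]
    by (intro integral_bind[where K=M and B=C and B'=1]) auto
qed

locale ee_sampler =
  fixes M :: "'a measure" and h :: "'a \<Rightarrow> real" and K :: nat
    and H Tm :: "nat \<Rightarrow> real" and q :: "nat \<Rightarrow> 'a \<Rightarrow> 'a \<Rightarrow> real"
    and pee :: real and B N :: nat and x0 :: "nat \<Rightarrow> 'a"
  assumes sf: "sigma_finite_measure M"
    and h_meas[measurable]: "h \<in> borel_measurable M"
    and H_mono: "\<forall>j<K. H j < H (Suc j)"
    and H0: "\<forall>x\<in>space M. H 0 \<le> h x"
    and T0: "Tm 0 = 1"
    and T_mono: "\<forall>j<K. Tm j < Tm (Suc j)"
    and normalisable: "\<forall>i\<le>K. integrable M (ee_f h H Tm i)"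
    and q_meas: "\<forall>i\<le>K. (\<lambda>(x, y). q i x y) \<in> borel_measurable (M \<Otimes>\<^sub>M M)"
    and q_nonneg: "\<forall>i\<le>K. \<forall>x\<in>space M. \<forall>y\<in>space M. 0 \<le> q i x y"
    and q_prob: "\<forall>i\<le>K. \<forall>x\<in>space M. (\<integral>\<^sup>+ y. ennreal (q i x y) \<partial>M) = 1"
    and pee: "0 < pee" "pee < 1"
    and x0: "\<forall>i\<le>K. x0 i \<in> space M"
    and irred: "irreducible_kernel M (ee_Tmh M h H Tm q K)"
    and aper: "aperiodic_kernel M (ee_Tmh M h H Tm q K)"
    and connect: "\<forall>i<K. \<forall>j\<le>K.
        (0 < j \<longrightarrow> (\<exists>A1 B1. A1 \<in> sets M \<and> B1 \<in> sets M \<and>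
            A1 \<subseteq> ee_D M h K H j \<and> B1 \<subseteq> ee_D M h K H (j - 1) \<and>
            emeasure M A1 > 0 \<and> emeasure M B1 > 0 \<and>
            kernel_set_trans M (ee_Tmh M h H Tm q i) A1 B1 > 0)) \<and>
        (j < K \<longrightarrow> (\<exists>A2 B2. A2 \<in> sets M \<and> B2 \<in> sets M \<and>
            A2 \<subseteq> ee_D M h K H j \<and> B2 \<subseteq> ee_D M h K H (Suc j) \<and>
            emeasure M A2 > 0 \<and> emeasure M B2 > 0 \<and>
            kernel_set_trans M (ee_Tmh M h H Tm q i) A2 B2 > 0))"
    and pos_mass: "\<forall>i\<le>K. \<forall>j\<le>K. measure (ee_pi M h H Tm i) (ee_D M h K H j) > 0"
begin

abbreviation f :: "nat \<Rightarrow> 'a \<Rightarrow> real" where "f \<equiv> ee_f h H Tm"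
abbreviation \<pi> :: "nat \<Rightarrow> 'a measure" where "\<pi> \<equiv> ee_pi M h H Tm"
abbreviation T :: "nat \<Rightarrow> 'a \<Rightarrow> 'a measure" where "T \<equiv> ee_Tmh M h H Tm q"
abbreviation D :: "nat \<Rightarrow> 'a set" where "D \<equiv> ee_D M h K H"
abbreviation I :: "'a \<Rightarrow> nat" where "I \<equiv> ee_I h K H"

lemma f_pos: "f i x > 0" by (simp add: ee_f_def)

lemma f_meas[measurable]: "f i \<in> borel_measurable M" unfolding ee_f_def by measurable

lemma D_sets[measurable]: "D j \<in> sets M" unfolding ee_D_def by measurable

lemma metropolis: assumes i: "i \<le> K" shows "metropolis M (f i) (q i)"
proof -
  interpret sigma_finite_measure M by (rule sf)
  have n: "(\<integral>x. f i x \<partial>M) \<noteq> 0"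
  proof
    assume 0: "(\<integral>x. f i x \<partial>M) = 0"
    have "measure (\<pi> i) (D 0) = 0" unfolding ee_pi_def 0 by (simp add: measure_def emeasure_density)
    then show False using pos_mass i by force
  qed
  have "0 \<le> (\<integral>x. f i x \<partial>M)" using f_pos by (intro integral_nonneg_AE) (auto intro!: AE_I2 less_imp_le)
  then show ?thesis using n i f_pos normalisable q_meas q_nonneg q_prob by unfold_locales auto
qed

lemma target_eq: "i \<le> K \<Longrightarrow> metropolis.target M (f i) = \<pi> i"
  unfolding metropolis.target_def[OF metropolis] ee_pi_def ..

lemma reversible_kernel_T: "i \<le> K \<Longrightarrow> reversible_kernel M (T i) (\<pi> i)"
proof -
  assume i: "i \<le> K"
  interpret m: metropolis M "f i" "q i" by (rule metropolis[OF i])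
  show ?thesis unfolding ee_Tmh_def target_eq[OF i, symmetric] by (rule m.reversible_kernel_axioms)
qed

lemma sets_pi[simp, measurable_cong]: "sets (\<pi> i) = sets M" by (simp add: ee_pi_def)
lemma space_pi[simp]: "space (\<pi> i) = space M" by (simp add: ee_pi_def)

lemma prob_pi: "i \<le> K \<Longrightarrow> prob_space (\<pi> i)"
  using reversible_kernel_T unfolding reversible_kernel_def stationary_kernel_def by blast

lemma kernel_T: "i \<le> K \<Longrightarrow> T i \<in> M \<rightarrow>\<^sub>M prob_algebra M"
  using reversible_kernel_T unfolding reversible_kernel_def stationary_kernel_def markov_kernel_def by blast

lemma space_not_empty: "space M \<noteq> {}"
  using prob_space.not_empty[OF prob_pi[of 0]] by simp

lemma H_strict: "a < b \<Longrightarrow> b \<le> K \<Longrightarrow> H a < H b"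
proof (induction b)
  case (Suc b)
  then show ?case using H_mono by (cases "a = b") (auto intro: less_trans)
qed simp

lemma Tm_ge: "i \<le> K \<Longrightarrow> 1 \<le> Tm i"
proof (induction i)
  case (Suc i)
  then have "1 \<le> Tm i" "Tm i < Tm (Suc i)" using T_mono by auto
  then show ?case by linarith
qed (simp add: T0)

lemma I_le: "x \<in> space M \<Longrightarrow> I x \<le> K"
  and I_iff: "x \<in> space M \<Longrightarrow> j \<le> K \<Longrightarrow> I x = j \<longleftrightarrow> x \<in> D j"
proof -
  assume x: "x \<in> space M"
  let ?S = "{j. j \<le> K \<and> H j \<le> h x}"
  have fin: "finite ?S" and ne: "?S \<noteq> {}" using H0 x by auto
  have mem: "I x \<in> ?S" unfolding ee_I_def by (rule Max_in[OF fin ne])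
  have ge: "j \<le> I x" if "j \<in> ?S" for j unfolding ee_I_def by (rule Max_ge[OF fin that])
  show "I x \<le> K" using mem by simp
  have *: "x \<in> D (I x)"
  proof -
    have "h x < H (Suc (I x))" if "I x < K" using ge[of "Suc (I x)"] that by (intro not_le_imp_less) auto
    then show ?thesis using mem x by (auto simp: ee_D_def)
  qed
  assume j: "j \<le> K"
  show "I x = j \<longleftrightarrow> x \<in> D j"
  proof
    assume D: "x \<in> D j"
    then have "j \<le> I x" using j by (intro ge) (auto simp: ee_D_def)
    moreover have "\<not> j < I x"
    proof
      assume lt: "j < I x"
      then have "H (Suc j) \<le> H (I x)" using H_strict[of "Suc j" "I x"] mem by (cases "Suc j = I x") auto
      then show False using D lt mem by (auto simp: ee_D_def)
    qed
    ultimately show "I x = j" by simp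
  qed (use * in auto)
qed

lemma I_meas[measurable]: "I \<in> M \<rightarrow>\<^sub>M count_space UNIV"
proof (subst measurable_count_space_eq_countable, safe)
  fix j
  have "I -` {j} \<inter> space M = (if j \<le> K then D j else {})"
    using I_le I_iff by (auto simp: ee_D_def)
  then show "I -` {j} \<inter> space M \<in> sets M" by (auto simp: D_sets)
qed auto

abbreviation \<Omega> :: "(nat \<Rightarrow> nat \<Rightarrow> 'a) measure" where "\<Omega> \<equiv> ee_space M"

lemma coord_meas[measurable]: "(\<lambda>\<omega>. \<omega> i n) \<in> \<Omega> \<rightarrow>\<^sub>M M"
proof -
  have 1: "(\<lambda>\<omega>. \<omega> i) \<in> \<Omega> \<rightarrow>\<^sub>M PiM UNIV (\<lambda>_. M)"
    unfolding ee_space_def by (rule measurable_component_singleton) simp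
  have 2: "(\<lambda>v. v n) \<in> PiM UNIV (\<lambda>_. M) \<rightarrow>\<^sub>M M" by (rule measurable_component_singleton) simp
  show ?thesis using measurable_compose[OF 1 2] .
qed

lemma coord_space: "\<omega> \<in> space \<Omega> \<Longrightarrow> \<omega> i n \<in> space M"
  using measurable_space[OF coord_meas] .

definition acc :: "nat \<Rightarrow> 'a \<Rightarrow> 'a \<Rightarrow> real" where
  "acc i x y = min 1 ((f i y * f (Suc i) x) / (f i x * f (Suc i) y))"

lemma acc_bounds: "0 \<le> acc i x y" "acc i x y \<le> 1"
  using f_pos by (auto simp: acc_def intro!: divide_nonneg_nonneg mult_nonneg_nonneg less_imp_le)

lemma acc_meas[measurable]: "(\<lambda>(x, y). acc i x y) \<in> borel_measurable (M \<Otimes>\<^sub>M M)"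
  unfolding acc_def by measurable

lemma jump:
  assumes xy: "x \<in> space M" "y \<in> space M"
  shows "ee_jump M h H Tm i x y \<in> space (prob_algebra M)"
    and "g \<in> bfun M \<Longrightarrow> (\<integral>z. g z \<partial>ee_jump M h H Tm i x y) = acc i x y * g y + (1 - acc i x y) * g x"
proof -
  have k: "return M (if b then y else x) \<in> space (prob_algebra M)" for b
    using xy by (auto simp: space_prob_algebra intro!: prob_space_return)
  show "ee_jump M h H Tm i x y \<in> space (prob_algebra M)"
    unfolding ee_jump_def by (rule bind_pmf_kernel(1)[OF k])
  assume g: "g \<in> bfun M"
  have "(\<integral>z. g z \<partial>ee_jump M h H Tm i x y) = (\<integral>b. (\<integral>z. g z \<partial>return M (if b then y else x)) \<partial>bernoulli_pmf (acc i x y))"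
    unfolding ee_jump_def acc_def by (rule bind_pmf_kernel(2)[OF k g])
  also have "\<dots> = acc i x y * g y + (1 - acc i x y) * g x"
    using acc_bounds xy bfun_measurable[OF g] by (simp add: integral_return)
  finally show "(\<integral>z. g z \<partial>ee_jump M h H Tm i x y) = acc i x y * g y + (1 - acc i x y) * g x" .
qed

lemma mix:
  assumes "P \<in> space (prob_algebra M)" "Q \<in> space (prob_algebra M)"
  shows "mix_measure pee P Q \<in> space (prob_algebra M)"
    and "g \<in> bfun M \<Longrightarrow> (\<integral>z. g z \<partial>mix_measure pee P Q) = pee * (\<integral>z. g z \<partial>P) + (1 - pee) * (\<integral>z. g z \<partial>Q)"
proof -
  have k: "(if b then P else Q) \<in> space (prob_algebra M)" for b using assms by auto
  show "mix_measure pee P Q \<in> space (prob_algebra M)"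
    unfolding mix_measure_def by (rule bind_pmf_kernel(1)[OF k])
  assume g: "g \<in> bfun M"
  show "(\<integral>z. g z \<partial>mix_measure pee P Q) = pee * (\<integral>z. g z \<partial>P) + (1 - pee) * (\<integral>z. g z \<partial>Q)"
    unfolding mix_measure_def bind_pmf_kernel(2)[OF k g] using pee by simp
qed

abbreviation ring :: "nat \<Rightarrow> nat \<Rightarrow> (nat \<Rightarrow> nat \<Rightarrow> 'a) \<Rightarrow> nat set" where "ring \<equiv> ee_ring h K H B N"
abbreviation nxt :: "nat \<Rightarrow> nat \<Rightarrow> (nat \<Rightarrow> nat \<Rightarrow> 'a) \<Rightarrow> 'a measure" where
  "nxt \<equiv> ee_next M h K H Tm q pee B N"

lemma ring_finite: "finite (ring i n \<omega>)"
  by (rule finite_subset[of _ "{..n + B + N}"]) (auto simp: ee_ring_def)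

lemma nxt_props:
  assumes \<omega>: "\<omega> \<in> space \<Omega>" and i: "i \<le> K"
  shows "nxt i n \<omega> \<in> space (prob_algebra M)"
    and "g \<in> bfun M \<Longrightarrow> (\<integral>z. g z \<partial>nxt i n \<omega>) =
       (if i = K \<or> ring i n \<omega> = {} then kop (T i) g (\<omega> i n)
        else pee * ((\<Sum>m\<in>ring i n \<omega>. acc i (\<omega> i n) (\<omega> (Suc i) m) * g (\<omega> (Suc i) m)
             + (1 - acc i (\<omega> i n) (\<omega> (Suc i) m)) * g (\<omega> i n)) / card (ring i n \<omega>))
           + (1 - pee) * kop (T i) g (\<omega> i n))"
proof -
  let ?R = "ring i n \<omega>"
  have Tp: "T i (\<omega> i n) \<in> space (prob_algebra M)" by (rule measurable_space[OF kernel_T[OF i] coord_space[OF \<omega>]])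
  have j: "ee_jump M h H Tm i (\<omega> i n) (\<omega> (Suc i) m) \<in> space (prob_algebra M)" for m
    by (rule jump(1)) (simp_all add: coord_space[OF \<omega>])
  note b = bind_pmf_kernel[OF j, where p="pmf_of_set ?R"]
  show "nxt i n \<omega> \<in> space (prob_algebra M)"
    unfolding ee_next_def Let_def using Tp b(1) mix(1) by auto
  assume g: "g \<in> bfun M"
  show "(\<integral>z. g z \<partial>nxt i n \<omega>) =
       (if i = K \<or> ring i n \<omega> = {} then kop (T i) g (\<omega> i n)
        else pee * ((\<Sum>m\<in>ring i n \<omega>. acc i (\<omega> i n) (\<omega> (Suc i) m) * g (\<omega> (Suc i) m)
             + (1 - acc i (\<omega> i n) (\<omega> (Suc i) m)) * g (\<omega> i n)) / card (ring i n \<omega>))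
           + (1 - pee) * kop (T i) g (\<omega> i n))"
  proof (cases "i = K \<or> ?R = {}")
    case True then show ?thesis unfolding ee_next_def Let_def kop_def by auto
  next
    case False
    then have "?R \<noteq> {}" by simp
    then show ?thesis unfolding ee_next_def Let_def using False
      by (simp add: mix(2)[OF b(1) Tp g] b(2)[OF g] jump(2)[OF coord_space[OF \<omega>] coord_space[OF \<omega>] g]
        integral_pmf_of_set ring_finite kop_def)
  qed
qed

lemma ring_meas[measurable]: "Measurable.pred \<Omega> (\<lambda>\<omega>. m \<in> ring i n \<omega>)"
  unfolding ee_ring_def by simp measurable

lemma sum_ring_eq:
  fixes F :: "nat \<Rightarrow> real"
  shows "(\<Sum>m\<in>ring i n \<omega>. F m) = (\<Sum>m=B..n+B+N. if m \<in> ring i n \<omega> then F m else 0)"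
proof -
  have "sum F (ring i n \<omega>) = sum F ({B..n+B+N} \<inter> ring i n \<omega>)"
    by (rule arg_cong[where f="sum F"]) (auto simp: ee_ring_def)
  also have "\<dots> = (\<Sum>m=B..n+B+N. if m \<in> ring i n \<omega> then F m else 0)" by (rule sum.inter_restrict) simp
  finally show ?thesis .
qed

lemma card_ring_eq: "real (card (ring i n \<omega>)) = (\<Sum>m=B..n+B+N. if m \<in> ring i n \<omega> then 1 else 0)"
  using sum_ring_eq[of "\<lambda>_. 1" i n \<omega>] by simp

lemma nxt_integral_meas:
  assumes i: "i \<le> K" and g: "g \<in> bfun M"
  shows "(\<lambda>\<omega>. \<integral>z. g z \<partial>nxt i n \<omega>) \<in> bfun \<Omega>"
proof -
  note [measurable] = bfun_measurable[OF g]
  interpret markov_kernel M "T i" by unfold_locales (rule kernel_T[OF i])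
  note [measurable] = bfun_measurable[OF kop_bfun[OF g]]
  obtain C where C: "\<forall>x\<in>space M. \<bar>g x\<bar> \<le> C" using bfun_bounded[OF g] by blast
  have e: "ring i n \<omega> = {} \<longleftrightarrow> (\<Sum>m=B..n+B+N. if m \<in> ring i n \<omega> then 1 else 0::real) = 0" for \<omega>
    using ring_finite[of i n \<omega>] by (simp add: card_ring_eq[symmetric])
  have "(\<lambda>\<omega>. \<integral>z. g z \<partial>nxt i n \<omega>) \<in> borel_measurable \<Omega>"
    by (subst measurable_cong[OF nxt_props(2)[OF _ i g]], assumption)
      (unfold e sum_ring_eq card_ring_eq, measurable)
  moreover have "\<bar>\<integral>z. g z \<partial>nxt i n \<omega>\<bar> \<le> C" if "\<omega> \<in> space \<Omega>" for \<omega>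
  proof -
    have *: "prob_space (nxt i n \<omega>)" "sets (nxt i n \<omega>) = sets M"
      using nxt_props(1)[OF that i, of n] by (auto simp: space_prob_algebra)
    have sp: "space (nxt i n \<omega>) = space M" using *(2) by (rule sets_eq_imp_space_eq)
    show ?thesis using C sp by (intro prob_space.abs_integral_le_bound[OF *(1)]) auto
  qed
  ultimately show ?thesis by (rule bfunI)
qed

lemma kernel_nxt: assumes i: "i \<le> K" shows "nxt i n \<in> \<Omega> \<rightarrow>\<^sub>M prob_algebra M"
proof (rule measurable_prob_algebraI)
  have p: "prob_space (nxt i n \<omega>)" "sets (nxt i n \<omega>) = sets M" if "\<omega> \<in> space \<Omega>" for \<omega>
    using nxt_props(1)[OF that i, of n] by (auto simp: space_prob_algebra)
  show "prob_space (nxt i n \<omega>)" if "\<omega> \<in> space \<Omega>" for \<omega> by (rule p[OF that])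
  show "nxt i n \<in> \<Omega> \<rightarrow>\<^sub>M subprob_algebra M"
  proof (rule measurable_subprob_algebra)
    fix A assume A: "A \<in> sets M"
    have "emeasure (nxt i n \<omega>) A = ennreal (\<integral>z. indicator A z \<partial>nxt i n \<omega>)" if "\<omega> \<in> space \<Omega>" for \<omega>
    proof -
      interpret prob_space "nxt i n \<omega>" by (rule p[OF that])
      show ?thesis using A p(2)[OF that] by (simp add: emeasure_eq_measure sets.Int_space_eq2)
    qed
    moreover have "(\<lambda>\<omega>. ennreal (\<integral>z. indicator A z \<partial>nxt i n \<omega>)) \<in> borel_measurable \<Omega>"
      using bfun_measurable[OF nxt_integral_meas[OF i bfun_indicator[OF A]]] by measurable
    ultimately show "(\<lambda>\<omega>. emeasure (nxt i n \<omega>) A) \<in> borel_measurable \<Omega>" by (subst measurable_cong) auto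
  qed (simp_all add: p prob_space_imp_subprob_space)
qed

abbreviation start :: "nat \<Rightarrow> nat" where "start \<equiv> ee_start K B N"
abbreviation law :: "nat \<Rightarrow> (nat \<Rightarrow> nat \<Rightarrow> 'a) measure" where
  "law \<equiv> ee_law M h K H Tm q pee B N x0"

definition upd :: "nat \<Rightarrow> (nat \<Rightarrow> nat \<Rightarrow> 'a) \<Rightarrow> (nat \<Rightarrow> 'a) \<Rightarrow> nat \<Rightarrow> nat \<Rightarrow> 'a" where
  "upd t \<omega> v = (\<lambda>i n. if i \<le> K \<and> start i \<le> t \<and> n = Suc (t - start i) then v i else \<omega> i n)"

definition moves :: "nat \<Rightarrow> nat \<Rightarrow> (nat \<Rightarrow> nat \<Rightarrow> 'a) \<Rightarrow> 'a measure" where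
  "moves t i \<omega> = (if start i \<le> t then nxt i (t - start i) \<omega> else return M (\<omega> i 0))"

lemma step_eq: "ee_step M h K H Tm q pee B N t \<omega> = distr (PiM {..K} (\<lambda>i. moves t i \<omega>)) \<Omega> (upd t \<omega>)"
  unfolding ee_step_def moves_def upd_def ..

lemma kernel_moves: "i \<le> K \<Longrightarrow> moves t i \<in> \<Omega> \<rightarrow>\<^sub>M prob_algebra M"
  unfolding moves_def using kernel_nxt[of i "t - start i"]
    measurable_compose[OF coord_meas measurable_return_prob_space, of i 0] by (cases "start i \<le> t") auto

lemma upd_meas: "(\<lambda>(\<omega>, v). upd t \<omega> v) \<in> \<Omega> \<Otimes>\<^sub>M PiM {..K} (\<lambda>_. M) \<rightarrow>\<^sub>M \<Omega>"
proof -
  have 1: "(\<lambda>z. upd t (fst z) (snd z) i n) \<in> \<Omega> \<Otimes>\<^sub>M PiM {..K} (\<lambda>_. M) \<rightarrow>\<^sub>M M" for i n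
  proof (cases "i \<le> K \<and> start i \<le> t \<and> n = Suc (t - start i)")
    case True
    have "(\<lambda>v. v i) \<in> PiM {..K} (\<lambda>_. M) \<rightarrow>\<^sub>M M" using True by (intro measurable_component_singleton) auto
    then show ?thesis using True measurable_compose[OF measurable_snd] by (simp add: upd_def)
  next
    case False
    have "upd t \<omega> v i n = \<omega> i n" for \<omega> v unfolding upd_def using False by (rule if_not_P)
    then show ?thesis using measurable_compose[OF measurable_fst coord_meas[of i n]] by simp
  qed
  have 2: "(\<lambda>z. upd t (fst z) (snd z) i) \<in> \<Omega> \<Otimes>\<^sub>M PiM {..K} (\<lambda>_. M) \<rightarrow>\<^sub>M PiM UNIV (\<lambda>_. M)" for i
    using 1 measurable_space[OF 1] by (intro measurable_PiM_single') auto
  have "(\<lambda>z. upd t (fst z) (snd z)) \<in> \<Omega> \<Otimes>\<^sub>M PiM {..K} (\<lambda>_. M) \<rightarrow>\<^sub>M \<Omega>"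
    unfolding ee_space_def
  proof (rule measurable_PiM_single')
    show "(\<lambda>z. upd t (fst z) (snd z) i) \<in> PiM UNIV (\<lambda>_. PiM UNIV (\<lambda>_. M)) \<Otimes>\<^sub>M PiM {..K} (\<lambda>_. M) \<rightarrow>\<^sub>M PiM UNIV (\<lambda>_. M)" for i
      using 2 unfolding ee_space_def .
  qed (use measurable_space[OF 2] in \<open>simp add: ee_space_def PiE_UNIV_domain Pi_iff\<close>)
  then show ?thesis by (simp add: case_prod_beta')
qed

lemma kernel_step: "ee_step M h K H Tm q pee B N t \<in> \<Omega> \<rightarrow>\<^sub>M prob_algebra \<Omega>"
  unfolding step_eq[abs_def]
  by (intro measurable_distr_prob_space2[OF measurable_PiM_prob_algebra upd_meas] kernel_moves) auto

lemma init_space: "ee_init M K x0 \<in> space \<Omega>"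
proof -
  have "ee_init M K x0 i n \<in> space M" for i n
    using x0 space_not_empty by (auto simp: ee_init_def some_in_eq)
  then show ?thesis by (auto simp: ee_space_def space_PiM)
qed

lemma law_prob: "law t \<in> space (prob_algebra \<Omega>)"
proof (induction t)
  case 0
  then show ?case using init_space by (simp add: space_prob_algebra prob_space_return)
next
  case (Suc t)
  then show ?case using prob_space_bind'[OF Suc kernel_step] sets_bind'[OF Suc kernel_step]
    by (simp add: space_prob_algebra)
qed

lemma prob_law: "prob_space (law t)" and sets_law[simp, measurable_cong]: "sets (law t) = sets \<Omega>"
  using law_prob by (auto simp: space_prob_algebra)

lemma space_law[simp]: "space (law t) = space \<Omega>" by (rule sets_eq_imp_space_eq) simp

lemma integrable_law: "\<phi> \<in> bfun \<Omega> \<Longrightarrow> integrable (law t) \<phi>"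
  by (rule bfun_integrable[OF _ prob_space.finite_measure[OF prob_law] sets_law])

lemma moves_prob:
  assumes "\<omega> \<in> space \<Omega>" "i \<le> K" shows "prob_space (moves t i \<omega>)" "sets (moves t i \<omega>) = sets M"
  using measurable_space[OF kernel_moves[OF assms(2)] assms(1)] by (auto simp: space_prob_algebra)

lemma integral_step:
  assumes \<phi>: "\<phi> \<in> bfun \<Omega>"
  shows "(\<integral>\<omega>. \<phi> \<omega> \<partial>law (Suc t)) = (\<integral>\<omega>. (\<integral>v. \<phi> (upd t \<omega> v) \<partial>PiM {..K} (\<lambda>i. moves t i \<omega>)) \<partial>law t)"
proof -
  have "(\<integral>\<omega>. \<phi> \<omega> \<partial>law (Suc t)) = (\<integral>\<omega>. (\<integral>w. \<phi> w \<partial>ee_step M h K H Tm q pee B N t \<omega>) \<partial>law t)"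
    using integral_bind_bfun[OF law_prob kernel_step \<phi>] by simp
  also have "\<dots> = (\<integral>\<omega>. (\<integral>v. \<phi> (upd t \<omega> v) \<partial>PiM {..K} (\<lambda>i. moves t i \<omega>)) \<partial>law t)"
  proof (rule Bochner_Integration.integral_cong[OF refl])
    fix \<omega> assume "\<omega> \<in> space (law t)"
    then have \<omega>: "\<omega> \<in> space \<Omega>" by simp
    have s: "sets (PiM {..K} (\<lambda>i. moves t i \<omega>)) = sets (PiM {..K} (\<lambda>_. M))"
      using moves_prob[OF \<omega>] by (intro sets_PiM_cong) auto
    have "upd t \<omega> \<in> PiM {..K} (\<lambda>i. moves t i \<omega>) \<rightarrow>\<^sub>M \<Omega>"
      unfolding measurable_cong_sets[OF s refl] using measurable_compose[OF measurable_Pair1'[OF \<omega>] upd_meas] by simp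
    then show "(\<integral>w. \<phi> w \<partial>ee_step M h K H Tm q pee B N t \<omega>) = (\<integral>v. \<phi> (upd t \<omega> v) \<partial>PiM {..K} (\<lambda>i. moves t i \<omega>))"
      unfolding step_eq using bfun_measurable[OF \<phi>] by (rule integral_distr)
  qed
  finally show ?thesis .
qed

lemma prob_moves_PiM: "\<omega> \<in> space \<Omega> \<Longrightarrow> prob_space (PiM {..K} (\<lambda>i. moves t i \<omega>))"
  using moves_prob by (intro prob_space_PiM) auto

lemma law_stable:
  assumes \<phi>: "\<phi> \<in> bfun \<Omega>" and c: "\<And>\<omega> v. \<phi> (upd t \<omega> v) = \<phi> \<omega>"
  shows "(\<integral>\<omega>. \<phi> \<omega> \<partial>law (Suc t)) = (\<integral>\<omega>. \<phi> \<omega> \<partial>law t)"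
  unfolding integral_step[OF \<phi>] c using prob_space.prob_space[OF prob_moves_PiM]
  by (intro Bochner_Integration.integral_cong) auto

lemma law_next:
  assumes i: "i \<le> K" and \<phi>: "\<phi> \<in> bfun \<Omega>" and c: "\<And>\<omega> v. \<phi> (upd (start i + m) \<omega> v) = \<phi> \<omega>" and g: "g \<in> bfun M"
  shows "(\<integral>\<omega>. \<phi> \<omega> * g (\<omega> i (Suc m)) \<partial>law (Suc (start i + m))) = (\<integral>\<omega>. \<phi> \<omega> * (\<integral>z. g z \<partial>nxt i m \<omega>) \<partial>law (start i + m))"
proof -
  let ?t = "start i + m"
  have b: "(\<lambda>\<omega>. \<phi> \<omega> * g (\<omega> i (Suc m))) \<in> bfun \<Omega>" by (intro bfun_mult \<phi> bfun_compose[OF g coord_meas])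
  have u: "upd ?t \<omega> v i (Suc m) = v i" for \<omega> v using i by (simp add: upd_def)
  show ?thesis unfolding integral_step[OF b] c u
  proof (rule Bochner_Integration.integral_cong[OF refl])
    fix \<omega> assume "\<omega> \<in> space (law ?t)"
    then have \<omega>: "\<omega> \<in> space \<Omega>" by simp
    let ?P = "PiM {..K} (\<lambda>i. moves ?t i \<omega>)"
    have ms: "sets (moves ?t i \<omega>) = sets M" by (rule moves_prob(2)[OF \<omega> i])
    have "(\<integral>z. g z \<partial>nxt i m \<omega>) = (\<integral>z. g z \<partial>moves ?t i \<omega>)" by (simp add: moves_def)
    also have "\<dots> = (\<integral>z. g z \<partial>distr ?P (moves ?t i \<omega>) (\<lambda>v. v i))"
      using i moves_prob(1)[OF \<omega>] by (subst distr_PiM_component) auto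
    also have "\<dots> = (\<integral>v. g (v i) \<partial>?P)"
      using i bfun_measurable[OF g] by (intro integral_distr measurable_component_singleton)
        (auto simp: measurable_cong_sets[OF ms refl])
    finally show "(\<integral>v. \<phi> \<omega> * g (v i) \<partial>?P) = \<phi> \<omega> * (\<integral>z. g z \<partial>nxt i m \<omega>)" by simp
  qed
qed

lemma law_frozen:
  assumes F: "F \<in> bfun (M \<Otimes>\<^sub>M M)" and n: "n \<le> m" and m: "start i + m \<le> t"
  shows "(\<integral>\<omega>. F (\<omega> i n, \<omega> i m) \<partial>law t) = (\<integral>\<omega>. F (\<omega> i n, \<omega> i m) \<partial>law (start i + m))"
  using m
proof (induction t rule: dec_induct)
  case (step t)
  have "(\<lambda>\<omega>. F (\<omega> i n, \<omega> i m)) \<in> bfun \<Omega>" by (rule bfun_compose[OF F]) measurable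
  then have "(\<integral>\<omega>. F (\<omega> i n, \<omega> i m) \<partial>law (Suc t)) = (\<integral>\<omega>. F (\<omega> i n, \<omega> i m) \<partial>law t)"
    using step n by (intro law_stable) (auto simp: upd_def)
  then show ?case using step by simp
qed simp

end


section \<open>Decorrelation and the law of large numbers\<close>

lemma double_sum_le:
  fixes c :: "nat \<Rightarrow> nat \<Rightarrow> real"
  assumes sym: "\<And>a b. c a b = c b a" and Q: "\<And>a b. \<bar>c a b\<bar> \<le> Q" and e: "0 \<le> e"
    and far: "\<And>a b. a + k \<le> b \<Longrightarrow> n1 \<le> b \<Longrightarrow> b \<le> n \<Longrightarrow> c a b \<le> e"
    and L: "L \<le> Suc n"
  shows "(\<Sum>a<L. \<Sum>b<L. c a b) \<le> e * (real L)\<^sup>2 + (2 * real (k + n1) + 1) * Q * real L"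
  using L
proof (induction L)
  case (Suc L)
  have Q0: "0 \<le> Q" using Q[of 0 0] by linarith
  have "c a L \<le> e + (if L < n1 \<or> L < a + k then Q else 0)" if "a < L" for a
    using far[of a L] Q[of a L] Suc.prems e Q0 by (cases "L < n1 \<or> L < a + k") auto
  then have "(\<Sum>a<L. c a L) \<le> (\<Sum>a<L. e + (if L < n1 \<or> L < a + k then Q else 0))" by (intro sum_mono) auto
  also have "\<dots> = e * real L + (\<Sum>a\<in>{..<L} \<inter> {a. L < n1 \<or> L < a + k}. Q)"
    by (simp add: sum.distrib sum.If_cases)
  also have "\<dots> \<le> e * real L + real (k + n1) * Q"
  proof -
    have "{..<L} \<inter> {a. L < n1 \<or> L < a + k} \<subseteq> {..<n1} \<union> {L - k..<L}" by auto
    then have "card ({..<L} \<inter> {a. L < n1 \<or> L < a + k}) \<le> card ({..<n1} \<union> {L - k..<L})" by (intro card_mono) auto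
    also have "\<dots> \<le> n1 + k" by (rule order.trans[OF card_Un_le]) auto
    finally have "real (card ({..<L} \<inter> {a. L < n1 \<or> L < a + k})) \<le> real (k + n1)" by simp
    then show ?thesis using Q0 by (simp add: mult_right_mono)
  qed
  finally have row: "(\<Sum>a<L. c a L) \<le> e * real L + real (k + n1) * Q" .
  have "(\<Sum>a<Suc L. \<Sum>b<Suc L. c a b) = (\<Sum>a<L. \<Sum>b<L. c a b) + (\<Sum>a<L. c a L) + (\<Sum>b<L. c L b) + c L L"
    by (simp add: sum.distrib)
  also have "(\<Sum>b<L. c L b) = (\<Sum>b<L. c b L)" by (intro sum.cong refl sym)
  also have "(\<Sum>a<L. \<Sum>b<L. c a b) + (\<Sum>a<L. c a L) + (\<Sum>b<L. c b L) + c L L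
      \<le> (e * (real L)\<^sup>2 + (2 * real (k + n1) + 1) * Q * real L) + 2 * (e * real L + real (k + n1) * Q) + Q"
    using Suc row Q[of L L] by (simp add: abs_le_iff)
  also have "\<dots> \<le> e * (real (Suc L))\<^sup>2 + (2 * real (k + n1) + 1) * Q * real (Suc L)"
    using e by (simp add: power2_eq_square algebra_simps)
  finally show ?case .
qed simp

context ee_sampler
begin

lemma coord_bfun: "g \<in> bfun M \<Longrightarrow> (\<lambda>\<omega>. g (\<omega> i n)) \<in> bfun \<Omega>"
  by (rule bfun_compose[OF _ coord_meas])

lemma law_frozen2:
  assumes "\<phi> \<in> bfun M" "g \<in> bfun M" "n \<le> m" "start i + m \<le> t"
  shows "(\<integral>\<omega>. \<phi> (\<omega> i n) * g (\<omega> i m) \<partial>law t) = (\<integral>\<omega>. \<phi> (\<omega> i n) * g (\<omega> i m) \<partial>law (start i + m))"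
proof -
  have "(\<lambda>z. \<phi> (fst z) * g (snd z)) \<in> bfun (M \<Otimes>\<^sub>M M)"
    using assms by (intro bfun_mult bfun_compose[of \<phi> M fst] bfun_compose[of g M snd]) auto
  from law_frozen[OF this assms(3,4)] show ?thesis by simp
qed

lemma law_frozen1:
  assumes "\<phi> \<in> bfun M" "start i + n \<le> t"
  shows "(\<integral>\<omega>. \<phi> (\<omega> i n) \<partial>law t) = (\<integral>\<omega>. \<phi> (\<omega> i n) \<partial>law (start i + n))"
  using law_frozen2[OF assms(1) bfun_const[of 1] order.refl assms(2)] by simp

lemma integral_mono_law:
  "\<phi> \<in> bfun \<Omega> \<Longrightarrow> \<psi> \<in> bfun \<Omega> \<Longrightarrow> (\<And>\<omega>. \<omega> \<in> space \<Omega> \<Longrightarrow> \<phi> \<omega> \<le> \<psi> \<omega>) \<Longrightarrow> (\<integral>\<omega>. \<phi> \<omega> \<partial>law t) \<le> (\<integral>\<omega>. \<psi> \<omega> \<partial>law t)"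
  by (intro integral_mono integrable_law) auto

lemma integral_diff_law:
  "\<phi> \<in> bfun \<Omega> \<Longrightarrow> \<psi> \<in> bfun \<Omega> \<Longrightarrow> (\<integral>\<omega>. \<phi> \<omega> - \<psi> \<omega> \<partial>law t) = (\<integral>\<omega>. \<phi> \<omega> \<partial>law t) - (\<integral>\<omega>. \<psi> \<omega> \<partial>law t)"
  by (intro Bochner_Integration.integral_diff integrable_law)

lemma weighted_integral_diff_le:
  assumes \<phi>: "\<phi> \<in> bfun \<Omega>" "\<And>\<omega>. \<omega> \<in> space \<Omega> \<Longrightarrow> \<bar>\<phi> \<omega>\<bar> \<le> 1" and u: "u \<in> bfun \<Omega>" and v: "v \<in> bfun \<Omega>"
  shows "\<bar>(\<integral>\<omega>. \<phi> \<omega> * u \<omega> \<partial>law t) - (\<integral>\<omega>. \<phi> \<omega> * v \<omega> \<partial>law t)\<bar> \<le> (\<integral>\<omega>. \<bar>u \<omega> - v \<omega>\<bar> \<partial>law t)"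
proof -
  have b: "(\<lambda>\<omega>. \<phi> \<omega> * u \<omega>) \<in> bfun \<Omega>" "(\<lambda>\<omega>. \<phi> \<omega> * v \<omega>) \<in> bfun \<Omega>" using \<phi> u v by auto
  have "\<bar>(\<integral>\<omega>. \<phi> \<omega> * u \<omega> \<partial>law t) - (\<integral>\<omega>. \<phi> \<omega> * v \<omega> \<partial>law t)\<bar> = \<bar>\<integral>\<omega>. \<phi> \<omega> * u \<omega> - \<phi> \<omega> * v \<omega> \<partial>law t\<bar>"
    by (simp add: integral_diff_law b)
  also have "\<dots> \<le> (\<integral>\<omega>. \<bar>\<phi> \<omega> * u \<omega> - \<phi> \<omega> * v \<omega>\<bar> \<partial>law t)" by simp
  also have "\<dots> \<le> (\<integral>\<omega>. \<bar>u \<omega> - v \<omega>\<bar> \<partial>law t)"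
  proof (intro integral_mono_law bfun_abs bfun_diff b u v)
    fix \<omega> assume "\<omega> \<in> space \<Omega>"
    then have "\<bar>\<phi> \<omega>\<bar> * \<bar>u \<omega> - v \<omega>\<bar> \<le> 1 * \<bar>u \<omega> - v \<omega>\<bar>" by (intro mult_right_mono \<phi>) auto
    then show "\<bar>\<phi> \<omega> * u \<omega> - \<phi> \<omega> * v \<omega>\<bar> \<le> \<bar>u \<omega> - v \<omega>\<bar>" by (simp add: abs_mult right_diff_distrib[symmetric])
  qed
  finally show ?thesis .
qed

definition step_error :: "nat \<Rightarrow> (('a \<Rightarrow> real) \<Rightarrow> 'a \<Rightarrow> real) \<Rightarrow> ('a \<Rightarrow> real) \<Rightarrow> nat \<Rightarrow> real" where
  "step_error i S g m = (\<integral>\<omega>. \<bar>(\<integral>z. g z \<partial>nxt i m \<omega>) - S g (\<omega> i m)\<bar> \<partial>law (start i + m))"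

definition mixing :: "nat \<Rightarrow> bool" where
  "mixing i \<longleftrightarrow> (\<forall>g\<in>bfun M. \<forall>e>0. \<exists>k n0. \<forall>m\<ge>n0. \<forall>n\<le>m. \<forall>\<phi>\<in>bfun M. (\<forall>x\<in>space M. \<bar>\<phi> x\<bar> \<le> 1) \<longrightarrow>
     \<bar>\<integral>\<omega>. \<phi> (\<omega> i n) * (g (\<omega> i (m + k)) - (\<integral>x. g x \<partial>\<pi> i)) \<partial>law (start i + (m + k))\<bar> \<le> e)"

definition lln :: "nat \<Rightarrow> bool" where
  "lln i \<longleftrightarrow> (\<forall>g\<in>bfun M. (\<lambda>n. \<integral>\<omega>. \<bar>(\<Sum>m\<le>n. g (\<omega> i (B + m))) / real (Suc n) - (\<integral>x. g x \<partial>\<pi> i)\<bar> \<partial>law (start i + (B + n))) \<longlonglongrightarrow> 0)"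

lemma k_step_comparison:
  assumes i: "i \<le> K" and S: "\<And>g. g \<in> bfun M \<Longrightarrow> S g \<in> bfun M"
    and err: "\<And>g. g \<in> bfun M \<Longrightarrow> step_error i S g \<longlonglongrightarrow> 0" and g: "g \<in> bfun M" and e: "e > 0"
  shows "\<exists>n0. \<forall>m\<ge>n0. \<forall>n\<le>m. \<forall>\<phi>\<in>bfun M. (\<forall>x\<in>space M. \<bar>\<phi> x\<bar> \<le> 1) \<longrightarrow>
     \<bar>(\<integral>\<omega>. \<phi> (\<omega> i n) * g (\<omega> i (m + k)) \<partial>law (start i + (m + k)))
      - (\<integral>\<omega>. \<phi> (\<omega> i n) * (S ^^ k) g (\<omega> i m) \<partial>law (start i + m))\<bar> \<le> e"
  using g e
proof (induction k arbitrary: g e)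
  case 0
  then show ?case by auto
next
  case (Suc k)
  have e2: "e / 2 > 0" using Suc.prems by simp
  obtain n1 where n1: "\<And>m n \<phi>. m \<ge> n1 \<Longrightarrow> n \<le> m \<Longrightarrow> \<phi> \<in> bfun M \<Longrightarrow> (\<forall>x\<in>space M. \<bar>\<phi> x\<bar> \<le> 1) \<Longrightarrow>
     \<bar>(\<integral>\<omega>. \<phi> (\<omega> i n) * S g (\<omega> i (m + k)) \<partial>law (start i + (m + k)))
      - (\<integral>\<omega>. \<phi> (\<omega> i n) * (S ^^ k) (S g) (\<omega> i m) \<partial>law (start i + m))\<bar> \<le> e / 2"
    using Suc.IH[OF S[OF Suc.prems(1)] e2] by blast
  obtain n2 where n2: "\<And>m. m \<ge> n2 \<Longrightarrow> \<bar>step_error i S g m\<bar> < e / 2"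
    using LIMSEQ_D[OF err[OF Suc.prems(1)] e2] by auto
  show ?case
  proof (intro exI allI impI ballI)
    fix m n \<phi> assume m: "m \<ge> max n1 n2" and n: "n \<le> m" and \<phi>: "\<phi> \<in> bfun M" "\<forall>x\<in>space M. \<bar>\<phi> x\<bar> \<le> 1"
    have \<phi>b: "(\<lambda>\<omega>. \<phi> (\<omega> i n)) \<in> bfun \<Omega>" by (rule coord_bfun[OF \<phi>(1)])
    have "(\<integral>\<omega>. \<phi> (\<omega> i n) * g (\<omega> i (m + Suc k)) \<partial>law (start i + (m + Suc k)))
        = (\<integral>\<omega>. \<phi> (\<omega> i n) * g (\<omega> i (Suc (m + k))) \<partial>law (Suc (start i + (m + k))))" by simp
    also have "\<dots> = (\<integral>\<omega>. \<phi> (\<omega> i n) * (\<integral>z. g z \<partial>nxt i (m + k) \<omega>) \<partial>law (start i + (m + k)))"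
      using n by (intro law_next[OF i \<phi>b _ Suc.prems(1)]) (simp add: upd_def)
    finally have 1: "(\<integral>\<omega>. \<phi> (\<omega> i n) * g (\<omega> i (m + Suc k)) \<partial>law (start i + (m + Suc k)))
        = (\<integral>\<omega>. \<phi> (\<omega> i n) * (\<integral>z. g z \<partial>nxt i (m + k) \<omega>) \<partial>law (start i + (m + k)))" .
    have "\<bar>(\<integral>\<omega>. \<phi> (\<omega> i n) * (\<integral>z. g z \<partial>nxt i (m + k) \<omega>) \<partial>law (start i + (m + k)))
        - (\<integral>\<omega>. \<phi> (\<omega> i n) * S g (\<omega> i (m + k)) \<partial>law (start i + (m + k)))\<bar> \<le> step_error i S g (m + k)"
      unfolding step_error_def
      using \<phi>(2) coord_space by (intro weighted_integral_diff_le \<phi>b nxt_integral_meas[OF i Suc.prems(1)] coord_bfun S Suc.prems) auto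
    then have 2: "\<bar>(\<integral>\<omega>. \<phi> (\<omega> i n) * (\<integral>z. g z \<partial>nxt i (m + k) \<omega>) \<partial>law (start i + (m + k)))
        - (\<integral>\<omega>. \<phi> (\<omega> i n) * S g (\<omega> i (m + k)) \<partial>law (start i + (m + k)))\<bar> \<le> e / 2"
      using n2[of "m + k"] m by auto
    have 3: "\<bar>(\<integral>\<omega>. \<phi> (\<omega> i n) * S g (\<omega> i (m + k)) \<partial>law (start i + (m + k)))
      - (\<integral>\<omega>. \<phi> (\<omega> i n) * (S ^^ Suc k) g (\<omega> i m) \<partial>law (start i + m))\<bar> \<le> e / 2"
      using n1[OF _ n \<phi>, unfolded funpow_swap1[symmetric]] m by simp
    show "\<bar>(\<integral>\<omega>. \<phi> (\<omega> i n) * g (\<omega> i (m + Suc k)) \<partial>law (start i + (m + Suc k)))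
      - (\<integral>\<omega>. \<phi> (\<omega> i n) * (S ^^ Suc k) g (\<omega> i m) \<partial>law (start i + m))\<bar> \<le> e"
      unfolding 1 using 2 3 by linarith
  qed
qed

lemma mixingI:
  assumes i: "i \<le> K" and S: "\<And>g. g \<in> bfun M \<Longrightarrow> S g \<in> bfun M"
    and err: "\<And>g. g \<in> bfun M \<Longrightarrow> step_error i S g \<longlonglongrightarrow> 0"
    and lim: "\<And>g e. g \<in> bfun M \<Longrightarrow> e > 0 \<Longrightarrow>
      \<exists>k n0. \<forall>m\<ge>n0. (\<integral>\<omega>. \<bar>(S ^^ k) g (\<omega> i m) - (\<integral>x. g x \<partial>\<pi> i)\<bar> \<partial>law (start i + m)) \<le> e"
  shows "mixing i"
  unfolding mixing_def
proof (intro ballI allI impI)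
  fix g and e :: real assume g: "g \<in> bfun M" and e: "e > 0"
  let ?c = "\<integral>x. g x \<partial>\<pi> i"
  have e2: "e / 2 > 0" using e by simp
  obtain k n1 where n1: "\<And>m. m \<ge> n1 \<Longrightarrow> (\<integral>\<omega>. \<bar>(S ^^ k) g (\<omega> i m) - ?c\<bar> \<partial>law (start i + m)) \<le> e / 2"
    using lim[OF g e2] by blast
  obtain n2 where n2: "\<And>m n \<phi>. m \<ge> n2 \<Longrightarrow> n \<le> m \<Longrightarrow> \<phi> \<in> bfun M \<Longrightarrow> (\<forall>x\<in>space M. \<bar>\<phi> x\<bar> \<le> 1) \<Longrightarrow>
     \<bar>(\<integral>\<omega>. \<phi> (\<omega> i n) * g (\<omega> i (m + k)) \<partial>law (start i + (m + k)))
      - (\<integral>\<omega>. \<phi> (\<omega> i n) * (S ^^ k) g (\<omega> i m) \<partial>law (start i + m))\<bar> \<le> e / 2"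
    using k_step_comparison[OF i S err g e2, of k] by blast
  have Sk: "(S ^^ k) g \<in> bfun M" for k by (induction k) (auto intro: S g)
  show "\<exists>k n0. \<forall>m\<ge>n0. \<forall>n\<le>m. \<forall>\<phi>\<in>bfun M. (\<forall>x\<in>space M. \<bar>\<phi> x\<bar> \<le> 1) \<longrightarrow>
     \<bar>\<integral>\<omega>. \<phi> (\<omega> i n) * (g (\<omega> i (m + k)) - ?c) \<partial>law (start i + (m + k))\<bar> \<le> e"
  proof (intro exI allI impI ballI)
    fix m n \<phi> assume m: "m \<ge> max n1 n2" and n: "n \<le> m" and \<phi>: "\<phi> \<in> bfun M" "\<forall>x\<in>space M. \<bar>\<phi> x\<bar> \<le> 1"
    let ?t = "start i + m" let ?t' = "start i + (m + k)"
    have \<phi>b: "(\<lambda>\<omega>. \<phi> (\<omega> i n)) \<in> bfun \<Omega>" by (rule coord_bfun[OF \<phi>(1)])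
    have "(\<integral>\<omega>. \<phi> (\<omega> i n) * (g (\<omega> i (m + k)) - ?c) \<partial>law ?t')
        = (\<integral>\<omega>. \<phi> (\<omega> i n) * g (\<omega> i (m + k)) - \<phi> (\<omega> i n) * ?c \<partial>law ?t')" by (simp add: right_diff_distrib)
    also have "\<dots> = (\<integral>\<omega>. \<phi> (\<omega> i n) * g (\<omega> i (m + k)) \<partial>law ?t') - (\<integral>\<omega>. \<phi> (\<omega> i n) * ?c \<partial>law ?t')"
      by (intro integral_diff_law bfun_mult \<phi>b coord_bfun g bfun_const)
    also have "(\<integral>\<omega>. \<phi> (\<omega> i n) * ?c \<partial>law ?t') = (\<integral>\<omega>. \<phi> (\<omega> i n) * ?c \<partial>law ?t)"
      using law_frozen1[OF \<phi>(1), of i n ?t'] law_frozen1[OF \<phi>(1), of i n ?t] n by simp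
    finally have 1: "(\<integral>\<omega>. \<phi> (\<omega> i n) * (g (\<omega> i (m + k)) - ?c) \<partial>law ?t') =
      (\<integral>\<omega>. \<phi> (\<omega> i n) * g (\<omega> i (m + k)) \<partial>law ?t') - (\<integral>\<omega>. \<phi> (\<omega> i n) * ?c \<partial>law ?t)" .
    have "\<bar>(\<integral>\<omega>. \<phi> (\<omega> i n) * (S ^^ k) g (\<omega> i m) \<partial>law ?t) - (\<integral>\<omega>. \<phi> (\<omega> i n) * ?c \<partial>law ?t)\<bar>
        \<le> (\<integral>\<omega>. \<bar>(S ^^ k) g (\<omega> i m) - ?c\<bar> \<partial>law ?t)"
      using \<phi>(2) coord_space by (intro weighted_integral_diff_le \<phi>b coord_bfun Sk bfun_const) auto
    also have "\<dots> \<le> e / 2" using m by (intro n1) auto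
    finally have 2: "\<bar>(\<integral>\<omega>. \<phi> (\<omega> i n) * (S ^^ k) g (\<omega> i m) \<partial>law ?t) - (\<integral>\<omega>. \<phi> (\<omega> i n) * ?c \<partial>law ?t)\<bar> \<le> e / 2" .
    have "m \<ge> n2" using m by simp
    from n2[OF this n \<phi>] 2 show "\<bar>\<integral>\<omega>. \<phi> (\<omega> i n) * (g (\<omega> i (m + k)) - ?c) \<partial>law ?t'\<bar> \<le> e"
      unfolding 1 by linarith
  qed
qed

lemma mixingD:
  assumes "mixing i" "g \<in> bfun M" "e > 0"
  shows "\<exists>k n0. \<forall>m\<ge>n0. \<forall>n\<le>m. \<forall>\<phi>\<in>bfun M. (\<forall>x\<in>space M. \<bar>\<phi> x\<bar> \<le> 1) \<longrightarrow>
     \<bar>\<integral>\<omega>. \<phi> (\<omega> i n) * (g (\<omega> i (m + k)) - (\<integral>x. g x \<partial>\<pi> i)) \<partial>law (start i + (m + k))\<bar> \<le> e"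
  by (rule assms(1)[unfolded mixing_def, THEN bspec[OF _ assms(2)], THEN spec, THEN mp, OF assms(3)])

lemma mixing_convergence:
  assumes i: "i \<le> K" and mix: "mixing i" and A: "A \<in> sets M"
  shows "(\<lambda>n. measure (ee_dist M h K H Tm q pee B N x0 i n) A) \<longlonglongrightarrow> measure (\<pi> i) A"
proof -
  let ?g = "indicator A :: 'a \<Rightarrow> real"
  interpret pi: prob_space "\<pi> i" by (rule prob_pi[OF i])
  have g: "?g \<in> bfun M" using A by (rule bfun_indicator)
  have c: "(\<integral>x. ?g x \<partial>\<pi> i) = measure (\<pi> i) A" using sets.sets_into_space[OF A] by (simp add: Int_absorb2)
  have d: "measure (ee_dist M h K H Tm q pee B N x0 i n) A = (\<integral>\<omega>. ?g (\<omega> i n) \<partial>law (start i + n))" for n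
  proof -
    interpret l: prob_space "law (start i + n)" by (rule prob_law)
    have m: "(\<lambda>\<omega>. \<omega> i n) \<in> law (start i + n) \<rightarrow>\<^sub>M M" by measurable
    interpret d: prob_space "distr (law (start i + n)) M (\<lambda>\<omega>. \<omega> i n)" by (rule l.prob_space_distr[OF m])
    have "measure (ee_dist M h K H Tm q pee B N x0 i n) A = (\<integral>x. ?g x \<partial>distr (law (start i + n)) M (\<lambda>\<omega>. \<omega> i n))"
      unfolding ee_dist_def using sets.sets_into_space[OF A] by (simp add: Int_absorb2)
    also have "\<dots> = (\<integral>\<omega>. ?g (\<omega> i n) \<partial>law (start i + n))" using A by (intro integral_distr[OF m]) simp
    finally show ?thesis .
  qed
  show ?thesis
  proof (rule LIMSEQ_I)
    fix r :: real assume r: "r > 0"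
    then have "r / 2 > 0" by simp
    from mixingD[OF mix g this]
    obtain k n0 where *: "\<forall>m\<ge>n0. \<forall>n\<le>m. \<forall>\<phi>\<in>bfun M. (\<forall>x\<in>space M. \<bar>\<phi> x\<bar> \<le> 1) \<longrightarrow>
       \<bar>\<integral>\<omega>. \<phi> (\<omega> i n) * (?g (\<omega> i (m + k)) - (\<integral>x. ?g x \<partial>\<pi> i)) \<partial>law (start i + (m + k))\<bar> \<le> r / 2" by (elim exE)
    show "\<exists>no. \<forall>n\<ge>no. norm (measure (ee_dist M h K H Tm q pee B N x0 i n) A - measure (\<pi> i) A) < r"
    proof (intro exI allI impI)
      fix n assume n: "n \<ge> n0 + k"
      have "\<bar>\<integral>\<omega>. 1 * (?g (\<omega> i (n - k + k)) - (\<integral>x. ?g x \<partial>\<pi> i)) \<partial>law (start i + (n - k + k))\<bar> \<le> r / 2"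
        using n by (intro *[rule_format, of "n - k" 0 "\<lambda>_. 1"]) auto
      moreover have "(\<integral>\<omega>. 1 * (?g (\<omega> i n) - (\<integral>x. ?g x \<partial>\<pi> i)) \<partial>law (start i + n))
          = (\<integral>\<omega>. ?g (\<omega> i n) \<partial>law (start i + n)) - measure (\<pi> i) A"
        using integral_diff_law[OF coord_bfun[OF g, of i n] bfun_const, of "start i + n"] c
          prob_space.prob_space[OF prob_law, of "start i + n"] by simp
      ultimately show "norm (measure (ee_dist M h K H Tm q pee B N x0 i n) A - measure (\<pi> i) A) < r"
        unfolding d using n r by simp
    qed
  qed
qed

lemma mixing_imp_lln:
  assumes i: "i \<le> K" and mix: "mixing i"
  shows "lln i"
  unfolding lln_def
proof
  fix g assume g: "g \<in> bfun M"
  let ?c = "\<integral>x. g x \<partial>\<pi> i"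
  define F where "F = (\<lambda>x. g x - ?c)"
  have F: "F \<in> bfun M" unfolding F_def using g by auto
  obtain C where C: "C > 0" "\<forall>x\<in>space M. \<bar>F x\<bar> \<le> C" using bfun_bounded[OF F] by blast
  define t where "t = (\<lambda>n. start i + (B + n))"
  define A where "A = (\<lambda>n \<omega>. (\<Sum>m\<le>n. g (\<omega> i (B + m))) / real (Suc n) - ?c)"
  define Q where "Q = C * C"
  have Aeq: "A n \<omega> = (\<Sum>m\<le>n. F (\<omega> i (B + m))) / real (Suc n)" for n \<omega>
    by (simp add: A_def F_def sum_subtractf field_simps)
  have Ab: "A n \<in> bfun \<Omega>" for n
  proof -
    have "(\<lambda>\<omega>. (1 / real (Suc n)) * (\<Sum>m\<le>n. F (\<omega> i (B + m)))) \<in> bfun \<Omega>"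
      by (intro bfun_mult bfun_const bfun_sum coord_bfun F)
    then show ?thesis unfolding Aeq[abs_def] by simp
  qed
  have Fb: "(\<lambda>\<omega>. F (\<omega> i a)) \<in> bfun \<Omega>" for a by (rule coord_bfun[OF F])
  have sq: "\<exists>R. \<forall>n. (\<integral>\<omega>. (A n \<omega>)\<^sup>2 \<partial>law (t n)) \<le> e + R / real (Suc n)" if e: "e > 0" for e
  proof -
    have e': "e / C > 0" using e C by simp
    from mixingD[OF mix g e']
    obtain k n0 where *: "\<forall>m\<ge>n0. \<forall>n\<le>m. \<forall>\<phi>\<in>bfun M. (\<forall>x\<in>space M. \<bar>\<phi> x\<bar> \<le> 1) \<longrightarrow>
       \<bar>\<integral>\<omega>. \<phi> (\<omega> i n) * (g (\<omega> i (m + k)) - ?c) \<partial>law (start i + (m + k))\<bar> \<le> e / C" by (elim exE)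
    show ?thesis
    proof (intro exI allI)
      fix n
      define c where "c = (\<lambda>a b. \<integral>\<omega>. F (\<omega> i (B + a)) * F (\<omega> i (B + b)) \<partial>law (t n))"
      have cQ: "\<bar>c a b\<bar> \<le> Q" for a b
        unfolding c_def Q_def
      proof (rule prob_space.abs_integral_le_bound[OF prob_law])
        fix \<omega> assume "\<omega> \<in> space (law (t n))"
        then have "\<bar>F (\<omega> i (B + a))\<bar> \<le> C" "\<bar>F (\<omega> i (B + b))\<bar> \<le> C" using C coord_space by auto
        then show "\<bar>F (\<omega> i (B + a)) * F (\<omega> i (B + b))\<bar> \<le> C * C" unfolding abs_mult by (intro mult_mono') auto
      qed
      have far: "c a b \<le> e" if ab: "a + k \<le> b" "n0 + k \<le> b" "b \<le> n" for a b
      proof -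
        let ?m = "B + b - k"
        have mk: "?m + k = B + b" using ab by simp
        have "(\<lambda>x. (1 / C) * F x) \<in> bfun M" using F by (intro bfun_mult) auto
        moreover have "\<bar>(1 / C) * F x\<bar> \<le> 1" if "x \<in> space M" for x using C that by (auto simp: abs_mult)
        ultimately have "\<bar>\<integral>\<omega>. (1 / C) * F (\<omega> i (B + a)) * (g (\<omega> i (?m + k)) - ?c) \<partial>law (start i + (?m + k))\<bar> \<le> e / C"
          using ab by (intro *[rule_format, of ?m "B + a" "\<lambda>x. (1 / C) * F x"]) auto
        then have "\<bar>\<integral>\<omega>. (1 / C) * (F (\<omega> i (B + a)) * F (\<omega> i (B + b))) \<partial>law (start i + (B + b))\<bar> \<le> e / C"
          unfolding mk F_def by (simp add: mult.assoc)
        then have "\<bar>\<integral>\<omega>. F (\<omega> i (B + a)) * F (\<omega> i (B + b)) \<partial>law (start i + (B + b))\<bar> \<le> e"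
          using C(1) by (simp add: abs_mult divide_right_mono field_simps)
        moreover have "c a b = (\<integral>\<omega>. F (\<omega> i (B + a)) * F (\<omega> i (B + b)) \<partial>law (start i + (B + b)))"
          unfolding c_def using ab by (intro law_frozen2 F) (auto simp: t_def)
        ultimately show ?thesis by simp
      qed
      have "(\<integral>\<omega>. (\<Sum>m\<le>n. F (\<omega> i (B + m)))\<^sup>2 \<partial>law (t n))
          = (\<integral>\<omega>. (\<Sum>a<Suc n. \<Sum>b<Suc n. F (\<omega> i (B + a)) * F (\<omega> i (B + b))) \<partial>law (t n))"
        by (simp add: power2_eq_square sum_product lessThan_Suc_atMost)
      also have "\<dots> = (\<Sum>a<Suc n. \<Sum>b<Suc n. c a b)" unfolding c_def
        by (subst Bochner_Integration.integral_sum, intro integrable_law bfun_sum bfun_mult Fb,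
          intro sum.cong refl Bochner_Integration.integral_sum integrable_law bfun_mult Fb)
      also have "\<dots> \<le> e * (real (Suc n))\<^sup>2 + (2 * real (k + (n0 + k)) + 1) * Q * real (Suc n)"
        using cQ far e by (intro double_sum_le[of c Q e k "n0 + k" n]) (auto simp: c_def mult.commute)
      finally have 1: "(\<integral>\<omega>. (\<Sum>m\<le>n. F (\<omega> i (B + m)))\<^sup>2 \<partial>law (t n))
          \<le> e * (real (Suc n))\<^sup>2 + (2 * real (k + (n0 + k)) + 1) * Q * real (Suc n)" .
      have "(\<integral>\<omega>. (A n \<omega>)\<^sup>2 \<partial>law (t n)) = (\<integral>\<omega>. (\<Sum>m\<le>n. F (\<omega> i (B + m)))\<^sup>2 \<partial>law (t n)) / (real (Suc n))\<^sup>2"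
        by (simp add: Aeq power_divide)
      also have "\<dots> \<le> (e * (real (Suc n))\<^sup>2 + (2 * real (k + (n0 + k)) + 1) * Q * real (Suc n)) / (real (Suc n))\<^sup>2"
        using 1 by (rule divide_right_mono) simp
      also have "\<dots> = e + (2 * real (k + (n0 + k)) + 1) * Q / real (Suc n)"
        by (simp add: add_divide_distrib power2_eq_square)
      finally show "(\<integral>\<omega>. (A n \<omega>)\<^sup>2 \<partial>law (t n)) \<le> e + (2 * real (k + (n0 + k)) + 1) * Q / real (Suc n)" .
    qed
  qed
  have le: "(\<integral>\<omega>. \<bar>A n \<omega>\<bar> \<partial>law (t n)) \<le> sqrt (\<integral>\<omega>. (A n \<omega>)\<^sup>2 \<partial>law (t n))" for n
    using Ab by (intro prob_space.integral_abs_le_sqrt[OF prob_law] integrable_law bfun_power2)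
  have "(\<lambda>n. \<integral>\<omega>. \<bar>A n \<omega>\<bar> \<partial>law (t n)) \<longlonglongrightarrow> 0"
  proof (rule LIMSEQ_I)
    fix r :: real assume r: "r > 0"
    then have r2: "r\<^sup>2 / 2 > 0" by simp
    obtain R where R: "\<And>n. (\<integral>\<omega>. (A n \<omega>)\<^sup>2 \<partial>law (t n)) \<le> r\<^sup>2 / 2 + R / real (Suc n)" using sq[OF r2] by blast
    have "(\<lambda>n. R / real (Suc n)) \<longlonglongrightarrow> 0" using LIMSEQ_Suc[OF lim_const_over_n[of R]] by simp
    from LIMSEQ_D[OF this r2] obtain n0 where n0: "\<And>n. n \<ge> n0 \<Longrightarrow> \<bar>R / real (Suc n)\<bar> < r\<^sup>2 / 2" by auto
    show "\<exists>no. \<forall>n\<ge>no. norm ((\<integral>\<omega>. \<bar>A n \<omega>\<bar> \<partial>law (t n)) - 0) < r"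
    proof (intro exI allI impI)
      fix n assume n: "n \<ge> n0"
      have "(\<integral>\<omega>. (A n \<omega>)\<^sup>2 \<partial>law (t n)) < r\<^sup>2" using R[of n] n0[OF n] by linarith
      then have "sqrt (\<integral>\<omega>. (A n \<omega>)\<^sup>2 \<partial>law (t n)) < sqrt (r\<^sup>2)" by (rule real_sqrt_less_mono)
      then have "(\<integral>\<omega>. \<bar>A n \<omega>\<bar> \<partial>law (t n)) < r" using le[of n] r by simp
      then show "norm ((\<integral>\<omega>. \<bar>A n \<omega>\<bar> \<partial>law (t n)) - 0) < r" by simp
    qed
  qed
  then show "(\<lambda>n. \<integral>\<omega>. \<bar>(\<Sum>m\<le>n. g (\<omega> i (B + m))) / real (Suc n) - ?c\<bar> \<partial>law (start i + (B + n))) \<longlonglongrightarrow> 0"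
    by (simp add: A_def t_def)
qed

end


section \<open>The limiting jump operator\<close>

text \<open>A minorisation \<open>S\<^sup>r g \<ge> c \<integral>g d\<nu>\<close> shrinks the oscillation of \<open>g\<close> by the factor \<open>1 - c\<close>.\<close>

lemma doeblin_uniform_convergence:
  fixes S :: "('a \<Rightarrow> real) \<Rightarrow> 'a \<Rightarrow> real"
  assumes \<nu>: "prob_space \<nu>" "sets \<nu> = sets M"
    and S: "\<And>g. g \<in> bfun M \<Longrightarrow> S g \<in> bfun M"
    and cong: "\<And>u v x. (\<And>y. y \<in> space M \<Longrightarrow> u y = v y) \<Longrightarrow> x \<in> space M \<Longrightarrow> S u x = S v x"
    and affine: "\<And>g a b x. g \<in> bfun M \<Longrightarrow> x \<in> space M \<Longrightarrow> S (\<lambda>y. a + b * g y) x = a + b * S g x"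
    and inv: "\<And>g. g \<in> bfun M \<Longrightarrow> (\<integral>x. S g x \<partial>\<nu>) = (\<integral>x. g x \<partial>\<nu>)"
    and c: "c > 0"
    and minor: "\<And>g x. g \<in> bfun M \<Longrightarrow> (\<And>y. y \<in> space M \<Longrightarrow> 0 \<le> g y) \<Longrightarrow> x \<in> space M \<Longrightarrow> c * (\<integral>y. g y \<partial>\<nu>) \<le> (S ^^ r) g x"
    and g: "g \<in> bfun M" and e: "e > 0"
  shows "\<exists>k. \<forall>x\<in>space M. \<bar>(S ^^ k) g x - (\<integral>y. g y \<partial>\<nu>)\<bar> \<le> e"
proof -
  interpret \<nu>: prob_space \<nu> by fact
  have sp: "space \<nu> = space M" using \<nu>(2) by (rule sets_eq_imp_space_eq)
  have int: "integrable \<nu> u" if "u \<in> bfun M" for u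
    using that \<nu>(2) \<nu>.finite_measure_axioms by (auto intro: bfun_integrable)
  have Sn: "(S ^^ n) u \<in> bfun M" if "u \<in> bfun M" for u n using that by (induction n) (auto intro: S)
  have invn: "(\<integral>x. (S ^^ n) u x \<partial>\<nu>) = (\<integral>x. u x \<partial>\<nu>)" if "u \<in> bfun M" for u n
    by (induction n) (auto simp: inv Sn that)
  have affn: "(S ^^ n) (\<lambda>y. a + b * u y) x = a + b * (S ^^ n) u x" if "u \<in> bfun M" "x \<in> space M" for u x n a b
    using that(2)
  proof (induction n arbitrary: x)
    case (Suc n)
    have "S ((S ^^ n) (\<lambda>y. a + b * u y)) x = S (\<lambda>y. a + b * (S ^^ n) u y) x"
      using Suc by (intro cong) auto
    also have "\<dots> = a + b * S ((S ^^ n) u) x" using Suc.prems that(1) by (intro affine Sn)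
    finally show ?case by simp
  qed simp
  let ?m = "\<integral>y. g y \<partial>\<nu>"
  obtain C where C: "C > 0" "\<forall>x\<in>space M. \<bar>g x\<bar> \<le> C" using bfun_bounded[OF g] by blast
  have c1: "c \<le> 1"
  proof -
    obtain x where x: "x \<in> space M" using \<nu>.not_empty sp by auto
    have "(S ^^ r) (\<lambda>y. 1 + 0 * (0::real)) x = 1" using affn[of "\<lambda>_. 0" x r 1 0] x by simp
    then show ?thesis using minor[of "\<lambda>_. 1" x] x \<nu>.prob_space by simp
  qed
  have shrink: "\<exists>a b. b - a \<le> (1 - c) ^ n * (2 * C) \<and> (\<forall>x\<in>space M. a \<le> (S ^^ (r * n)) g x \<and> (S ^^ (r * n)) g x \<le> b)" for n
  proof (induction n)
    case 0
    have "- C \<le> g x \<and> g x \<le> C" if "x \<in> space M" for x using C(2) that by (auto simp: abs_le_iff)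
    then show ?case by (intro exI[of _ "-C"] exI[of _ C]) auto
  next
    case (Suc n)
    then obtain a b where ab: "b - a \<le> (1 - c) ^ n * (2 * C)"
      "\<forall>x\<in>space M. a \<le> (S ^^ (r * n)) g x \<and> (S ^^ (r * n)) g x \<le> b" by blast
    define u where "u = (S ^^ (r * n)) g"
    have u: "u \<in> bfun M" unfolding u_def by (rule Sn[OF g])
    have mu: "(\<integral>x. u x \<partial>\<nu>) = ?m" unfolding u_def by (rule invn[OF g])
    have U: "(S ^^ (r * Suc n)) g = (S ^^ r) u" unfolding u_def by (simp add: funpow_add)
    have "a + c * (?m - a) \<le> (S ^^ r) u x \<and> (S ^^ r) u x \<le> b - c * (b - ?m)" if x: "x \<in> space M" for x
    proof
      have "c * (\<integral>y. (- a) + 1 * u y \<partial>\<nu>) \<le> (S ^^ r) (\<lambda>y. (- a) + 1 * u y) x"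
        using ab(2) u x by (intro minor bfun_add bfun_mult) (auto simp: u_def)
      also have "\<dots> = - a + (S ^^ r) u x" using affn[OF u x, of r "-a" 1] by simp
      also have "(\<integral>y. (- a) + 1 * u y \<partial>\<nu>) = ?m - a" using int[OF u] mu \<nu>.prob_space by simp
      finally show "a + c * (?m - a) \<le> (S ^^ r) u x" by simp
      have "c * (\<integral>y. b + (- 1) * u y \<partial>\<nu>) \<le> (S ^^ r) (\<lambda>y. b + (- 1) * u y) x"
        using ab(2) u x by (intro minor bfun_add bfun_mult) (auto simp: u_def)
      also have "\<dots> = b - (S ^^ r) u x" using affn[OF u x, of r b "-1"] by simp
      also have "(\<integral>y. b + (- 1) * u y \<partial>\<nu>) = b - ?m" using int[OF u] mu \<nu>.prob_space by simp
      finally show "(S ^^ r) u x \<le> b - c * (b - ?m)" by simp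
    qed
    moreover have "(b - c * (b - ?m)) - (a + c * (?m - a)) \<le> (1 - c) ^ Suc n * (2 * C)"
    proof -
      have "(b - c * (b - ?m)) - (a + c * (?m - a)) = (1 - c) * (b - a)" by (simp add: algebra_simps)
      also have "\<dots> \<le> (1 - c) * ((1 - c) ^ n * (2 * C))" using ab(1) c1 by (intro mult_left_mono) auto
      finally show ?thesis by (simp add: mult.assoc)
    qed
    ultimately show ?case unfolding U by blast
  qed
  have "(\<lambda>n. (1 - c) ^ n * (2 * C)) \<longlonglongrightarrow> 0 * (2 * C)"
    using c c1 by (intro tendsto_mult LIMSEQ_power_zero tendsto_const) auto
  from LIMSEQ_D[OF this e] obtain n where n: "\<bar>(1 - c) ^ n * (2 * C)\<bar> < e" by auto
  obtain a b where ab: "b - a \<le> (1 - c) ^ n * (2 * C)"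
    "\<And>x. x \<in> space M \<Longrightarrow> a \<le> (S ^^ (r * n)) g x \<and> (S ^^ (r * n)) g x \<le> b" using shrink by blast
  have i: "integrable \<nu> ((S ^^ (r * n)) g)" by (rule int[OF Sn[OF g]])
  have "(\<integral>x. a \<partial>\<nu>) \<le> (\<integral>x. (S ^^ (r * n)) g x \<partial>\<nu>)" using ab(2) i sp by (intro integral_mono) auto
  then have a: "a \<le> ?m" using invn[OF g] \<nu>.prob_space by simp
  have "(\<integral>x. (S ^^ (r * n)) g x \<partial>\<nu>) \<le> (\<integral>x. b \<partial>\<nu>)" using ab(2) i sp by (intro integral_mono) auto
  then have b: "?m \<le> b" using invn[OF g] \<nu>.prob_space by simp
  have "\<bar>(S ^^ (r * n)) g x - ?m\<bar> \<le> e" if "x \<in> space M" for x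
    using ab(2)[OF that] ab(1) a b n by linarith
  then show ?thesis by blast
qed

context ee_sampler
begin

lemma start_K: "start K = 0" by (simp add: ee_start_def)

lemma integral_law_top:
  assumes "u \<in> bfun M"
  shows "(\<integral>\<omega>. u (\<omega> K m) \<partial>law (start K + m)) = (kop (T K) ^^ m) u (x0 K)"
  using assms
proof (induction m arbitrary: u)
  case 0
  show ?case unfolding start_K using init_space bfun_measurable[OF coord_bfun[OF 0]]
    by (simp add: integral_return ee_init_def)
next
  case (Suc m)
  interpret markov_kernel M "T K" by unfold_locales (rule kernel_T, simp)
  have "(\<integral>\<omega>. u (\<omega> K (Suc m)) \<partial>law (start K + Suc m)) = (\<integral>\<omega>. 1 * u (\<omega> K (Suc m)) \<partial>law (Suc (start K + m)))" by simp
  also have "\<dots> = (\<integral>\<omega>. 1 * (\<integral>z. u z \<partial>nxt K m \<omega>) \<partial>law (start K + m))"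
    by (rule law_next) (auto intro: Suc.prems)
  also have "\<dots> = (\<integral>\<omega>. kop (T K) u (\<omega> K m) \<partial>law (start K + m))"
    using nxt_props(2)[OF _ order.refl Suc.prems] by (intro Bochner_Integration.integral_cong) auto
  also have "\<dots> = (kop (T K) ^^ m) (kop (T K) u) (x0 K)" by (intro Suc.IH kop_bfun Suc.prems)
  finally show ?case by (simp add: funpow_swap1)
qed

lemma mixing_top: "mixing K"
proof (rule mixingI[of K "kop (T K)"])
  interpret m: metropolis M "f K" "q K" by (rule metropolis) simp
  have T: "T K = MH_kernel M (f K) (q K)" by (simp add: ee_Tmh_def)
  have tg: "m.target = \<pi> K" by (rule target_eq) simp
  show "kop (T K) g \<in> bfun M" if "g \<in> bfun M" for g using that unfolding T by (rule m.kop_bfun)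
  show "step_error K (kop (T K)) g \<longlonglongrightarrow> 0" if g: "g \<in> bfun M" for g
  proof -
    have "step_error K (kop (T K)) g m = 0" for m
      unfolding step_error_def using nxt_props(2)[OF _ order.refl g, of _ m]
      by (intro integral_eq_zero_AE AE_I2) auto
    then have "step_error K (kop (T K)) g = (\<lambda>_. 0)" by auto
    then show ?thesis by simp
  qed
  fix g and e :: real assume g: "g \<in> bfun M" and e: "e > 0"
  let ?c = "\<integral>x. g x \<partial>\<pi> K"
  have e2: "e / 2 > 0" using e by simp
  have "(\<lambda>n. \<integral>x. \<bar>(kop (T K) ^^ n) g x - ?c\<bar> \<partial>\<pi> K) \<longlonglongrightarrow> 0"
    using m.reversible_L1_convergence[OF irred[unfolded T] aper[unfolded T] g] unfolding T tg .
  from LIMSEQ_D[OF this e2] obtain k where k: "\<bar>\<integral>x. \<bar>(kop (T K) ^^ k) g x - ?c\<bar> \<partial>\<pi> K\<bar> < e / 2" by auto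
  define u where "u = (\<lambda>x. \<bar>(kop (T K) ^^ k) g x - ?c\<bar>)"
  have u: "u \<in> bfun M" unfolding u_def T using g by (intro bfun_abs bfun_diff m.kop_funpow_bfun bfun_const)
  have "(\<lambda>m. (kop (T K) ^^ m) u (x0 K)) \<longlonglongrightarrow> (\<integral>x. u x \<partial>\<pi> K)"
    using m.pointwise_convergence[OF irred[unfolded T] aper[unfolded T] u, of "x0 K"] x0 unfolding T tg by simp
  from LIMSEQ_D[OF this e2] obtain n0 where n0: "\<And>m. m \<ge> n0 \<Longrightarrow> \<bar>(kop (T K) ^^ m) u (x0 K) - (\<integral>x. u x \<partial>\<pi> K)\<bar> < e / 2" by auto
  have "(\<integral>\<omega>. u (\<omega> K m) \<partial>law (start K + m)) \<le> e" if "m \<ge> n0" for m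
    unfolding integral_law_top[OF u] using n0[OF that] k unfolding u_def[symmetric] by linarith
  then show "\<exists>k n0. \<forall>m\<ge>n0. (\<integral>\<omega>. \<bar>(kop (T K) ^^ k) g (\<omega> K m) - ?c\<bar> \<partial>law (start K + m)) \<le> e"
    unfolding u_def by blast
qed simp

definition w :: "nat \<Rightarrow> 'a \<Rightarrow> real" where "w i x = f i x / f (Suc i) x"

lemma w_pos: "w i x > 0" using f_pos by (simp add: w_def)

lemma w_meas[measurable]: "w i \<in> borel_measurable M" unfolding w_def by measurable

lemma acc_w: "acc i x y = min 1 (w i y / w i x)"
  using f_pos[of i x] f_pos[of i y] f_pos[of "Suc i" x] f_pos[of "Suc i" y]
  by (simp add: acc_def w_def field_simps)

lemma w_bounded: assumes i: "i < K" shows "\<exists>W>0. \<forall>x. w i x \<le> W"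
proof -
  have t: "0 < Tm i" "Tm i < Tm (Suc i)" "H i < H (Suc i)" using Tm_ge[of i] T_mono H_mono i by auto
  define W where "W = exp (max (H (Suc i) / Tm (Suc i) - H (Suc i) / Tm i) (H (Suc i) / Tm (Suc i) - H i / Tm i))"
  have "w i x \<le> W" for x
  proof -
    have "max (h x) (H (Suc i)) / Tm (Suc i) - max (h x) (H i) / Tm i
        \<le> max (H (Suc i) / Tm (Suc i) - H (Suc i) / Tm i) (H (Suc i) / Tm (Suc i) - H i / Tm i)"
    proof (cases "h x \<ge> H (Suc i)")
      case True
      have "1 / Tm (Suc i) - 1 / Tm i \<le> 0" using t by (simp add: frac_le)
      then have "(1 / Tm (Suc i) - 1 / Tm i) * h x \<le> (1 / Tm (Suc i) - 1 / Tm i) * H (Suc i)"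
        using True by (intro mult_left_mono_neg) auto
      then show ?thesis using True t by (simp add: max_def left_diff_distrib)
    next
      case False
      have "H i / Tm i \<le> max (h x) (H i) / Tm i" using t by (intro divide_right_mono) auto
      then show ?thesis using False by (simp add: max_def)
    qed
    then show ?thesis unfolding w_def ee_f_def W_def by (simp add: exp_diff[symmetric])
  qed
  then show ?thesis by (intro exI[of _ W]) (auto simp: W_def)
qed

lemma integral_pi_w:
  assumes i: "i < K" and u: "u \<in> borel_measurable M"
  shows "(\<integral>x. u x \<partial>\<pi> i) = ((\<integral>x. f (Suc i) x \<partial>M) / (\<integral>x. f i x \<partial>M)) * (\<integral>x. w i x * u x \<partial>\<pi> (Suc i))"
proof -
  have i1: "i \<le> K" "Suc i \<le> K" using i by auto
  interpret a: metropolis M "f i" "q i" by (rule metropolis[OF i1(1)])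
  interpret b: metropolis M "f (Suc i)" "q (Suc i)" by (rule metropolis[OF i1(2)])
  have 1: "(\<integral>x. u x \<partial>\<pi> i) = (\<integral>x. f i x * u x \<partial>M) / (\<integral>x. f i x \<partial>M)"
    using a.integral_target[OF u] unfolding target_eq[OF i1(1)] .
  have wu: "(\<lambda>x. w i x * u x) \<in> borel_measurable M" using u by measurable
  have "(\<integral>x. w i x * u x \<partial>\<pi> (Suc i)) = (\<integral>x. f (Suc i) x * (w i x * u x) \<partial>M) / (\<integral>x. f (Suc i) x \<partial>M)"
    using b.integral_target[OF wu] unfolding target_eq[OF i1(2)] .
  also have "(\<lambda>x. f (Suc i) x * (w i x * u x)) = (\<lambda>x. f i x * u x)"
  proof
    fix x show "f (Suc i) x * (w i x * u x) = f i x * u x" using f_pos[of "Suc i" x] by (simp add: w_def)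
  qed
  finally show ?thesis unfolding 1 using a.f_norm b.f_norm by simp
qed

definition mass :: "nat \<Rightarrow> nat \<Rightarrow> real" where "mass i j = measure (\<pi> (Suc i)) (D j)"

lemma mass_pos: "i < K \<Longrightarrow> j \<le> K \<Longrightarrow> 0 < mass i j" using pos_mass by (simp add: mass_def)

lemma mass_le: "i < K \<Longrightarrow> mass i j \<le> 1" unfolding mass_def by (intro prob_space.prob_le_1 prob_pi) simp

definition jump_fun :: "nat \<Rightarrow> ('a \<Rightarrow> real) \<Rightarrow> 'a \<Rightarrow> 'a \<Rightarrow> real" where
  "jump_fun i g x y = (if I y = I x then acc i x y * g y + (1 - acc i x y) * g x else 0)"

text \<open>Limit of the equi-energy jump: the ring is replaced by \<open>\<pi> (Suc i)\<close> conditioned on the energy set.\<close>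

definition jump_op :: "nat \<Rightarrow> ('a \<Rightarrow> real) \<Rightarrow> 'a \<Rightarrow> real" where
  "jump_op i g x = (\<integral>y. jump_fun i g x y \<partial>\<pi> (Suc i)) / mass i (I x)"

definition lim_op :: "nat \<Rightarrow> ('a \<Rightarrow> real) \<Rightarrow> 'a \<Rightarrow> real" where
  "lim_op i g x = pee * jump_op i g x + (1 - pee) * kop (T i) g x"

lemma integral_same_energy:
  assumes i: "i < K" and x: "x \<in> space M"
  shows "(\<integral>y. (if I y = I x then 1 else 0) \<partial>\<pi> (Suc i)) = mass i (I x)"
proof -
  interpret p: prob_space "\<pi> (Suc i)" using i by (intro prob_pi) simp
  have "(\<integral>y. (if I y = I x then 1 else 0) \<partial>\<pi> (Suc i)) = (\<integral>y. indicator (D (I x)) y \<partial>\<pi> (Suc i))"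
    using I_iff I_le[OF x] by (intro Bochner_Integration.integral_cong) (auto simp: indicator_def)
  also have "\<dots> = mass i (I x)" unfolding mass_def using sets.sets_into_space[OF D_sets[of "I x"]] by (simp add: Int_absorb2)
  finally show ?thesis .
qed

lemma jump_fun_meas: assumes "g \<in> borel_measurable M" shows "(\<lambda>(x, y). jump_fun i g x y) \<in> borel_measurable (M \<Otimes>\<^sub>M M)"
proof -
  note [measurable] = assms
  have [measurable]: "(\<lambda>z. real (I (fst z))) \<in> borel_measurable (M \<Otimes>\<^sub>M M)" "(\<lambda>z. real (I (snd z))) \<in> borel_measurable (M \<Otimes>\<^sub>M M)"
    by (rule measurable_compose[OF measurable_compose[OF _ I_meas]]; simp)+
  have e: "I (snd z) = I (fst z) \<longleftrightarrow> real (I (snd z)) = real (I (fst z))" for z :: "'a \<times> 'a" by simp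
  show ?thesis unfolding jump_fun_def acc_w split_beta' e by measurable
qed

lemma jump_fun_bound:
  assumes G: "\<And>x. x \<in> space M \<Longrightarrow> \<bar>g x\<bar> \<le> G" and x: "x \<in> space M" and y: "y \<in> space M"
  shows "\<bar>jump_fun i g x y\<bar> \<le> G * (if I y = I x then 1 else 0)"
proof -
  have "\<bar>acc i x y * g y + (1 - acc i x y) * g x\<bar> \<le> acc i x y * \<bar>g y\<bar> + (1 - acc i x y) * \<bar>g x\<bar>"
    using acc_bounds[of i x y] by (intro order.trans[OF abs_triangle_ineq]) (simp add: abs_mult)
  also have "\<dots> \<le> acc i x y * G + (1 - acc i x y) * G"
    using acc_bounds[of i x y] G x y by (intro add_mono mult_left_mono) auto
  finally show ?thesis by (simp add: jump_fun_def algebra_simps)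
qed

lemma jump_fun_bfun:
  assumes g: "g \<in> bfun M" and x: "x \<in> space M" shows "jump_fun i g x \<in> bfun M"
proof -
  obtain G where G: "G > 0" "\<forall>x\<in>space M. \<bar>g x\<bar> \<le> G" using bfun_bounded[OF g] by blast
  show ?thesis
  proof (rule bfunI)
    show "jump_fun i g x \<in> borel_measurable M"
      using measurable_compose_Pair1[OF x jump_fun_meas[OF bfun_measurable[OF g]]] by simp
    show "\<bar>jump_fun i g x y\<bar> \<le> G" if "y \<in> space M" for y
      using jump_fun_bound[of g G x y i] G x that by (auto split: if_splits)
  qed
qed

lemma integrable_pi: "i \<le> K \<Longrightarrow> u \<in> bfun M \<Longrightarrow> integrable (\<pi> i) u"
  by (rule bfun_integrable[OF _ prob_space.finite_measure[OF prob_pi] sets_pi])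

lemma jump_op_abs_le:
  assumes i: "i < K" and G: "\<And>x. x \<in> space M \<Longrightarrow> \<bar>g x\<bar> \<le> G" and g: "g \<in> bfun M" and x: "x \<in> space M"
  shows "\<bar>jump_op i g x\<bar> \<le> G"
proof -
  have Si: "Suc i \<le> K" using i by simp
  have same: "(\<lambda>y. if I y = I x then 1 else 0) \<in> bfun M" by (rule bfunI[where C=1]) auto
  have "\<bar>\<integral>y. jump_fun i g x y \<partial>\<pi> (Suc i)\<bar> \<le> (\<integral>y. \<bar>jump_fun i g x y\<bar> \<partial>\<pi> (Suc i))" by simp
  also have "\<dots> \<le> (\<integral>y. G * (if I y = I x then 1 else 0) \<partial>\<pi> (Suc i))"
    using jump_fun_bound[OF G x] jump_fun_bfun[OF g x] same
    by (intro integral_mono integrable_pi[OF Si] bfun_abs bfun_mult bfun_const) auto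
  also have "\<dots> = G * mass i (I x)" using integral_same_energy[OF i x] by simp
  finally show ?thesis unfolding jump_op_def using mass_pos[OF i I_le[OF x]] by (simp add: divide_le_eq)
qed

lemma jump_op_bfun: assumes i: "i < K" and g: "g \<in> bfun M" shows "jump_op i g \<in> bfun M"
proof -
  obtain G where G: "G > 0" "\<forall>x\<in>space M. \<bar>g x\<bar> \<le> G" using bfun_bounded[OF g] by blast
  interpret p: prob_space "\<pi> (Suc i)" using i by (intro prob_pi) simp
  have m: "(\<lambda>(x, y). jump_fun i g x y) \<in> borel_measurable (M \<Otimes>\<^sub>M \<pi> (Suc i))"
    using jump_fun_meas[OF bfun_measurable[OF g]] by (simp cong: measurable_cong_sets sets_pair_measure_cong)
  show ?thesis
  proof (rule bfunI[where C=G])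
    have "(\<lambda>x. \<integral>y. jump_fun i g x y \<partial>\<pi> (Suc i)) \<in> borel_measurable M"
      using p.borel_measurable_lebesgue_integral[OF m] .
    then show "jump_op i g \<in> borel_measurable M" unfolding jump_op_def by measurable
  qed (use jump_op_abs_le[OF i _ g] G in auto)
qed

lemma lim_op_bfun: assumes i: "i < K" and g: "g \<in> bfun M" shows "lim_op i g \<in> bfun M"
proof -
  interpret markov_kernel M "T i" using i by unfold_locales (auto intro: kernel_T)
  show ?thesis unfolding lim_op_def[abs_def]
    by (intro bfun_add bfun_mult bfun_const jump_op_bfun[OF i g] kop_bfun[OF g])
qed

lemma lim_op_cong:
  assumes i: "i < K" and uv: "\<And>y. y \<in> space M \<Longrightarrow> u y = v y" and x: "x \<in> space M"
  shows "lim_op i u x = lim_op i v x"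
proof -
  interpret markov_kernel M "T i" using i by unfold_locales (auto intro: kernel_T)
  have "(\<integral>y. jump_fun i u x y \<partial>\<pi> (Suc i)) = (\<integral>y. jump_fun i v x y \<partial>\<pi> (Suc i))"
    using uv x by (intro Bochner_Integration.integral_cong) (auto simp: jump_fun_def)
  then show ?thesis unfolding lim_op_def jump_op_def using kop_cong[OF x uv] by simp
qed

lemma lim_op_affine:
  assumes i: "i < K" and g: "g \<in> bfun M" and x: "x \<in> space M"
  shows "lim_op i (\<lambda>y. a + b * g y) x = a + b * lim_op i g x"
proof -
  interpret markov_kernel M "T i" using i by unfold_locales (auto intro: kernel_T)
  have Si: "Suc i \<le> K" using i by simp
  have same: "(\<lambda>y. if I y = I x then 1 else 0) \<in> bfun M" by (rule bfunI[where C=1]) auto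
  have "(\<integral>y. jump_fun i (\<lambda>y. a + b * g y) x y \<partial>\<pi> (Suc i))
      = (\<integral>y. a * (if I y = I x then 1 else 0) + b * jump_fun i g x y \<partial>\<pi> (Suc i))"
    by (intro Bochner_Integration.integral_cong) (auto simp: jump_fun_def algebra_simps)
  also have "\<dots> = a * mass i (I x) + b * (\<integral>y. jump_fun i g x y \<partial>\<pi> (Suc i))"
    using integrable_pi[OF Si same] integrable_pi[OF Si jump_fun_bfun[OF g x]] integral_same_energy[OF i x] by simp
  finally have "jump_op i (\<lambda>y. a + b * g y) x = a + b * jump_op i g x"
    unfolding jump_op_def using mass_pos[OF i I_le[OF x]] by (simp add: add_divide_distrib)
  moreover have "kop (T i) (\<lambda>y. a + b * g y) x = a + b * kop (T i) g x"
    using x g bfun_mult[OF bfun_const g, of b] by (simp add: kop_add kop_cmult)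
  ultimately show ?thesis unfolding lim_op_def by (simp add: algebra_simps)
qed

lemma jump_op_diff:
  assumes i: "i < K" and g: "g \<in> bfun M" and x: "x \<in> space M"
  shows "jump_op i g x - g x = (\<integral>y. (if I y = I x then acc i x y * (g y - g x) else 0) \<partial>\<pi> (Suc i)) / mass i (I x)"
proof -
  have Si: "Suc i \<le> K" using i by simp
  have same: "(\<lambda>y. if I y = I x then 1 else 0) \<in> bfun M" by (rule bfunI[where C=1]) auto
  have "(\<integral>y. (if I y = I x then acc i x y * (g y - g x) else 0) \<partial>\<pi> (Suc i))
      = (\<integral>y. jump_fun i g x y - g x * (if I y = I x then 1 else 0) \<partial>\<pi> (Suc i))"
    by (intro Bochner_Integration.integral_cong) (auto simp: jump_fun_def algebra_simps)
  also have "\<dots> = (\<integral>y. jump_fun i g x y \<partial>\<pi> (Suc i)) - g x * mass i (I x)"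
    using integrable_pi[OF Si same] integrable_pi[OF Si jump_fun_bfun[OF g x]] integral_same_energy[OF i x] by simp
  finally show ?thesis unfolding jump_op_def using mass_pos[OF i I_le[OF x]] by (simp add: diff_divide_distrib)
qed

end


lemma finite_uniform_pos:
  fixes P :: "'b \<Rightarrow> real \<Rightarrow> bool"
  assumes "finite A" and "\<And>a. a \<in> A \<Longrightarrow> \<exists>c>0. P a c" and mono: "\<And>a c c'. P a c \<Longrightarrow> 0 < c' \<Longrightarrow> c' \<le> c \<Longrightarrow> P a c'"
  shows "\<exists>c>0. \<forall>a\<in>A. P a c"
  using assms(1,2)
proof (induction A rule: finite_induct)
  case empty show ?case by (intro exI[of _ 1]) simp
next
  case (insert a A)
  obtain c where c: "c > 0" "\<forall>a\<in>A. P a c" using insert by blast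
  obtain d where d: "d > 0" "P a d" using insert by blast
  have "P b (min c d)" if "b \<in> insert a A" for b
    using that c d mono[of b c "min c d"] mono[of b d "min c d"] by auto
  then show ?case using c d by (intro exI[of _ "min c d"]) auto
qed

context ee_sampler
begin

lemma mass_lower: "i < K \<Longrightarrow> \<exists>c>0. \<forall>j\<in>{..K}. c \<le> mass i j"
  using mass_pos[of i] by (intro finite_uniform_pos) (auto intro: order.trans)

lemma jump_op_stationary:
  assumes i: "i < K" and g: "g \<in> bfun M"
  shows "(\<integral>x. jump_op i g x \<partial>\<pi> i) = (\<integral>x. g x \<partial>\<pi> i)"
proof -
  have Si: "Suc i \<le> K" and ii: "i \<le> K" using i by auto
  interpret p: prob_space "\<pi> (Suc i)" by (rule prob_pi[OF Si])
  obtain G where G: "G > 0" "\<forall>x\<in>space M. \<bar>g x\<bar> \<le> G" using bfun_bounded[OF g] by blast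
  obtain W where W: "W > 0" "\<And>x. w i x \<le> W" using w_bounded[OF i] by blast
  obtain c where c: "c > 0" "\<forall>j\<in>{..K}. c \<le> mass i j" using mass_lower[OF i] by blast
  note [measurable] = bfun_measurable[OF g]
  define \<Phi> where "\<Phi> = (\<lambda>x y. if I y = I x then w i x * acc i x y * (g y - g x) / mass i (I x) else 0)"
  have wa: "w i x * acc i x y = min (w i x) (w i y)" for x y
    unfolding acc_w using w_pos[of i x] by (auto simp: min_def field_simps)
  have anti: "\<Phi> y x = - \<Phi> x y" for x y unfolding \<Phi>_def wa by (auto simp: min.commute minus_divide_left algebra_simps)
  have "(\<lambda>(x, y). \<Phi> x y) \<in> bfun (M \<Otimes>\<^sub>M M)"
  proof (rule bfunI[where C="W * (2 * G) / c"])
    have [measurable]: "(\<lambda>z. real (I (fst z))) \<in> borel_measurable (M \<Otimes>\<^sub>M M)" "(\<lambda>z. real (I (snd z))) \<in> borel_measurable (M \<Otimes>\<^sub>M M)"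
      by (rule measurable_compose[OF measurable_compose[OF _ I_meas]]; simp)+
    have [measurable]: "(\<lambda>z. mass i (I (fst z))) \<in> borel_measurable (M \<Otimes>\<^sub>M M)"
      by (rule measurable_compose[OF measurable_compose[OF _ I_meas]]; simp)
    have e: "I (snd z) = I (fst z) \<longleftrightarrow> real (I (snd z)) = real (I (fst z))" for z :: "'a \<times> 'a" by simp
    show "(\<lambda>(x, y). \<Phi> x y) \<in> borel_measurable (M \<Otimes>\<^sub>M M)"
      unfolding \<Phi>_def wa split_beta' e by measurable
    fix z assume "z \<in> space (M \<Otimes>\<^sub>M M)"
    then obtain x y where z: "z = (x, y)" and xy: "x \<in> space M" "y \<in> space M" by (auto simp: space_pair_measure)
    have m: "c \<le> mass i (I x)" using c I_le[OF xy(1)] by simp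
    have 1: "\<bar>g y - g x\<bar> \<le> 2 * G" using G(2) xy by (smt (verit))
    have 2: "\<bar>min (w i x) (w i y)\<bar> \<le> W" using w_pos[of i x] w_pos[of i y] W(2)[of x] by auto
    have "\<bar>\<Phi> x y\<bar> \<le> \<bar>min (w i x) (w i y) * (g y - g x) / mass i (I x)\<bar>" unfolding \<Phi>_def wa by simp
    also have "\<dots> = \<bar>min (w i x) (w i y)\<bar> * \<bar>g y - g x\<bar> / mass i (I x)" using m c by (simp add: abs_mult)
    also have "\<dots> \<le> (W * (2 * G)) / c" using 1 2 m c W by (intro frac_le mult_mono) auto
    finally show "\<bar>case z of (x, y) \<Rightarrow> \<Phi> x y\<bar> \<le> W * (2 * G) / c" by (simp add: z)
  qed
  moreover have "finite_measure (\<pi> (Suc i) \<Otimes>\<^sub>M \<pi> (Suc i))"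
    by (intro prob_space.finite_measure prob_space_pair prob_pi Si)
  moreover have "sets (\<pi> (Suc i) \<Otimes>\<^sub>M \<pi> (Suc i)) = sets (M \<Otimes>\<^sub>M M)" by (rule sets_pair_measure_cong) simp_all
  ultimately have int: "integrable (\<pi> (Suc i) \<Otimes>\<^sub>M \<pi> (Suc i)) (\<lambda>(x, y). \<Phi> x y)" by (rule bfun_integrable)
  have "(\<integral>x. jump_op i g x - g x \<partial>\<pi> i) = (\<integral>x. f (Suc i) x \<partial>M) / (\<integral>x. f i x \<partial>M) * (\<integral>x. w i x * (jump_op i g x - g x) \<partial>\<pi> (Suc i))"
    by (intro integral_pi_w[OF i] bfun_measurable bfun_diff jump_op_bfun i g)
  also have "(\<integral>x. w i x * (jump_op i g x - g x) \<partial>\<pi> (Suc i)) = (\<integral>x. \<integral>y. \<Phi> x y \<partial>\<pi> (Suc i) \<partial>\<pi> (Suc i))"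
  proof (rule Bochner_Integration.integral_cong[OF refl])
    fix x assume "x \<in> space (\<pi> (Suc i))"
    then have x: "x \<in> space M" by simp
    have "w i x * (jump_op i g x - g x) = (w i x / mass i (I x)) * (\<integral>y. (if I y = I x then acc i x y * (g y - g x) else 0) \<partial>\<pi> (Suc i))"
      unfolding jump_op_diff[OF i g x] by simp
    also have "\<dots> = (\<integral>y. (w i x / mass i (I x)) * (if I y = I x then acc i x y * (g y - g x) else 0) \<partial>\<pi> (Suc i))" by simp
    also have "\<dots> = (\<integral>y. \<Phi> x y \<partial>\<pi> (Suc i))"
      unfolding \<Phi>_def by (intro Bochner_Integration.integral_cong) auto
    finally show "w i x * (jump_op i g x - g x) = (\<integral>y. \<Phi> x y \<partial>\<pi> (Suc i))" .
  qed
  also have "\<dots> = 0" by (rule p.integral_antisymmetric[OF int anti])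
  finally have "(\<integral>x. jump_op i g x - g x \<partial>\<pi> i) = 0" by simp
  then show ?thesis using integrable_pi[OF ii jump_op_bfun[OF i g]] integrable_pi[OF ii g] by simp
qed

lemma lim_op_stationary:
  assumes i: "i < K" and g: "g \<in> bfun M"
  shows "(\<integral>x. lim_op i g x \<partial>\<pi> i) = (\<integral>x. g x \<partial>\<pi> i)"
proof -
  have ii: "i \<le> K" using i by simp
  interpret r: reversible_kernel M "T i" "\<pi> i" by (rule reversible_kernel_T[OF ii])
  have "(\<integral>x. lim_op i g x \<partial>\<pi> i) = pee * (\<integral>x. jump_op i g x \<partial>\<pi> i) + (1 - pee) * (\<integral>x. kop (T i) g x \<partial>\<pi> i)"
    unfolding lim_op_def using integrable_pi[OF ii jump_op_bfun[OF i g]] integrable_pi[OF ii r.kop_bfun[OF g]] by simp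
  also have "\<dots> = (\<integral>x. g x \<partial>\<pi> i)" unfolding jump_op_stationary[OF i g] r.stationary[OF g] by (simp add: algebra_simps)
  finally show ?thesis .
qed

definition part :: "nat \<Rightarrow> nat \<Rightarrow> ('a \<Rightarrow> real) \<Rightarrow> real" where
  "part i l g = (\<integral>x. indicator (D l) x * g x \<partial>\<pi> i)"

lemma part_bfun: "g \<in> bfun M \<Longrightarrow> (\<lambda>x. indicator (D l) x * g x) \<in> bfun M"
  by (intro bfun_mult bfun_indicator D_sets)

lemma part_nonneg: "(\<And>x. x \<in> space M \<Longrightarrow> 0 \<le> g x) \<Longrightarrow> 0 \<le> part i l g"
  unfolding part_def by (intro integral_nonneg_AE AE_I2) auto

lemma part_mono:
  assumes "i \<le> K" "u \<in> bfun M" "v \<in> bfun M" "\<And>x. x \<in> D l \<Longrightarrow> u x \<le> v x"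
  shows "part i l u \<le> part i l v"
  unfolding part_def using assms by (intro integral_mono integrable_pi part_bfun) (auto simp: indicator_def)

lemma part_cmult: "part i l (\<lambda>x. c * g x) = c * part i l g"
proof -
  have "part i l (\<lambda>x. c * g x) = (\<integral>x. c * (indicator (D l) x * g x) \<partial>\<pi> i)" unfolding part_def by (simp add: mult_ac)
  then show ?thesis unfolding part_def by simp
qed

lemma part_one: "i \<le> K \<Longrightarrow> part i l (\<lambda>_. 1) = measure (\<pi> i) (D l)"
  using sets.sets_into_space[OF D_sets[of l]] prob_space.finite_measure[OF prob_pi[of i]]
  by (simp add: part_def Int_absorb2)

lemma integral_eq_sum_part:
  assumes i: "i \<le> K" and g: "g \<in> bfun M"
  shows "(\<integral>x. g x \<partial>\<pi> i) = (\<Sum>l\<le>K. part i l g)"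
proof -
  have "(\<Sum>l\<le>K. indicator (D l) x * g x) = g x" if x: "x \<in> space M" for x
  proof -
    have "(\<Sum>l\<le>K. indicator (D l) x * g x) = (\<Sum>l\<le>K. if l = I x then g x else 0)"
      using I_iff[OF x] by (intro sum.cong) (auto simp: indicator_def)
    then show ?thesis using I_le[OF x] by simp
  qed
  then have "(\<integral>x. g x \<partial>\<pi> i) = (\<integral>x. (\<Sum>l\<le>K. indicator (D l) x * g x) \<partial>\<pi> i)"
    by (intro Bochner_Integration.integral_cong) auto
  also have "\<dots> = (\<Sum>l\<le>K. part i l g)" unfolding part_def
    by (intro Bochner_Integration.integral_sum integrable_pi[OF i] part_bfun g)
  finally show ?thesis .
qed

lemma jump_op_lower:
  assumes i: "i < K"
  shows "\<exists>c>0. \<forall>g\<in>bfun M. (\<forall>x\<in>space M. 0 \<le> g x) \<longrightarrow> (\<forall>x\<in>space M. c * part i (I x) g \<le> jump_op i g x)"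
proof -
  have Si: "Suc i \<le> K" and ii: "i \<le> K" using i by auto
  interpret a: metropolis M "f i" "q i" by (rule metropolis[OF ii])
  interpret b: metropolis M "f (Suc i)" "q (Suc i)" by (rule metropolis[OF Si])
  obtain W where W: "W > 0" "\<And>x. w i x \<le> W" using w_bounded[OF i] by blast
  define k where "k = (\<integral>x. f (Suc i) x \<partial>M) / (\<integral>x. f i x \<partial>M)"
  have k: "k > 0" unfolding k_def using a.f_norm b.f_norm by simp
  show ?thesis
  proof (intro exI[of _ "1 / (W * k)"] conjI ballI impI)
    show "0 < 1 / (W * k)" using W k by simp
    fix g x assume g: "g \<in> bfun M" and pos: "\<forall>x\<in>space M. 0 \<le> g x" and x: "x \<in> space M"
    have pg: "(\<lambda>y. indicator (D (I x)) y * g y) \<in> bfun M" by (rule part_bfun[OF g])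
    have wb: "w i \<in> bfun M" using W(2) w_pos by (intro bfunI[where C=W]) (auto simp: abs_of_pos)
    have "1 / (W * k) * part i (I x) g = (1 / W) * (\<integral>y. w i y * (indicator (D (I x)) y * g y) \<partial>\<pi> (Suc i))"
      unfolding part_def integral_pi_w[OF i bfun_measurable[OF pg]] k_def[symmetric] using k by simp
    also have "\<dots> = (\<integral>y. (1 / W) * (w i y * (indicator (D (I x)) y * g y)) \<partial>\<pi> (Suc i))" by simp
    also have "\<dots> \<le> (\<integral>y. jump_fun i g x y \<partial>\<pi> (Suc i))"
    proof (rule integral_mono)
      show "integrable (\<pi> (Suc i)) (\<lambda>y. (1 / W) * (w i y * (indicator (D (I x)) y * g y)))"
        by (intro integrable_pi[OF Si] bfun_mult[OF bfun_const] bfun_mult wb bfun_indicator D_sets g)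
      show "integrable (\<pi> (Suc i)) (\<lambda>y. jump_fun i g x y)" by (intro integrable_pi[OF Si] jump_fun_bfun g x)
      fix y assume "y \<in> space (\<pi> (Suc i))"
      then have y: "y \<in> space M" by simp
      show "(1 / W) * (w i y * (indicator (D (I x)) y * g y)) \<le> jump_fun i g x y"
      proof (cases "I y = I x")
        case True
        then have yD: "y \<in> D (I x)" using I_iff[OF y I_le[OF x]] by simp
        have "w i y / W \<le> acc i x y" unfolding acc_w using W(1) W(2)[of y] W(2)[of x] w_pos[of i x] w_pos[of i y]
          by (auto intro: divide_left_mono)
        then have "(w i y / W) * g y \<le> acc i x y * g y" using pos y by (intro mult_right_mono) auto
        moreover have "0 \<le> (1 - acc i x y) * g x" using acc_bounds[of i x y] pos x by simp
        ultimately show ?thesis using True yD by (simp add: jump_fun_def)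
      next
        case False
        then have "y \<notin> D (I x)" using I_iff[OF y I_le[OF x]] by simp
        then show ?thesis using False by (simp add: jump_fun_def)
      qed
    qed
    also have "\<dots> \<le> jump_op i g x"
    proof -
      have "0 \<le> (\<integral>y. jump_fun i g x y \<partial>\<pi> (Suc i))"
        using pos x acc_bounds by (intro integral_nonneg_AE AE_I2) (auto simp: jump_fun_def)
      then have "(\<integral>y. jump_fun i g x y \<partial>\<pi> (Suc i)) * mass i (I x) \<le> (\<integral>y. jump_fun i g x y \<partial>\<pi> (Suc i)) * 1"
        using mass_le[OF i] by (intro mult_left_mono) auto
      then show ?thesis unfolding jump_op_def using mass_pos[OF i I_le[OF x]] by (simp add: le_divide_eq)
    qed
    finally show "1 / (W * k) * part i (I x) g \<le> jump_op i g x" .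
  qed
qed

lemma adjacent_transition:
  assumes i: "i < K" and l: "l \<le> K" "l' \<le> K" and adj: "l' = Suc l \<or> l = Suc l'"
  shows "0 < part i l (kop (T i) (indicator (D l')))"
proof -
  have ii: "i \<le> K" using i by simp
  interpret a: metropolis M "f i" "q i" by (rule metropolis[OF ii])
  interpret t: markov_kernel M "T i" by unfold_locales (rule kernel_T[OF ii])
  obtain A C where AC: "A \<in> sets M" "C \<in> sets M" "A \<subseteq> D l" "C \<subseteq> D l'" "kernel_set_trans M (T i) A C > 0"
    using adj
  proof
    assume "l' = Suc l"
    then show ?thesis using connect[rule_format, OF i l(1)] l that by auto
  next
    assume "l = Suc l'"
    then show ?thesis using connect[rule_format, OF i l(1)] l that by auto
  qed
  define u where "u = (\<lambda>x. indicator (D l) x * kop (T i) (indicator (D l')) x)"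
  have u: "u \<in> bfun M" unfolding u_def by (intro part_bfun t.kop_bfun bfun_indicator D_sets)
  have upos: "0 \<le> u x" if "x \<in> space M" for x unfolding u_def using that by (intro mult_nonneg_nonneg t.kop_nonneg) auto
  have p: "part i l (kop (T i) (indicator (D l'))) = (\<integral>x. f i x * u x \<partial>M) / (\<integral>x. f i x \<partial>M)"
    unfolding part_def u_def[symmetric] using a.integral_target[OF bfun_measurable[OF u]] unfolding target_eq[OF ii] .
  have fu0: "0 \<le> f i x * u x" if "x \<in> space M" for x using upos[OF that] less_imp_le[OF f_pos[of i x]] by simp
  have fu: "0 \<le> (\<integral>x. f i x * u x \<partial>M)" using fu0 by (intro integral_nonneg_AE AE_I2) auto
  have "(\<integral>x. f i x * u x \<partial>M) \<noteq> 0"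
  proof
    assume "(\<integral>x. f i x * u x \<partial>M) = 0"
    then have "AE x in M. f i x * u x = 0"
      using fu0 a.integrable_f_bfun[OF u]
      by (subst (asm) integral_nonneg_eq_0_iff_AE) (auto intro!: AE_I2)
    then have "AE x in M. emeasure (T i x) C * indicator A x = 0" using AE_space
    proof eventually_elim
      fix x assume z: "f i x * u x = 0" and x: "x \<in> space M"
      show "emeasure (T i x) C * indicator A x = 0"
      proof (cases "x \<in> A")
        case True
        then have "kop (T i) (indicator (D l')) x = 0" using z f_pos[of i x] AC(3) by (auto simp: u_def)
        then have "measure (T i x) (D l') = 0" using t.kop_indicator[OF x D_sets] by simp
        then have "emeasure (T i x) (D l') = 0"
          using prob_space.finite_measure[OF t.prob_P[OF x]] by (simp add: finite_measure.emeasure_eq_measure)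
        moreover have "emeasure (T i x) C \<le> emeasure (T i x) (D l')" using AC(4) t.sets_P[OF x] by (intro emeasure_mono) auto
        ultimately show ?thesis by simp
      qed simp
    qed
    then have "kernel_set_trans M (T i) A C = (\<integral>\<^sup>+x. 0 \<partial>M)" unfolding kernel_set_trans_def by (rule nn_integral_cong_AE)
    then show False using AC(5) by simp
  qed
  then show ?thesis unfolding p using fu a.f_norm by simp
qed

definition reach :: "nat \<Rightarrow> nat \<Rightarrow> nat \<Rightarrow> nat \<Rightarrow> real \<Rightarrow> bool" where
  "reach i n j l c \<longleftrightarrow> (\<forall>g\<in>bfun M. (\<forall>x\<in>space M. 0 \<le> g x) \<longrightarrow> (\<forall>x\<in>D j. c * part i l g \<le> (lim_op i ^^ n) g x))"

lemma D_space: "x \<in> D j \<Longrightarrow> x \<in> space M" by (simp add: ee_D_def)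

lemma jump_op_nonneg:
  assumes i: "i < K" and pos: "\<forall>x\<in>space M. 0 \<le> g x" and x: "x \<in> space M"
  shows "0 \<le> jump_op i g x"
  unfolding jump_op_def using pos x acc_bounds less_imp_le[OF mass_pos[OF i I_le[OF x]]]
  by (intro divide_nonneg_nonneg integral_nonneg_AE AE_I2) (auto simp: jump_fun_def)

lemma lim_op_ge:
  assumes i: "i < K" and pos: "\<forall>x\<in>space M. 0 \<le> g x" and x: "x \<in> space M"
  shows "pee * jump_op i g x \<le> lim_op i g x" "(1 - pee) * kop (T i) g x \<le> lim_op i g x" "0 \<le> lim_op i g x"
proof -
  interpret t: markov_kernel M "T i" using i by unfold_locales (auto intro: kernel_T)
  have "0 \<le> pee * jump_op i g x" "0 \<le> (1 - pee) * kop (T i) g x"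
    using jump_op_nonneg[OF i pos x] t.kop_nonneg[OF x, of g] pos pee by auto
  then show "pee * jump_op i g x \<le> lim_op i g x" "(1 - pee) * kop (T i) g x \<le> lim_op i g x" "0 \<le> lim_op i g x"
    unfolding lim_op_def by auto
qed

lemma minorisation:
  assumes i: "i < K"
  shows "\<exists>c>0. \<forall>g\<in>bfun M. (\<forall>x\<in>space M. 0 \<le> g x) \<longrightarrow>
    (\<forall>x\<in>space M. c * (\<integral>y. g y \<partial>\<pi> i) \<le> (lim_op i ^^ (2 * K + 1)) g x)"
proof -
  have ii: "i \<le> K" using i by simp
  interpret t: markov_kernel M "T i" by unfold_locales (rule kernel_T[OF ii])
  let ?S = "lim_op i"
  obtain c0 where c0: "c0 > 0" and low: "\<And>g x. g \<in> bfun M \<Longrightarrow> \<forall>x\<in>space M. 0 \<le> g x \<Longrightarrow> x \<in> space M \<Longrightarrow> c0 * part i (I x) g \<le> jump_op i g x"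
    using jump_op_lower[OF i] by blast
  have one: "pee * c0 * part i l g \<le> ?S g x" if g: "g \<in> bfun M" and pos: "\<forall>x\<in>space M. 0 \<le> g x" and x: "x \<in> D l" and l: "l \<le> K" for g x l
  proof -
    have xs: "x \<in> space M" by (rule D_space[OF x])
    have "I x = l" using I_iff[OF xs l] x by simp
    then have "pee * (c0 * part i l g) \<le> pee * jump_op i g x" using low[OF g pos xs] pee by (intro mult_left_mono) auto
    then show ?thesis using lim_op_ge(1)[OF i pos xs] by simp
  qed
  have base: "\<exists>c>0. reach i 1 j j c" if "j \<le> K" for j
    unfolding reach_def using one that c0 pee by (intro exI[of _ "pee * c0"]) auto
  have stay: "\<exists>c>0. reach i (Suc n) j l c" if r: "\<exists>c>0. reach i n j l c" and l: "l \<le> K" for n j l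
  proof -
    obtain c where c: "c > 0" "reach i n j l c" using r by blast
    have "reach i (Suc n) j l (c * (pee * c0 * measure (\<pi> i) (D l)))" unfolding reach_def
    proof (intro ballI impI)
      fix g x assume g: "g \<in> bfun M" and pos: "\<forall>x\<in>space M. 0 \<le> g x" and x: "x \<in> D j"
      have "pee * c0 * part i l g * measure (\<pi> i) (D l) = part i l (\<lambda>x. (pee * c0 * part i l g) * 1)"
        unfolding part_cmult part_one[OF ii] ..
      also have "\<dots> \<le> part i l (?S g)" using one[OF g pos _ l] by (intro part_mono ii lim_op_bfun i g) auto
      finally have "c * (pee * c0 * part i l g * measure (\<pi> i) (D l)) \<le> c * part i l (?S g)" using c by (intro mult_left_mono) auto
      also have "\<dots> \<le> (?S ^^ n) (?S g) x"
        using c(2) x lim_op_ge(3)[OF i pos] lim_op_bfun[OF i g] unfolding reach_def by blast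
      finally show "c * (pee * c0 * measure (\<pi> i) (D l)) * part i l g \<le> (?S ^^ Suc n) g x"
        by (simp add: funpow_swap1 mult_ac)
    qed
    moreover have "0 < c * (pee * c0 * measure (\<pi> i) (D l))" using c c0 pee pos_mass ii l by simp
    ultimately show ?thesis by blast
  qed
  have move: "\<exists>c>0. reach i (Suc (Suc n)) j l' c"
    if r: "\<exists>c>0. reach i n j l c" and l: "l \<le> K" "l' \<le> K" and adj: "l' = Suc l \<or> l = Suc l'" for n j l l'
  proof -
    obtain c where c: "c > 0" "reach i n j l c" using r by blast
    define a where "a = part i l (kop (T i) (indicator (D l')))"
    have a: "a > 0" unfolding a_def by (rule adjacent_transition[OF i l adj])
    have "reach i (Suc (Suc n)) j l' (c * ((1 - pee) * (pee * c0) * a))" unfolding reach_def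
    proof (intro ballI impI)
      fix g x assume g: "g \<in> bfun M" and pos: "\<forall>x\<in>space M. 0 \<le> g x" and x: "x \<in> D j"
      have Sg: "?S g \<in> bfun M" and Spos: "\<forall>x\<in>space M. 0 \<le> ?S g x" using lim_op_bfun[OF i g] lim_op_ge(3)[OF i pos] by auto
      have SSg: "?S (?S g) \<in> bfun M" and SSpos: "\<forall>x\<in>space M. 0 \<le> ?S (?S g) x" using lim_op_bfun[OF i Sg] lim_op_ge(3)[OF i Spos] by auto
      let ?b = "pee * c0 * part i l' g"
      have bi: "(\<lambda>y. ?b * indicator (D l') y) \<in> bfun M" by (intro bfun_mult bfun_const bfun_indicator D_sets)
      have "(1 - pee) * ?b * a = part i l (\<lambda>x. ((1 - pee) * ?b) * kop (T i) (indicator (D l')) x)"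
        unfolding part_cmult a_def ..
      also have "\<dots> \<le> part i l (?S (?S g))"
      proof (intro part_mono ii SSg bfun_mult[OF bfun_const] t.kop_bfun bfun_indicator D_sets)
        fix x assume "x \<in> D l"
        then have xs: "x \<in> space M" by (rule D_space)
        have "?b * indicator (D l') y \<le> ?S g y" if "y \<in> space M" for y
          using one[OF g pos _ l(2), of y] Spos that by (auto simp: indicator_def)
        then have "kop (T i) (\<lambda>y. ?b * indicator (D l') y) x \<le> kop (T i) (?S g) x"
          by (intro t.kop_mono[OF xs bi Sg])
        then have "(1 - pee) * (?b * kop (T i) (indicator (D l')) x) \<le> (1 - pee) * kop (T i) (?S g) x"
          unfolding t.kop_cmult using pee by (intro mult_left_mono) auto
        also have "\<dots> \<le> ?S (?S g) x" by (rule lim_op_ge(2)[OF i Spos xs])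
        finally show "(1 - pee) * ?b * kop (T i) (indicator (D l')) x \<le> ?S (?S g) x" by (simp add: mult.assoc)
      qed
      finally have "c * ((1 - pee) * ?b * a) \<le> c * part i l (?S (?S g))" using c by (intro mult_left_mono) auto
      also have "\<dots> \<le> (?S ^^ n) (?S (?S g)) x" using c(2) x SSpos SSg unfolding reach_def by blast
      finally show "c * ((1 - pee) * (pee * c0) * a) * part i l' g \<le> (?S ^^ Suc (Suc n)) g x"
        by (simp add: funpow_swap1 mult_ac)
    qed
    moreover have "0 < c * ((1 - pee) * (pee * c0) * a)" using c c0 pee a by simp
    ultimately show ?thesis by blast
  qed
  have up: "\<exists>c>0. reach i (2 * d + 1) j (j + d) c" if "j + d \<le> K" for j d
    using that
  proof (induction d)
    case (Suc d) then show ?case using move[of "2 * d + 1" j "j + d" "j + Suc d"] by simp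
  qed (use base in simp)
  have down: "\<exists>c>0. reach i (2 * d + 1) j (j - d) c" if "j \<le> K" "d \<le> j" for j d
    using that
  proof (induction d)
    case (Suc d)
    then have "j - d = Suc (j - Suc d)" by simp
    then show ?case using Suc move[of "2 * d + 1" j "j - d" "j - Suc d"] by simp
  qed (use base in simp)
  have stays: "\<exists>c>0. reach i (n + k) j l c" if "\<exists>c>0. reach i n j l c" "l \<le> K" for n k j l
  proof (induction k)
    case (Suc k) then show ?case using stay[of "n + k" j l] that by simp
  qed (use that in simp)
  have all: "\<exists>c>0. reach i (2 * K + 1) j l c" if "j \<le> K" "l \<le> K" for j l
  proof -
    define d where "d = (if j \<le> l then l - j else j - l)"
    have "\<exists>c>0. reach i (2 * d + 1) j l c"
      using up[of j d] down[of j d] that by (auto simp: d_def split: if_splits)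
    then have "\<exists>c>0. reach i ((2 * d + 1) + 2 * (K - d)) j l c" by (rule stays[OF _ that(2)])
    moreover have "(2 * d + 1) + 2 * (K - d) = 2 * K + 1" using that by (auto simp: d_def)
    ultimately show ?thesis by simp
  qed
  have "\<exists>c>0. \<forall>p\<in>{..K} \<times> {..K}. (\<lambda>p c. reach i (2 * K + 1) (fst p) (snd p) c) p c"
  proof (rule finite_uniform_pos)
    fix p c c' assume r: "reach i (2 * K + 1) (fst p) (snd p) c" and c': "0 < c'" "c' \<le> c"
    show "reach i (2 * K + 1) (fst p) (snd p) c'" unfolding reach_def
    proof (intro ballI impI)
      fix g x assume g: "g \<in> bfun M" and pos: "\<forall>x\<in>space M. 0 \<le> g x" and x: "x \<in> D (fst p)"
      have "c' * part i (snd p) g \<le> c * part i (snd p) g" using c' pos by (intro mult_right_mono part_nonneg) auto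
      also have "\<dots> \<le> (?S ^^ (2 * K + 1)) g x" using r g pos x unfolding reach_def by blast
      finally show "c' * part i (snd p) g \<le> (?S ^^ (2 * K + 1)) g x" .
    qed
  qed (use all in auto)
  then obtain c where c: "c > 0" and R: "\<And>j l. j \<le> K \<Longrightarrow> l \<le> K \<Longrightarrow> reach i (2 * K + 1) j l c" by auto
  show ?thesis
  proof (intro exI[of _ "c / real (Suc K)"] conjI ballI impI)
    show "0 < c / real (Suc K)" using c by simp
    fix g x assume g: "g \<in> bfun M" and pos: "\<forall>x\<in>space M. 0 \<le> g x" and x: "x \<in> space M"
    let ?v = "(?S ^^ (2 * K + 1)) g x"
    have xD: "x \<in> D (I x)" using I_iff[OF x I_le[OF x]] by simp
    have "(\<Sum>l\<le>K. c * part i l g) \<le> (\<Sum>l\<le>K. ?v)"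
      using R[OF I_le[OF x]] g pos xD unfolding reach_def by (intro sum_mono) auto
    then have "c * (\<integral>y. g y \<partial>\<pi> i) \<le> real (Suc K) * ?v"
      unfolding integral_eq_sum_part[OF ii g] by (simp add: sum_distrib_left)
    then show "c / real (Suc K) * (\<integral>y. g y \<partial>\<pi> i) \<le> ?v" by (simp add: field_simps del: funpow.simps)
  qed
qed

lemma lim_op_uniform:
  assumes i: "i < K" and g: "g \<in> bfun M" and e: "e > 0"
  shows "\<exists>k. \<forall>x\<in>space M. \<bar>(lim_op i ^^ k) g x - (\<integral>y. g y \<partial>\<pi> i)\<bar> \<le> e"
proof -
  obtain c where c: "c > 0" and m: "\<forall>g\<in>bfun M. (\<forall>x\<in>space M. 0 \<le> g x) \<longrightarrow>
    (\<forall>x\<in>space M. c * (\<integral>y. g y \<partial>\<pi> i) \<le> (lim_op i ^^ (2 * K + 1)) g x)" using minorisation[OF i] by blast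
  show ?thesis
  proof (rule doeblin_uniform_convergence[where r="2 * K + 1" and M=M and c=c])
    show "prob_space (\<pi> i)" using i by (intro prob_pi) simp
    show "c * (\<integral>y. g y \<partial>\<pi> i) \<le> (lim_op i ^^ (2 * K + 1)) g x"
      if "g \<in> bfun M" "\<And>y. y \<in> space M \<Longrightarrow> 0 \<le> g y" "x \<in> space M" for g x
      using m that by blast
  qed (simp_all add: lim_op_bfun lim_op_affine lim_op_stationary i g e c, rule lim_op_cong[OF i])
qed

end


context ee_sampler
begin

section \<open>Ring averages\<close>

definition avg :: "nat \<Rightarrow> nat \<Rightarrow> (nat \<Rightarrow> nat \<Rightarrow> 'a) \<Rightarrow> ('a \<Rightarrow> real) \<Rightarrow> real" where
  "avg i n \<omega> u = (\<Sum>m\<le>n + N. u (\<omega> (Suc i) (B + m))) / real (Suc (n + N))"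

definition dev :: "nat \<Rightarrow> nat \<Rightarrow> (nat \<Rightarrow> nat \<Rightarrow> 'a) \<Rightarrow> ('a \<Rightarrow> real) \<Rightarrow> real" where
  "dev i n \<omega> u = \<bar>avg i n \<omega> u - (\<integral>x. u x \<partial>\<pi> (Suc i))\<bar>"

lemma avg_add: "avg i n \<omega> (\<lambda>x. u x + v x) = avg i n \<omega> u + avg i n \<omega> v"
  by (simp add: avg_def sum.distrib add_divide_distrib)

lemma avg_diff: "avg i n \<omega> (\<lambda>x. u x - v x) = avg i n \<omega> u - avg i n \<omega> v"
  by (simp add: avg_def sum_subtractf diff_divide_distrib)

lemma avg_cmult: "avg i n \<omega> (\<lambda>x. c * u x) = c * avg i n \<omega> u"
  by (simp add: avg_def sum_distrib_left)

lemma avg_mono: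
  assumes "\<omega> \<in> space \<Omega>" "\<And>x. x \<in> space M \<Longrightarrow> u x \<le> v x"
  shows "avg i n \<omega> u \<le> avg i n \<omega> v"
  unfolding avg_def using assms coord_space by (intro divide_right_mono sum_mono) auto

lemma avg_abs_le:
  assumes "\<omega> \<in> space \<Omega>" "\<And>x. x \<in> space M \<Longrightarrow> \<bar>u x\<bar> \<le> v x"
  shows "\<bar>avg i n \<omega> u\<bar> \<le> avg i n \<omega> v"
proof -
  have "\<bar>avg i n \<omega> u\<bar> \<le> avg i n \<omega> (\<lambda>x. \<bar>u x\<bar>)" unfolding avg_def by (simp add: divide_right_mono sum_abs)
  also have "\<dots> \<le> avg i n \<omega> v" by (rule avg_mono[OF assms])
  finally show ?thesis .
qed

lemma dev_bfun: assumes "u \<in> bfun M" shows "(\<lambda>\<omega>. dev i n \<omega> u) \<in> bfun \<Omega>"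
proof -
  have "(\<lambda>\<omega>. \<bar>(1 / real (Suc (n + N))) * (\<Sum>m\<le>n + N. u (\<omega> (Suc i) (B + m))) - (\<integral>x. u x \<partial>\<pi> (Suc i))\<bar>) \<in> bfun \<Omega>"
    by (intro bfun_abs bfun_diff bfun_mult bfun_const bfun_sum coord_bfun assms)
  then show ?thesis by (simp add: dev_def avg_def)
qed

lemma dev_tendsto:
  assumes i: "i < K" and l: "lln (Suc i)" and u: "u \<in> bfun M"
  shows "(\<lambda>n. \<integral>\<omega>. dev i n \<omega> u \<partial>law (start i + n)) \<longlonglongrightarrow> 0"
proof -
  have "(\<lambda>n. \<integral>\<omega>. \<bar>(\<Sum>m\<le>n. u (\<omega> (Suc i) (B + m))) / real (Suc n) - (\<integral>x. u x \<partial>\<pi> (Suc i))\<bar> \<partial>law (start (Suc i) + (B + n))) \<longlonglongrightarrow> 0"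
    using l u unfolding lln_def by blast
  from LIMSEQ_ignore_initial_segment[OF this, of N]
  have "(\<lambda>n. \<integral>\<omega>. dev i n \<omega> u \<partial>law (start (Suc i) + (B + (n + N)))) \<longlonglongrightarrow> 0"
    unfolding dev_def avg_def .
  moreover have "start (Suc i) + (B + (n + N)) = start i + n" for n
  proof -
    have "K - i = Suc (K - Suc i)" using i by simp
    then show ?thesis unfolding ee_start_def by simp
  qed
  ultimately show ?thesis by simp
qed

lemma dev_add_le:
  assumes i: "Suc i \<le> K" and u: "u \<in> bfun M" and v: "v \<in> bfun M"
  shows "dev i n \<omega> (\<lambda>x. u x + v x) \<le> dev i n \<omega> u + dev i n \<omega> v"
proof -
  have "(\<integral>x. u x + v x \<partial>\<pi> (Suc i)) = (\<integral>x. u x \<partial>\<pi> (Suc i)) + (\<integral>x. v x \<partial>\<pi> (Suc i))"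
    using integrable_pi[OF i u] integrable_pi[OF i v] by simp
  then show ?thesis unfolding dev_def avg_add by linarith
qed

lemma dev_cmult: "dev i n \<omega> (\<lambda>x. c * u x) = \<bar>c\<bar> * dev i n \<omega> u"
  unfolding dev_def avg_cmult by (simp add: abs_mult[symmetric] right_diff_distrib)

lemma dev_bracket:
  assumes i: "Suc i \<le> K" and \<omega>: "\<omega> \<in> space \<Omega>" and u: "u \<in> bfun M" and v: "v \<in> bfun M" and b: "b \<in> bfun M"
    and le: "\<And>x. x \<in> space M \<Longrightarrow> \<bar>u x - v x\<bar> \<le> b x"
  shows "dev i n \<omega> u \<le> dev i n \<omega> v + dev i n \<omega> b + 2 * (\<integral>x. b x \<partial>\<pi> (Suc i))"
proof -
  have 1: "\<bar>avg i n \<omega> (\<lambda>x. u x - v x)\<bar> \<le> avg i n \<omega> b" by (rule avg_abs_le[OF \<omega> le])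
  have iu: "integrable (\<pi> (Suc i)) u" "integrable (\<pi> (Suc i)) v" "integrable (\<pi> (Suc i)) b"
    using integrable_pi[OF i] u v b by auto
  have "\<bar>\<integral>x. u x - v x \<partial>\<pi> (Suc i)\<bar> \<le> (\<integral>x. \<bar>u x - v x\<bar> \<partial>\<pi> (Suc i))" by simp
  also have "\<dots> \<le> (\<integral>x. b x \<partial>\<pi> (Suc i))" using iu le by (intro integral_mono) auto
  finally have 2: "\<bar>(\<integral>x. u x \<partial>\<pi> (Suc i)) - (\<integral>x. v x \<partial>\<pi> (Suc i))\<bar> \<le> (\<integral>x. b x \<partial>\<pi> (Suc i))" using iu by simp
  show ?thesis using 1 2 unfolding dev_def avg_diff by linarith
qed

definition same :: "'a \<Rightarrow> 'a \<Rightarrow> real" where "same x y = (if I y = I x then 1 else 0)"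

lemma same_eq: assumes x: "x \<in> space M" and y: "y \<in> space M" shows "same x y = indicator (D (I x)) y"
  using I_iff[OF y I_le[OF x]] by (auto simp: same_def indicator_def)

lemma same_bfun: "same x \<in> bfun M"
  unfolding same_def by (rule bfunI[where C=1]) auto

lemma ratio_error:
  fixes J' c' J p G :: real
  assumes p: "p > 0" and c: "c' > 0" and J: "\<bar>J'\<bar> \<le> G * c'"
  shows "\<bar>J' / c' - J / p\<bar> \<le> (\<bar>J' - J\<bar> + G * \<bar>c' - p\<bar>) / p"
proof -
  have "J' / c' - J / p = ((J' - J) + (J' / c') * (p - c')) / p" using p c by (simp add: field_simps)
  then have "\<bar>J' / c' - J / p\<bar> = \<bar>(J' - J) + (J' / c') * (p - c')\<bar> / p" using p by simp
  also have "\<dots> \<le> (\<bar>J' - J\<bar> + G * \<bar>c' - p\<bar>) / p"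
  proof (rule divide_right_mono)
    have "\<bar>J' / c'\<bar> \<le> G" using J c by (simp add: divide_le_eq)
    then have "\<bar>J' / c'\<bar> * \<bar>p - c'\<bar> \<le> G * \<bar>p - c'\<bar>" by (intro mult_right_mono) auto
    then have "\<bar>(J' / c') * (p - c')\<bar> \<le> G * \<bar>c' - p\<bar>" by (simp add: abs_mult abs_minus_commute)
    then show "\<bar>(J' - J) + (J' / c') * (p - c')\<bar> \<le> \<bar>J' - J\<bar> + G * \<bar>c' - p\<bar>" by linarith
  qed (use p in simp)
  finally show ?thesis .
qed

lemma sum_ring_shift:
  fixes F :: "nat \<Rightarrow> real"
  shows "(\<Sum>m\<in>ring i n \<omega>. F m) = (\<Sum>m\<le>n + N. if I (\<omega> (Suc i) (B + m)) = I (\<omega> i n) then F (B + m) else 0)"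
proof -
  have "(\<Sum>m\<in>ring i n \<omega>. F m) = (\<Sum>m=B..n+B+N. if m \<in> ring i n \<omega> then F m else 0)" by (rule sum_ring_eq)
  also have "\<dots> = (\<Sum>m\<le>n + N. if B + m \<in> ring i n \<omega> then F (B + m) else 0)"
    by (rule sum.reindex_bij_witness[where i="\<lambda>m. B + m" and j="\<lambda>m. m - B"]) auto
  also have "\<dots> = (\<Sum>m\<le>n + N. if I (\<omega> (Suc i) (B + m)) = I (\<omega> i n) then F (B + m) else 0)"
    by (intro sum.cong) (auto simp: ee_ring_def)
  finally show ?thesis .
qed

lemma next_error_le:
  fixes n :: nat
  assumes i: "i < K" and \<omega>: "\<omega> \<in> space \<Omega>" and g: "g \<in> bfun M" and G: "\<And>x. x \<in> space M \<Longrightarrow> \<bar>g x\<bar> \<le> G"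
  defines "x \<equiv> \<omega> i n"
  shows "\<bar>(\<integral>z. g z \<partial>nxt i n \<omega>) - lim_op i g x\<bar> \<le> (dev i n \<omega> (jump_fun i g x) + 2 * G * dev i n \<omega> (same x)) / mass i (I x)"
proof -
  have ii: "i \<le> K" using i by simp
  interpret t: markov_kernel M "T i" by unfold_locales (rule kernel_T[OF ii])
  have x: "x \<in> space M" unfolding x_def by (rule coord_space[OF \<omega>])
  have G0: "0 \<le> G" using G[OF x] by linarith
  have p: "mass i (I x) > 0" by (rule mass_pos[OF i I_le[OF x]])
  let ?J = "\<integral>y. jump_fun i g x y \<partial>\<pi> (Suc i)" let ?p = "mass i (I x)"
  let ?J' = "avg i n \<omega> (jump_fun i g x)" let ?c' = "avg i n \<omega> (same x)"
  have ps: "(\<integral>y. same x y \<partial>\<pi> (Suc i)) = ?p" unfolding same_def by (rule integral_same_energy[OF i x])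
  have S1: "(\<Sum>m\<in>ring i n \<omega>. acc i x (\<omega> (Suc i) m) * g (\<omega> (Suc i) m) + (1 - acc i x (\<omega> (Suc i) m)) * g x)
      = real (Suc (n + N)) * ?J'"
    unfolding sum_ring_shift avg_def jump_fun_def x_def by simp
  have S2: "real (card (ring i n \<omega>)) = real (Suc (n + N)) * ?c'"
    using sum_ring_shift[of "\<lambda>_. 1" i n \<omega>] unfolding avg_def same_def x_def by simp
  have JG: "\<bar>?J'\<bar> \<le> G * ?c'"
    unfolding avg_cmult[symmetric] using jump_fun_bound[OF G x] by (intro avg_abs_le[OF \<omega>]) (auto simp: same_def)
  have Tg: "\<bar>kop (T i) g x\<bar> \<le> G" by (rule t.kop_abs_le_const[OF x G])
  have jg: "\<bar>?J / ?p\<bar> \<le> G" using jump_op_abs_le[OF i G g x] unfolding jump_op_def .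
  have D: "dev i n \<omega> (jump_fun i g x) = \<bar>?J' - ?J\<bar>" "dev i n \<omega> (same x) = \<bar>?c' - ?p\<bar>"
    unfolding dev_def ps by auto
  show ?thesis
  proof (cases "ring i n \<omega> = {}")
    case True
    then have c0: "?c' = 0" using S2 by simp
    have "(\<integral>z. g z \<partial>nxt i n \<omega>) - lim_op i g x = pee * (kop (T i) g x - ?J / ?p)"
      using True nxt_props(2)[OF \<omega> ii g, of n] by (simp add: x_def[symmetric] lim_op_def jump_op_def algebra_simps)
    then have "\<bar>(\<integral>z. g z \<partial>nxt i n \<omega>) - lim_op i g x\<bar> = pee * \<bar>kop (T i) g x - ?J / ?p\<bar>" using pee by (simp add: abs_mult)
    also have "\<dots> \<le> 1 * (2 * G)" using pee Tg jg by (intro mult_mono) linarith+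
    also have "\<dots> = (2 * G * dev i n \<omega> (same x)) / ?p" unfolding D c0 using p by simp
    also have "\<dots> \<le> (dev i n \<omega> (jump_fun i g x) + 2 * G * dev i n \<omega> (same x)) / ?p"
      using p by (intro divide_right_mono) (auto simp: dev_def)
    finally show ?thesis .
  next
    case False
    then have "real (card (ring i n \<omega>)) > 0" using ring_finite[of i n \<omega>] by (simp add: card_gt_0_iff)
    then have c': "?c' > 0" unfolding S2 by (simp add: zero_less_mult_iff)
    have "(\<integral>z. g z \<partial>nxt i n \<omega>) = pee * (?J' / ?c') + (1 - pee) * kop (T i) g x"
      using False i nxt_props(2)[OF \<omega> ii g, of n] unfolding x_def[symmetric] S1 S2 by (simp del: of_nat_Suc)
    then have "(\<integral>z. g z \<partial>nxt i n \<omega>) - lim_op i g x = pee * (?J' / ?c' - ?J / ?p)"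
      by (simp add: lim_op_def jump_op_def algebra_simps)
    then have "\<bar>(\<integral>z. g z \<partial>nxt i n \<omega>) - lim_op i g x\<bar> = pee * \<bar>?J' / ?c' - ?J / ?p\<bar>" using pee by (simp add: abs_mult)
    also have "\<dots> \<le> 1 * \<bar>?J' / ?c' - ?J / ?p\<bar>" using pee by (intro mult_right_mono) auto
    also have "\<dots> \<le> (\<bar>?J' - ?J\<bar> + G * \<bar>?c' - ?p\<bar>) / ?p" using ratio_error[OF p c' JG] by simp
    also have "\<dots> \<le> (dev i n \<omega> (jump_fun i g x) + 2 * G * dev i n \<omega> (same x)) / ?p"
      unfolding D using p G0 by (intro divide_right_mono add_mono mult_right_mono) auto
    finally show ?thesis .
  qed
qed

definition sacc :: "nat \<Rightarrow> 'a \<Rightarrow> 'a \<Rightarrow> real" where "sacc i x y = same x y * acc i x y"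

lemma sacc_bfun: assumes x: "x \<in> space M" shows "sacc i x \<in> bfun M"
proof (rule bfunI[where C=1])
  note [measurable] = bfun_measurable[OF same_bfun[of x]]
  show "sacc i x \<in> borel_measurable M" unfolding sacc_def acc_w by measurable
  show "\<bar>sacc i x y\<bar> \<le> 1" for y using acc_bounds[of i x y] by (simp add: sacc_def same_def)
qed

lemma dev_jump_fun_le:
  assumes i: "i < K" and g: "g \<in> bfun M" and G: "\<And>x. x \<in> space M \<Longrightarrow> \<bar>g x\<bar> \<le> G" and x: "x \<in> space M"
  shows "dev i n \<omega> (jump_fun i g x) \<le> dev i n \<omega> (\<lambda>y. sacc i x y * g y) + G * dev i n \<omega> (same x) + G * dev i n \<omega> (sacc i x)"
proof -
  have Si: "Suc i \<le> K" using i by simp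
  have e: "jump_fun i g x = (\<lambda>y. (sacc i x y * g y + g x * same x y) + (- g x) * sacc i x y)"
    by (auto simp: jump_fun_def sacc_def same_def algebra_simps)
  have b: "(\<lambda>y. sacc i x y * g y) \<in> bfun M" "(\<lambda>y. g x * same x y) \<in> bfun M" "(\<lambda>y. (- g x) * sacc i x y) \<in> bfun M"
    by (intro bfun_mult bfun_const sacc_bfun[OF x] same_bfun g)+
  have "dev i n \<omega> (jump_fun i g x) \<le> dev i n \<omega> (\<lambda>y. sacc i x y * g y + g x * same x y) + dev i n \<omega> (\<lambda>y. (- g x) * sacc i x y)"
    unfolding e by (intro dev_add_le[OF Si] bfun_add b)
  also have "\<dots> \<le> dev i n \<omega> (\<lambda>y. sacc i x y * g y) + dev i n \<omega> (\<lambda>y. g x * same x y) + dev i n \<omega> (\<lambda>y. (- g x) * sacc i x y)"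
    by (intro add_right_mono dev_add_le[OF Si] b)
  also have "dev i n \<omega> (\<lambda>y. g x * same x y) = \<bar>g x\<bar> * dev i n \<omega> (same x)" by (rule dev_cmult)
  also have "dev i n \<omega> (\<lambda>y. (- g x) * sacc i x y) = \<bar>g x\<bar> * dev i n \<omega> (sacc i x)" unfolding dev_cmult by simp
  also have "dev i n \<omega> (\<lambda>y. sacc i x y * g y) + \<bar>g x\<bar> * dev i n \<omega> (same x) + \<bar>g x\<bar> * dev i n \<omega> (sacc i x)
      \<le> dev i n \<omega> (\<lambda>y. sacc i x y * g y) + G * dev i n \<omega> (same x) + G * dev i n \<omega> (sacc i x)"
    using G[OF x] by (intro add_mono mult_right_mono order.refl) (auto simp: dev_def)
  finally show ?thesis .
qed

text \<open>The acceptance functions depend on the current state only through its energy set and the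
  single number \<open>w i x\<close>, hence they admit finite brackets of arbitrarily small mass.\<close>

lemma acceptance_brackets:
  assumes i: "i < K" and eta: "\<eta> > 0"
  shows "\<exists>F. finite F \<and> F \<subseteq> bfun M \<times> bfun M \<and>
    (\<forall>x\<in>space M. \<exists>(u, b)\<in>F. (\<integral>y. b y \<partial>\<pi> (Suc i)) \<le> \<eta> \<and> (\<forall>y\<in>space M. \<bar>sacc i x y - u y\<bar> \<le> b y))"
proof -
  have Si: "Suc i \<le> K" using i by simp
  interpret p: prob_space "\<pi> (Suc i)" by (rule prob_pi[OF Si])
  obtain W where W: "W > 0" "\<And>x. w i x \<le> W" using w_bounded[OF i] by blast
  define E where "E = (\<lambda>d::real. {y\<in>space M. w i y < d})"
  have E[measurable]: "E d \<in> sets M" for d unfolding E_def by measurable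
  have "(\<lambda>k::nat. measure (\<pi> (Suc i)) (E (1 / real (Suc k)))) \<longlonglongrightarrow> measure (\<pi> (Suc i)) (\<Inter>k. E (1 / real (Suc k)))"
  proof (rule p.finite_Lim_measure_decseq)
    show "decseq (\<lambda>k. E (1 / real (Suc k)))"
    proof (rule decseq_SucI, rule subsetI)
      fix k y assume "y \<in> E (1 / real (Suc (Suc k)))"
      moreover have "1 / real (Suc (Suc k)) \<le> 1 / real (Suc k)" by (simp add: frac_le)
      ultimately show "y \<in> E (1 / real (Suc k))" unfolding E_def by auto
    qed
  qed auto
  moreover have "(\<Inter>k. E (1 / real (Suc k))) = {}"
  proof (rule equals0I)
    fix y assume y: "y \<in> (\<Inter>k. E (1 / real (Suc k)))"
    obtain k where "1 / real (Suc k) < w i y" using w_pos[of i y] by (metis nat_approx_posE)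
    then show False using y by (auto simp: E_def dest!: spec[of _ k])
  qed
  ultimately have "(\<lambda>k::nat. measure (\<pi> (Suc i)) (E (1 / real (Suc k)))) \<longlonglongrightarrow> 0" by simp
  from LIMSEQ_D[OF this eta] obtain k0 where k0: "measure (\<pi> (Suc i)) (E (1 / real (Suc k0))) < \<eta>" by auto
  define \<delta> where "\<delta> = 1 / real (Suc k0)"
  have \<delta>: "\<delta> > 0" "measure (\<pi> (Suc i)) (E \<delta>) \<le> \<eta>" using k0 by (auto simp: \<delta>_def)
  define mesh where "mesh = \<delta> * \<eta>"
  have mesh: "mesh > 0" using \<delta> eta by (simp add: mesh_def)
  define kmax where "kmax = nat \<lceil>W / mesh\<rceil>"
  define U where "U = (\<lambda>(j, k). (\<lambda>y. indicator (D j) y * min 1 (w i y / (real k * mesh)) :: real))"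
  define F1 where "F1 = (\<lambda>jk. (U jk, \<lambda>_::'a. \<eta>)) ` ({..K} \<times> {1..kmax})"
  define F2 where "F2 = (\<lambda>j. (indicator (D j) :: 'a \<Rightarrow> real, indicator (E \<delta>) :: 'a \<Rightarrow> real)) ` {..K}"
  have Ub: "U (j, k) \<in> bfun M" if "k \<ge> 1" for j k
  proof (rule bfunI[where C=1])
    show "U (j, k) \<in> borel_measurable M" unfolding U_def by simp measurable
    show "\<bar>U (j, k) y\<bar> \<le> 1" for y
      using w_pos[of i y] mesh that by (auto simp: U_def indicator_def min_def)
  qed
  have "finite (F1 \<union> F2)" by (simp add: F1_def F2_def)
  moreover have "F1 \<union> F2 \<subseteq> bfun M \<times> bfun M"
    unfolding F1_def F2_def using Ub by (auto intro!: bfun_indicator)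
  moreover have "\<exists>(u, b)\<in>F1 \<union> F2. (\<integral>y. b y \<partial>\<pi> (Suc i)) \<le> \<eta> \<and> (\<forall>y\<in>space M. \<bar>sacc i x y - u y\<bar> \<le> b y)" if x: "x \<in> space M" for x
  proof (cases "w i x < \<delta>")
    case True
    have "(indicator (D (I x)), indicator (E \<delta>)) \<in> F1 \<union> F2" using I_le[OF x] by (auto simp: F2_def)
    moreover have "(\<integral>y. indicator (E \<delta>) y \<partial>\<pi> (Suc i)) \<le> \<eta>" using \<delta>(2) sets.sets_into_space[OF E[of \<delta>]] by (simp add: Int_absorb2)
    moreover have "\<bar>sacc i x y - indicator (D (I x)) y\<bar> \<le> indicator (E \<delta>) y" if y: "y \<in> space M" for y
    proof (cases "w i y < \<delta>")
      case True
      then show ?thesis using y acc_bounds[of i x y] unfolding sacc_def same_eq[OF x y] by (auto simp: E_def indicator_def)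
    next
      case False
      then have "acc i x y = 1" using \<open>w i x < \<delta>\<close> w_pos[of i x] by (simp add: acc_w min_def)
      then show ?thesis unfolding sacc_def same_eq[OF x y] by simp
    qed
    ultimately show ?thesis by blast
  next
    case False
    define s where "s = w i x"
    have s: "\<delta> \<le> s" "s \<le> W" using False W(2) by (auto simp: s_def)
    have s0: "s > 0" using s \<delta> by linarith
    define k where "k = nat \<lceil>s / mesh\<rceil>"
    have sm: "s / mesh > 0" using s0 mesh by simp
    have k1: "s / mesh \<le> real k" "real k \<le> s / mesh + 1" using sm unfolding k_def by linarith+
    have kp: "k \<ge> 1" using k1 sm by (cases k) auto
    have "s / mesh \<le> W / mesh" using s mesh by (intro divide_right_mono) auto
    then have kk: "k \<le> kmax" unfolding k_def kmax_def by (intro nat_mono ceiling_mono)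
    define r where "r = real k * mesh"
    have r1: "s \<le> r" using k1(1) mesh by (simp add: r_def divide_le_eq)
    have r2: "r \<le> (1 + \<eta>) * s"
    proof -
      have "r \<le> (s / mesh + 1) * mesh" unfolding r_def using k1(2) mesh by (intro mult_right_mono) auto
      also have "\<dots> = s + \<delta> * \<eta>" using \<delta>(1) eta by (simp add: distrib_right mesh_def)
      also have "\<dots> \<le> s + s * \<eta>" using s eta by (intro add_left_mono mult_right_mono) auto
      finally show ?thesis by (simp add: algebra_simps)
    qed
    have r0: "r > 0" using r1 s0 by linarith
    have "(U (I x, k), \<lambda>_. \<eta>) \<in> F1 \<union> F2" using I_le[OF x] kk kp by (auto simp: F1_def)
    moreover have "(\<integral>y. \<eta> \<partial>\<pi> (Suc i)) \<le> \<eta>" using p.prob_space by simp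
    moreover have "\<bar>sacc i x y - U (I x, k) y\<bar> \<le> \<eta>" if y: "y \<in> space M" for y
    proof -
      let ?v = "w i y"
      have v: "?v > 0" by (rule w_pos)
      have a: "?v / r \<le> ?v / s" using r1 s0 v by (intro divide_left_mono) auto
      have b: "?v / s \<le> (1 + \<eta>) * (?v / r)"
      proof -
        have "?v * r \<le> ?v * ((1 + \<eta>) * s)" using r2 v by (intro mult_left_mono) auto
        then show ?thesis using s0 r0 by (simp add: field_simps)
      qed
      have "min 1 (?v / s) \<le> min 1 (?v / r) + \<eta>"
      proof (cases "?v / r \<le> 1")
        case True
        have "\<eta> * (?v / r) \<le> \<eta> * 1" using True eta by (intro mult_left_mono) auto
        moreover have "(1 + \<eta>) * (?v / r) = ?v / r + \<eta> * (?v / r)" by (simp only: distrib_right mult_1)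
        ultimately have "?v / s \<le> ?v / r + \<eta>" using b by linarith
        then show ?thesis using True by simp
      next
        case False
        have "min 1 (?v / s) \<le> 1" by (rule min.cobounded1)
        moreover have "min 1 (?v / r) = 1" using False by simp
        ultimately show ?thesis using eta by linarith
      qed
      moreover have "min 1 (?v / r) \<le> min 1 (?v / s)" using a by (intro min.mono) auto
      ultimately have d: "\<bar>min 1 (?v / s) - min 1 (?v / r)\<bar> \<le> \<eta>" by linarith
      have "\<bar>sacc i x y - U (I x, k) y\<bar> = indicator (D (I x)) y * \<bar>min 1 (?v / s) - min 1 (?v / r)\<bar>"
        unfolding sacc_def same_eq[OF x y] acc_w U_def s_def[symmetric] r_def[symmetric] by (simp add: indicator_def r_def)
      also have "\<dots> \<le> \<eta>" using d eta by (simp add: indicator_def)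
      finally show ?thesis .
    qed
    ultimately show ?thesis by blast
  qed
  ultimately show ?thesis by blast
qed

lemma step_error_tendsto:
  assumes i: "i < K" and l: "lln (Suc i)" and g: "g \<in> bfun M"
  shows "step_error i (lim_op i) g \<longlonglongrightarrow> 0"
proof (rule LIMSEQ_I)
  fix e :: real assume e: "e > 0"
  have Si: "Suc i \<le> K" and ii: "i \<le> K" using i by auto
  obtain G where G: "G > 0" "\<forall>x\<in>space M. \<bar>g x\<bar> \<le> G" using bfun_bounded[OF g] by blast
  have G': "\<bar>g x\<bar> \<le> G" if "x \<in> space M" for x using G(2) that by blast
  obtain c where c: "c > 0" "\<forall>j\<in>{..K}. c \<le> mass i j" using mass_lower[OF i] by blast
  define \<eta> where "\<eta> = e * c / (8 * G)"
  have \<eta>: "\<eta> > 0" using e c G by (simp add: \<eta>_def)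
  obtain F where F: "finite F" "F \<subseteq> bfun M \<times> bfun M"
    and br: "\<forall>x\<in>space M. \<exists>(u, b)\<in>F. (\<integral>y. b y \<partial>\<pi> (Suc i)) \<le> \<eta> \<and> (\<forall>y\<in>space M. \<bar>sacc i x y - u y\<bar> \<le> b y)"
    using acceptance_brackets[OF i \<eta>] by blast
  define A where "A = (\<lambda>n \<omega>. \<Sum>p\<in>F. dev i n \<omega> (\<lambda>y. fst p y * g y) + G * dev i n \<omega> (fst p) + 2 * G * dev i n \<omega> (snd p))"
  define Z where "Z = (\<lambda>n \<omega>. \<Sum>j\<le>K. 3 * G * dev i n \<omega> (indicator (D j)))"
  have Fb: "fst p \<in> bfun M" "snd p \<in> bfun M" if "p \<in> F" for p using F(2) that by auto
  have Ab: "A n \<in> bfun \<Omega>" for n unfolding A_def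
    by (intro bfun_sum bfun_add bfun_mult[OF bfun_const] dev_bfun bfun_mult Fb g)
  have Zb: "Z n \<in> bfun \<Omega>" for n unfolding Z_def
    by (intro bfun_sum bfun_mult[OF bfun_const] dev_bfun bfun_indicator D_sets)
  have dev0: "0 \<le> dev i n \<omega> u" for n \<omega> u by (simp add: dev_def)
  have pt: "\<bar>(\<integral>z. g z \<partial>nxt i n \<omega>) - lim_op i g (\<omega> i n)\<bar> \<le> (1 / c) * (A n \<omega> + Z n \<omega>) + e / 2" if \<omega>: "\<omega> \<in> space \<Omega>" for n \<omega>
  proof -
    define x where "x = \<omega> i n"
    have x: "x \<in> space M" unfolding x_def by (rule coord_space[OF \<omega>])
    obtain u b where ub: "(u, b) \<in> F" "(\<integral>y. b y \<partial>\<pi> (Suc i)) \<le> \<eta>" "\<forall>y\<in>space M. \<bar>sacc i x y - u y\<bar> \<le> b y"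
      using br x by blast
    have u: "u \<in> bfun M" and b: "b \<in> bfun M" using Fb[OF ub(1)] by auto
    have m: "c \<le> mass i (I x)" using c I_le[OF x] by simp
    have d1: "dev i n \<omega> (sacc i x) \<le> dev i n \<omega> u + dev i n \<omega> b + 2 * \<eta>"
      using dev_bracket[OF Si \<omega> sacc_bfun[OF x] u b, of i n] ub(2,3) by force
    have d2: "dev i n \<omega> (\<lambda>y. sacc i x y * g y) \<le> dev i n \<omega> (\<lambda>y. u y * g y) + G * dev i n \<omega> b + 2 * (G * \<eta>)"
    proof -
      have "dev i n \<omega> (\<lambda>y. sacc i x y * g y) \<le> dev i n \<omega> (\<lambda>y. u y * g y) + dev i n \<omega> (\<lambda>y. G * b y) + 2 * (\<integral>y. G * b y \<partial>\<pi> (Suc i))"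
      proof (rule dev_bracket[OF Si \<omega>])
        fix y assume y: "y \<in> space M"
        have "\<bar>sacc i x y - u y\<bar> * \<bar>g y\<bar> \<le> b y * G" using ub(3) y G' by (intro mult_mono') auto
        then show "\<bar>sacc i x y * g y - u y * g y\<bar> \<le> G * b y"
          unfolding left_diff_distrib[symmetric] abs_mult by (simp only: mult.commute)
      qed (auto intro!: sacc_bfun x g u b)
      moreover have "(\<integral>y. G * b y \<partial>\<pi> (Suc i)) \<le> G * \<eta>" using ub(2) G by simp
      moreover have "dev i n \<omega> (\<lambda>y. G * b y) = G * dev i n \<omega> b" unfolding dev_cmult using G by simp
      ultimately show ?thesis by linarith
    qed
    have ds: "dev i n \<omega> (same x) = dev i n \<omega> (indicator (D (I x)))"
    proof -
      have "avg i n \<omega> (same x) = avg i n \<omega> (indicator (D (I x)))"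
        unfolding avg_def using same_eq[OF x coord_space[OF \<omega>]] by simp
      moreover have "(\<integral>y. same x y \<partial>\<pi> (Suc i)) = (\<integral>y. indicator (D (I x)) y \<partial>\<pi> (Suc i))"
        using same_eq[OF x] by (intro Bochner_Integration.integral_cong) auto
      ultimately show ?thesis unfolding dev_def by simp
    qed
    have "3 * G * dev i n \<omega> (indicator (D (I x))) \<le> Z n \<omega>"
      unfolding Z_def using I_le[OF x] G dev0 by (intro member_le_sum[of "I x" "{..K}"]) auto
    then have z: "3 * G * dev i n \<omega> (same x) \<le> Z n \<omega>" by (simp add: ds)
    have a: "dev i n \<omega> (\<lambda>y. u y * g y) + G * dev i n \<omega> u + 2 * G * dev i n \<omega> b \<le> A n \<omega>"
    proof -
      have "(\<lambda>p. dev i n \<omega> (\<lambda>y. fst p y * g y) + G * dev i n \<omega> (fst p) + 2 * G * dev i n \<omega> (snd p)) (u, b) \<le> A n \<omega>"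
        unfolding A_def using F(1) ub(1) G dev0 by (intro member_le_sum) auto
      then show ?thesis by simp
    qed
    have "dev i n \<omega> (jump_fun i g x) + 2 * G * dev i n \<omega> (same x)
        \<le> dev i n \<omega> (\<lambda>y. sacc i x y * g y) + G * dev i n \<omega> (sacc i x) + 3 * G * dev i n \<omega> (same x)"
      using dev_jump_fun_le[OF i g G' x, of n \<omega>] by (simp add: algebra_simps)
    also have "\<dots> \<le> (dev i n \<omega> (\<lambda>y. u y * g y) + G * dev i n \<omega> b + 2 * (G * \<eta>)) + G * (dev i n \<omega> u + dev i n \<omega> b + 2 * \<eta>) + Z n \<omega>"
      using d1 d2 z G by (intro add_mono mult_left_mono) auto
    also have "\<dots> = (dev i n \<omega> (\<lambda>y. u y * g y) + G * dev i n \<omega> u + 2 * G * dev i n \<omega> b) + Z n \<omega> + 4 * G * \<eta>"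
      by (simp add: algebra_simps)
    also have "\<dots> \<le> A n \<omega> + Z n \<omega> + 4 * G * \<eta>" using a by simp
    finally have num: "dev i n \<omega> (jump_fun i g x) + 2 * G * dev i n \<omega> (same x) \<le> A n \<omega> + Z n \<omega> + 4 * G * \<eta>" .
    have "\<bar>(\<integral>z. g z \<partial>nxt i n \<omega>) - lim_op i g x\<bar> \<le> (dev i n \<omega> (jump_fun i g x) + 2 * G * dev i n \<omega> (same x)) / mass i (I x)"
      unfolding x_def by (rule next_error_le[OF i \<omega> g G'])
    also have "\<dots> \<le> (A n \<omega> + Z n \<omega> + 4 * G * \<eta>) / c"
      using num m c dev0 G by (intro frac_le) (auto intro: add_nonneg_nonneg order.trans[OF _ num])
    also have "\<dots> = (1 / c) * (A n \<omega> + Z n \<omega>) + e / 2" using c G by (simp add: \<eta>_def field_simps)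
    finally show ?thesis unfolding x_def .
  qed
  have lim: "(\<lambda>n. \<integral>\<omega>. A n \<omega> + Z n \<omega> \<partial>law (start i + n)) \<longlonglongrightarrow> 0"
  proof -
    have dt: "(\<lambda>n. \<integral>\<omega>. dev i n \<omega> v \<partial>law (start i + n)) \<longlonglongrightarrow> 0" if "v \<in> bfun M" for v
      by (rule dev_tendsto[OF i l that])
    have di: "integrable (law t) (\<lambda>\<omega>. dev i n \<omega> v)" if "v \<in> bfun M" for v n t
      by (rule integrable_law[OF dev_bfun[OF that]])
    have gF: "(\<lambda>y. fst p y * g y) \<in> bfun M" if "p \<in> F" for p using Fb(1)[OF that] g by auto
    have Ai: "(\<integral>\<omega>. A n \<omega> \<partial>law (start i + n)) = (\<Sum>p\<in>F. (\<integral>\<omega>. dev i n \<omega> (\<lambda>y. fst p y * g y) \<partial>law (start i + n))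
        + G * (\<integral>\<omega>. dev i n \<omega> (fst p) \<partial>law (start i + n)) + 2 * G * (\<integral>\<omega>. dev i n \<omega> (snd p) \<partial>law (start i + n)))" for n
    proof -
      have "(\<integral>\<omega>. A n \<omega> \<partial>law (start i + n)) = (\<Sum>p\<in>F. \<integral>\<omega>. dev i n \<omega> (\<lambda>y. fst p y * g y) + G * dev i n \<omega> (fst p) + 2 * G * dev i n \<omega> (snd p) \<partial>law (start i + n))"
        unfolding A_def using di gF Fb by (intro Bochner_Integration.integral_sum) auto
      also have "\<dots> = (\<Sum>p\<in>F. (\<integral>\<omega>. dev i n \<omega> (\<lambda>y. fst p y * g y) \<partial>law (start i + n))
        + G * (\<integral>\<omega>. dev i n \<omega> (fst p) \<partial>law (start i + n)) + 2 * G * (\<integral>\<omega>. dev i n \<omega> (snd p) \<partial>law (start i + n)))"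
        using di gF Fb by (intro sum.cong refl) simp
      finally show ?thesis .
    qed
    have Zi: "(\<integral>\<omega>. Z n \<omega> \<partial>law (start i + n)) = (\<Sum>j\<le>K. 3 * G * (\<integral>\<omega>. dev i n \<omega> (indicator (D j)) \<partial>law (start i + n)))" for n
    proof -
      have "(\<integral>\<omega>. Z n \<omega> \<partial>law (start i + n)) = (\<Sum>j\<le>K. \<integral>\<omega>. 3 * G * dev i n \<omega> (indicator (D j)) \<partial>law (start i + n))"
        unfolding Z_def using di[OF bfun_indicator[OF D_sets]] by (intro Bochner_Integration.integral_sum) auto
      then show ?thesis by simp
    qed
    have "(\<lambda>n. \<integral>\<omega>. A n \<omega> \<partial>law (start i + n)) \<longlonglongrightarrow> (\<Sum>p\<in>F. 0 + G * 0 + 2 * G * 0)"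
      unfolding Ai by (intro tendsto_sum tendsto_add tendsto_mult tendsto_const dt gF Fb)
    moreover have "(\<lambda>n. \<integral>\<omega>. Z n \<omega> \<partial>law (start i + n)) \<longlonglongrightarrow> (\<Sum>j\<le>K. 3 * G * 0)"
      unfolding Zi by (intro tendsto_sum tendsto_mult tendsto_const dt bfun_indicator D_sets)
    ultimately have "(\<lambda>n. (\<integral>\<omega>. A n \<omega> \<partial>law (start i + n)) + (\<integral>\<omega>. Z n \<omega> \<partial>law (start i + n))) \<longlonglongrightarrow> 0 + 0"
      by (intro tendsto_add) auto
    then show ?thesis using integrable_law[OF Ab] integrable_law[OF Zb] by simp
  qed
  have "e * c / 2 > 0" using e c by simp
  from LIMSEQ_D[OF lim this] obtain n0 where n0: "\<And>n. n \<ge> n0 \<Longrightarrow> \<bar>\<integral>\<omega>. A n \<omega> + Z n \<omega> \<partial>law (start i + n)\<bar> < e * c / 2" by auto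
  show "\<exists>no. \<forall>n\<ge>no. norm (step_error i (lim_op i) g n - 0) < e"
  proof (intro exI allI impI)
    fix n assume n: "n \<ge> n0"
    interpret l: prob_space "law (start i + n)" by (rule prob_law)
    have "step_error i (lim_op i) g n \<le> (\<integral>\<omega>. (1 / c) * (A n \<omega> + Z n \<omega>) + e / 2 \<partial>law (start i + n))"
      unfolding step_error_def
      by (intro integral_mono_law bfun_abs bfun_diff nxt_integral_meas[OF ii g] coord_bfun lim_op_bfun[OF i g]
          bfun_add bfun_mult[OF bfun_const] Ab Zb bfun_const pt)
    also have "\<dots> = (1 / c) * (\<integral>\<omega>. A n \<omega> + Z n \<omega> \<partial>law (start i + n)) + e / 2"
      using integrable_law[OF bfun_add[OF Ab Zb]] l.prob_space by simp
    also have "\<dots> < (1 / c) * (e * c / 2) + e / 2"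
      using n0[OF n] c by (intro add_strict_right_mono mult_strict_left_mono) (auto simp: abs_less_iff)
    also have "\<dots> = e" using c by simp
    finally have "step_error i (lim_op i) g n < e" .
    moreover have "0 \<le> step_error i (lim_op i) g n" unfolding step_error_def by simp
    ultimately show "norm (step_error i (lim_op i) g n - 0) < e" by simp
  qed
qed

lemma mixing_step:
  assumes i: "i < K" and l: "lln (Suc i)"
  shows "mixing i"
proof (rule mixingI[of i "lim_op i"])
  show "i \<le> K" using i by simp
  show "lim_op i g \<in> bfun M" if "g \<in> bfun M" for g by (rule lim_op_bfun[OF i that])
  show "step_error i (lim_op i) g \<longlonglongrightarrow> 0" if "g \<in> bfun M" for g by (rule step_error_tendsto[OF i l that])
  fix g and e :: real assume g: "g \<in> bfun M" and e: "e > 0"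
  obtain k where k: "\<forall>x\<in>space M. \<bar>(lim_op i ^^ k) g x - (\<integral>x. g x \<partial>\<pi> i)\<bar> \<le> e" using lim_op_uniform[OF i g e] by blast
  have "(\<integral>\<omega>. \<bar>(lim_op i ^^ k) g (\<omega> i m) - (\<integral>x. g x \<partial>\<pi> i)\<bar> \<partial>law (start i + m)) \<le> e" for m
  proof -
    have "\<bar>\<integral>\<omega>. \<bar>(lim_op i ^^ k) g (\<omega> i m) - (\<integral>x. g x \<partial>\<pi> i)\<bar> \<partial>law (start i + m)\<bar> \<le> e"
      using k coord_space by (intro prob_space.abs_integral_le_bound[OF prob_law]) auto
    then show ?thesis by linarith
  qed
  then show "\<exists>k n0. \<forall>m\<ge>n0. (\<integral>\<omega>. \<bar>(lim_op i ^^ k) g (\<omega> i m) - (\<integral>x. g x \<partial>\<pi> i)\<bar> \<partial>law (start i + m)) \<le> e" by blast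
qed

lemma mixing_all: "i \<le> K \<Longrightarrow> mixing i"
proof (induction i rule: inc_induct)
  case base show ?case by (rule mixing_top)
next
  case (step i)
  then have "lln (Suc i)" by (intro mixing_imp_lln) auto
  then show ?case using step by (intro mixing_step) auto
qed

end


theorem theorem2:
  fixes M :: "'a measure" and h :: "'a \<Rightarrow> real" and K :: nat
    and H Tm :: "nat \<Rightarrow> real" and q :: "nat \<Rightarrow> 'a \<Rightarrow> 'a \<Rightarrow> real"
    and pee :: real and B N :: nat and x0 :: "nat \<Rightarrow> 'a"
  assumes sf: "sigma_finite_measure M"
    and h_meas: "h \<in> borel_measurable M"
    and H_mono: "\<forall>j<K. H j < H (Suc j)"
    and H0: "\<forall>x\<in>space M. H 0 \<le> h x"
    and T0: "Tm 0 = 1"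
    and T_mono: "\<forall>j<K. Tm j < Tm (Suc j)"
    and normalisable: "\<forall>i\<le>K. integrable M (ee_f h H Tm i)"
    and q_meas: "\<forall>i\<le>K. (\<lambda>(x, y). q i x y) \<in> borel_measurable (M \<Otimes>\<^sub>M M)"
    and q_nonneg: "\<forall>i\<le>K. \<forall>x\<in>space M. \<forall>y\<in>space M. 0 \<le> q i x y"
    and q_prob: "\<forall>i\<le>K. \<forall>x\<in>space M. (\<integral>\<^sup>+ y. ennreal (q i x y) \<partial>M) = 1"
    and pee: "0 < pee" "pee < 1"
    and x0: "\<forall>i\<le>K. x0 i \<in> space M"
    and irred: "irreducible_kernel M (ee_Tmh M h H Tm q K)"
    and aper: "aperiodic_kernel M (ee_Tmh M h H Tm q K)"
    and connect: "\<forall>i<K. \<forall>j\<le>K.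
        (0 < j \<longrightarrow> (\<exists>A1 B1. A1 \<in> sets M \<and> B1 \<in> sets M \<and>
            A1 \<subseteq> ee_D M h K H j \<and> B1 \<subseteq> ee_D M h K H (j - 1) \<and>
            emeasure M A1 > 0 \<and> emeasure M B1 > 0 \<and>
            kernel_set_trans M (ee_Tmh M h H Tm q i) A1 B1 > 0)) \<and>
        (j < K \<longrightarrow> (\<exists>A2 B2. A2 \<in> sets M \<and> B2 \<in> sets M \<and>
            A2 \<subseteq> ee_D M h K H j \<and> B2 \<subseteq> ee_D M h K H (Suc j) \<and>
            emeasure M A2 > 0 \<and> emeasure M B2 > 0 \<and>
            kernel_set_trans M (ee_Tmh M h H Tm q i) A2 B2 > 0))"
    and pos_mass: "\<forall>i\<le>K. \<forall>j\<le>K. measure (ee_pi M h H Tm i) (ee_D M h K H j) > 0"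
  shows "\<forall>i\<le>K. \<forall>A\<in>sets M.
           (\<lambda>n. measure (ee_dist M h K H Tm q pee B N x0 i n) A)
             \<longlonglongrightarrow> measure (ee_pi M h H Tm i) A"
proof -
  interpret ee_sampler M h K H Tm q pee B N x0
    by (rule ee_sampler.intro) (fact assms)+
  show ?thesis using mixing_convergence mixing_all by blast
qed

end
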